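(* Let $D=\sum_{s=1}^N\gamma_s\varpi_{i_s}[x_s]+\mu[\infty]$ be a $\Lambda$-valued divisor on $\mathbb{P}^1$, $\Lambda^+$-valued outside $\infty$ (as in the context), with $\mu=D|_\infty\in\Lambda$, such that $\lambda+\mu=\sum_{i=1}^{n-1}a_i\alpha_i$ with all $a_i\in\mathbb{Z}_{\ge0}$, where $\lambda=\sum_s\gamma_s\varpi_{i_s}$. Then there is a unique $\mathbb{C}$-algebra homomorphism $\Psi_D\colon Y_{-\mu}(\mathfrak{gl}_n)\to\mathcal{A}$ such that (all rational functions of $z$ expanded in $z^{-1}$) $$E_i(z)\mapsto-\sum_{r=1}^{a_i}\frac{P_{i-1}(p_{i,r}-1)Z_i(p_{i,r})}{(z-p_{i,r})P_{i,r}(p_{i,r})}e^{q_{i,r}},\qquad F_i(z)\mapsto\sum_{r=1}^{a_i}\frac{P_{i+1}(p_{i,r}+1)}{(z-p_{i,r}-1)P_{i,r}(p_{i,r})}e^{-q_{i,r}},$$ $$D_i(z)\mapsto\frac{P_i(z)}{P_{i-1}(z-1)}\prod_{0\le k<i}Z_k(z)=\frac{P_i(z)}{P_{i-1}(z-1)}\prod_{x\in\mathbb{C}}(z-x)^{-\epsilon^\vee_i(\lambda_x)}.$$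
   Context: Let $n\ge2$, $\Lambda=\bigoplus_{j=1}^n\mathbb{Z}\epsilon_j$, $\epsilon^\vee_j$ the dual basis, $\alpha^\vee_i=\epsilon^\vee_i-\epsilon^\vee_{i+1}$ ($1\le i<n$), $\alpha^\vee_0:=-\epsilon^\vee_1$, $\alpha_i=\epsilon_i-\epsilon_{i+1}$, $\varpi_i:=-\sum_{j=i+1}^n\epsilon_j$ ($0\le i\le n-1$). $\Lambda^+:=\{\nu\in\Lambda:\alpha^\vee_i(\nu)\ge0,\ 1\le i\le n-1\}$. A $\Lambda$-valued divisor on $\mathbb{P}^1$, $\Lambda^+$-valued outside $\infty$, is a formal sum $D=\sum_{s=1}^N\gamma_s\varpi_{i_s}[x_s]+\mu[\infty]$ with $N\ge0$, $0\le i_s\le n-1$, $x_s\in\mathbb{C}$, $\gamma_s=1$ if $i_s\ne0$ and $\gamma_s\in\{\pm1\}$ if $i_s=0$, and $\mu\in\Lambda$. Set $\lambda_x:=\sum_{s:x_s=x}\gamma_s\varpi_{i_s}$ for $x\in\mathbb{C}$. Put $a_0=a_n=0$. $\mathcal{A}$ is the associative $\mathbb{C}$-algebra generated by $p_{i,r},e^{\pm q_{i,r}},(p_{i,r}-p_{i,s}+m)^{-1}$ ($1\le i<n$, $1\le r\ne s\le a_i$, $m\in\mathbb{Z}$; the last being inverses of the indicated elements) with relations $[e^{\pm q_{i,r}},p_{j,s}]=\mp\delta_{i,j}\delta_{r,s}e^{\pm q_{i,r}}$, $[p_{i,r},p_{j,s}]=0=[e^{q_{i,r}},e^{q_{j,s}}]$,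 $e^{\pm q_{i,r}}e^{\mp q_{i,r}}=1$. $Z_i(z):=\prod_{s:i_s=i}(z-x_s)^{\gamma_s}$ ($0\le i\le n-1$), $P_j(z):=\prod_{r=1}^{a_j}(z-p_{j,r})$, $P_{j,r}(z):=\prod_{s\ne r}(z-p_{j,s})$, $P_0=P_n=1$. For $\nu\in\Lambda$ with $d_j:=\epsilon^\vee_j(\nu)$, $Y_\nu(\mathfrak{gl}_n)$ is the $\mathbb{C}$-algebra generated by $E_i^{(r)},F_i^{(r)}$ ($1\le i<n$, $r\ge1$), $D_i^{(s)}$ ($s\ge d_i$), $\widetilde D_i^{(s)}$ ($s\ge-d_i$) subject to: (Y0) $D_i^{(d_i)}=1$, $\sum_{t=d_i}^{r+d_i}D_i^{(t)}\widetilde D_i^{(r-t)}=-\delta_{r,0}$, $[D_i^{(r)},D_j^{(s)}]=0$; (Y1) $[E_i^{(r)},F_j^{(s)}]=-\delta_{i,j}\sum_{t=-d_i}^{r+s-1-d_{i+1}}\widetilde D_i^{(t)}D_{i+1}^{(r+s-t-1)}$; (Y2) $[D_i^{(r)},E_j^{(s)}]=(\delta_{i,j+1}-\delta_{i,j})\sum_{t=d_i}^{r-1}D_i^{(t)}E_j^{(r+s-t-1)}$; (Y3) $[D_i^{(r)},F_j^{(s)}]=(\delta_{i,j}-\delta_{i,j+1})\sum_{t=d_i}^{r-1}F_j^{(r+s-t-1)}D_i^{(t)}$; (Y4) $[E_i^{(r)},E_i^{(s)}]=\sum_{t=1}^{r-1}E_i^{(t)}E_i^{(r+s-t-1)}-\sum_{t=1}^{s-1}E_i^{(t)}E_i^{(r+s-t-1)}$;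 (Y5) $[F_i^{(r)},F_i^{(s)}]=\sum_{t=1}^{s-1}F_i^{(r+s-t-1)}F_i^{(t)}-\sum_{t=1}^{r-1}F_i^{(r+s-t-1)}F_i^{(t)}$; (Y6) $[E_i^{(r+1)},E_{i+1}^{(s)}]-[E_i^{(r)},E_{i+1}^{(s+1)}]=-E_i^{(r)}E_{i+1}^{(s)}$; (Y7) $[F_i^{(r+1)},F_{i+1}^{(s)}]-[F_i^{(r)},F_{i+1}^{(s+1)}]=F_{i+1}^{(s)}F_i^{(r)}$; (Y8),(Y9) $[E_i^{(r)},E_j^{(s)}]=0=[F_i^{(r)},F_j^{(s)}]$ if $|i-j|>1$; (Y10),(Y11) for $|i-j|=1$: $[E_i^{(r)},[E_i^{(s)},E_j^{(t)}]]+[E_i^{(s)},[E_i^{(r)},E_j^{(t)}]]=0$, and the same with $F$ in place of $E$. Generating series: $E_i(z)=\sum_{r\ge1}E_i^{(r)}z^{-r}$, $F_i(z)=\sum_{r\ge1}F_i^{(r)}z^{-r}$, $D_i(z)=\sum_{r\ge d_i}D_i^{(r)}z^{-r}$. *)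

theory Defs
  imports Complex_Main "HOL-Library.Poly_Mapping" "HOL-Computational_Algebra.Formal_Power_Series"
begin

datatype 'g word = Word "'g list"

fun unword :: "'g word \<Rightarrow> 'g list" where "unword (Word xs) = xs"

instantiation word :: (type) monoid_add
begin
definition zero_word_def: "0 = Word []"
definition plus_word_def: "u + v = Word (unword u @ unword v)"
instance
proof
  fix a b c :: "'a word"
  show "a + b + c = a + (b + c)" by (cases a; cases b; cases c) (simp add: plus_word_def)
  show "0 + a = a" by (cases a) (simp add: plus_word_def zero_word_def)
  show "a + 0 = a" by (cases a) (simp add: plus_word_def zero_word_def)
qed
end

type_synonym 'g freealg = "'g word \<Rightarrow>\<^sub>0 complex"

definition gen :: "'g \<Rightarrow> 'g freealg" where
  "gen g = Poly_Mapping.single (Word [g]) 1"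

definition cst :: "complex \<Rightarrow> 'g freealg" where
  "cst c = Poly_Mapping.single (Word []) c"

definition comm :: "'r::ring \<Rightarrow> 'r \<Rightarrow> 'r" where
  "comm x y = x * y - y * x"

definition over :: "'g set \<Rightarrow> 'g freealg \<Rightarrow> bool" where
  "over G x \<longleftrightarrow> (\<forall>w\<in>Poly_Mapping.keys x. set (unword w) \<subseteq> G)"

inductive_set ideal_gen :: "'r::ring_1 set \<Rightarrow> 'r set" for R where
  base: "r \<in> R \<Longrightarrow> r \<in> ideal_gen R"
| zero: "0 \<in> ideal_gen R"
| add: "a \<in> ideal_gen R \<Longrightarrow> b \<in> ideal_gen R \<Longrightarrow> a + b \<in> ideal_gen R"
| mult: "a \<in> ideal_gen R \<Longrightarrow> u * a * v \<in> ideal_gen R"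

text \<open>Generators: AP i r = p_{i,r}, AQ i r = e^{q_{i,r}}, AQi i r = e^{-q_{i,r}},
  AInv i r s m = (p_{i,r} - p_{i,s} + m)^{-1}.\<close>
datatype agen = AP nat nat | AQ nat nat | AQi nat nat | AInv nat nat nat int

definition Agens :: "nat \<Rightarrow> (nat \<Rightarrow> nat) \<Rightarrow> agen set" where
  "Agens n a =
     {AP i r | i r. 1 \<le> i \<and> i < n \<and> 1 \<le> r \<and> r \<le> a i}
   \<union> {AQ i r | i r. 1 \<le> i \<and> i < n \<and> 1 \<le> r \<and> r \<le> a i}
   \<union> {AQi i r | i r. 1 \<le> i \<and> i < n \<and> 1 \<le> r \<and> r \<le> a i}
   \<union> {AInv i r s m | i r s m. 1 \<le> i \<and> i < n \<and> 1 \<le> r \<and> r \<le> a i \<and> 1 \<le> s \<and> s \<le> a i \<and> r \<noteq> s}"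

abbreviation pp :: "nat \<Rightarrow> nat \<Rightarrow> agen freealg" where "pp i r \<equiv> gen (AP i r)"
abbreviation eq :: "nat \<Rightarrow> nat \<Rightarrow> agen freealg" where "eq i r \<equiv> gen (AQ i r)"
abbreviation eqi :: "nat \<Rightarrow> nat \<Rightarrow> agen freealg" where "eqi i r \<equiv> gen (AQi i r)"
abbreviation ainv :: "nat \<Rightarrow> nat \<Rightarrow> nat \<Rightarrow> int \<Rightarrow> agen freealg" where
  "ainv i r s m \<equiv> gen (AInv i r s m)"

definition Arels :: "nat \<Rightarrow> (nat \<Rightarrow> nat) \<Rightarrow> agen freealg set" where
  "Arels n a =
     {comm (eq i r) (pp j s) + (if i = j \<and> r = s then eq i r else 0) | i r j s.
        AP i r \<in> Agens n a \<and> AP j s \<in> Agens n a}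
   \<union> {comm (eqi i r) (pp j s) - (if i = j \<and> r = s then eqi i r else 0) | i r j s.
        AP i r \<in> Agens n a \<and> AP j s \<in> Agens n a}
   \<union> {comm (pp i r) (pp j s) | i r j s. AP i r \<in> Agens n a \<and> AP j s \<in> Agens n a}
   \<union> {comm (eq i r) (eq j s) | i r j s. AP i r \<in> Agens n a \<and> AP j s \<in> Agens n a}
   \<union> {eq i r * eqi i r - 1 | i r. AP i r \<in> Agens n a}
   \<union> {eqi i r * eq i r - 1 | i r. AP i r \<in> Agens n a}
   \<union> {ainv i r s m * (pp i r - pp i s + of_int m) - 1 | i r s m. AInv i r s m \<in> Agens n a}
   \<union> {(pp i r - pp i s + of_int m) * ainv i r s m - 1 | i r s m. AInv i r s m \<in> Agens n a}"

text \<open>\<A> = (free algebra on Agens) / AIdeal; x and y represent the same element iff x - y \<in> AIdeal.\<close>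
definition AIdeal :: "nat \<Rightarrow> (nat \<Rightarrow> nat) \<Rightarrow> agen freealg set" where
  "AIdeal n a = ideal_gen (Arels n a)"

section \<open>The shifted Yangian Y_\<nu>(gl_n), d i = \<epsilon>_i^\<or>(\<nu>)\<close>

text \<open>The defining relations (Y0)-(Y11), written as elements (required to vanish) evaluated at
  an assignment of the generators E_i^{(r)}, F_i^{(r)}, D_i^{(s)}, Dt_i^{(s)} in a ring.\<close>
definition Yrels :: "nat \<Rightarrow> (nat \<Rightarrow> int) \<Rightarrow> (nat \<Rightarrow> nat \<Rightarrow> 'r::ring_1) \<Rightarrow> (nat \<Rightarrow> nat \<Rightarrow> 'r)
    \<Rightarrow> (nat \<Rightarrow> int \<Rightarrow> 'r) \<Rightarrow> (nat \<Rightarrow> int \<Rightarrow> 'r) \<Rightarrow> 'r set" where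
  "Yrels n d E F D Dt =
     \<comment> \<open>(Y0)\<close>
     {D i (d i) - 1 | i. 1 \<le> i \<and> i \<le> n}
   \<union> {(\<Sum>t\<in>{d i..int r + d i}. D i t * Dt i (int r - t)) + (if r = 0 then 1 else 0) | i r.
        1 \<le> i \<and> i \<le> n}
   \<union> {comm (D i r) (D j s) | i j r s. 1 \<le> i \<and> i \<le> n \<and> 1 \<le> j \<and> j \<le> n \<and> d i \<le> r \<and> d j \<le> s}
     \<comment> \<open>(Y1)\<close>
   \<union> {comm (E i r) (F j s) + (if i = j then
          (\<Sum>t\<in>{- d i..int r + int s - 1 - d (i+1)}. Dt i t * D (i+1) (int r + int s - t - 1)) else 0)
        | i j r s. 1 \<le> i \<and> i < n \<and> 1 \<le> j \<and> j < n \<and> 1 \<le> r \<and> 1 \<le> s}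
     \<comment> \<open>(Y2)\<close>
   \<union> {comm (D i r) (E j s) - of_int ((if i = j + 1 then 1 else 0) - (if i = j then 1 else 0)) *
          (\<Sum>t\<in>{d i..r - 1}. D i t * E j (nat (r + int s - t - 1)))
        | i j r s. 1 \<le> i \<and> i \<le> n \<and> 1 \<le> j \<and> j < n \<and> d i \<le> r \<and> 1 \<le> s}
     \<comment> \<open>(Y3)\<close>
   \<union> {comm (D i r) (F j s) - of_int ((if i = j then 1 else 0) - (if i = j + 1 then 1 else 0)) *
          (\<Sum>t\<in>{d i..r - 1}. F j (nat (r + int s - t - 1)) * D i t)
        | i j r s. 1 \<le> i \<and> i \<le> n \<and> 1 \<le> j \<and> j < n \<and> d i \<le> r \<and> 1 \<le> s}
     \<comment> \<open>(Y4)\<close>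
   \<union> {comm (E i r) (E i s) - ((\<Sum>t\<in>{1..<r}. E i t * E i (r + s - t - 1))
          - (\<Sum>t\<in>{1..<s}. E i t * E i (r + s - t - 1)))
        | i r s. 1 \<le> i \<and> i < n \<and> 1 \<le> r \<and> 1 \<le> s}
     \<comment> \<open>(Y5)\<close>
   \<union> {comm (F i r) (F i s) - ((\<Sum>t\<in>{1..<s}. F i (r + s - t - 1) * F i t)
          - (\<Sum>t\<in>{1..<r}. F i (r + s - t - 1) * F i t))
        | i r s. 1 \<le> i \<and> i < n \<and> 1 \<le> r \<and> 1 \<le> s}
     \<comment> \<open>(Y6)\<close>
   \<union> {comm (E i (r+1)) (E (i+1) s) - comm (E i r) (E (i+1) (s+1)) + E i r * E (i+1) s
        | i r s. 1 \<le> i \<and> i + 1 < n \<and> 1 \<le> r \<and> 1 \<le> s}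
     \<comment> \<open>(Y7)\<close>
   \<union> {comm (F i (r+1)) (F (i+1) s) - comm (F i r) (F (i+1) (s+1)) - F (i+1) s * F i r
        | i r s. 1 \<le> i \<and> i + 1 < n \<and> 1 \<le> r \<and> 1 \<le> s}
     \<comment> \<open>(Y8), (Y9)\<close>
   \<union> {comm (E i r) (E j s) | i j r s. 1 \<le> i \<and> i < n \<and> 1 \<le> j \<and> j < n \<and> (i + 1 < j \<or> j + 1 < i)
        \<and> 1 \<le> r \<and> 1 \<le> s}
   \<union> {comm (F i r) (F j s) | i j r s. 1 \<le> i \<and> i < n \<and> 1 \<le> j \<and> j < n \<and> (i + 1 < j \<or> j + 1 < i)
        \<and> 1 \<le> r \<and> 1 \<le> s}
     \<comment> \<open>(Y10), (Y11)\<close>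
   \<union> {comm (E i r) (comm (E i s) (E j t)) + comm (E i s) (comm (E i r) (E j t))
        | i j r s t. 1 \<le> i \<and> i < n \<and> 1 \<le> j \<and> j < n \<and> (j = i + 1 \<or> i = j + 1)
        \<and> 1 \<le> r \<and> 1 \<le> s \<and> 1 \<le> t}
   \<union> {comm (F i r) (comm (F i s) (F j t)) + comm (F i s) (comm (F i r) (F j t))
        | i j r s t. 1 \<le> i \<and> i < n \<and> 1 \<le> j \<and> j < n \<and> (j = i + 1 \<or> i = j + 1)
        \<and> 1 \<le> r \<and> 1 \<le> s \<and> 1 \<le> t}"

text \<open>An assignment of the generators of Y_\<nu>(gl_n) to elements of \<A> defines a C-algebra
  homomorphism Y_\<nu>(gl_n) \<rightarrow> \<A> (universal property of the presented algebra):
  all images lie in \<A> and all defining relations hold in \<A>.\<close>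
definition Yhom :: "nat \<Rightarrow> (nat \<Rightarrow> nat) \<Rightarrow> (nat \<Rightarrow> int)
    \<Rightarrow> (nat \<Rightarrow> nat \<Rightarrow> agen freealg) \<Rightarrow> (nat \<Rightarrow> nat \<Rightarrow> agen freealg)
    \<Rightarrow> (nat \<Rightarrow> int \<Rightarrow> agen freealg) \<Rightarrow> (nat \<Rightarrow> int \<Rightarrow> agen freealg) \<Rightarrow> bool" where
  "Yhom n a d E F D Dt \<longleftrightarrow>
     (\<forall>i r. 1 \<le> i \<and> i < n \<and> 1 \<le> r \<longrightarrow> over (Agens n a) (E i r) \<and> over (Agens n a) (F i r))
   \<and> (\<forall>i s. 1 \<le> i \<and> i \<le> n \<and> d i \<le> s \<longrightarrow> over (Agens n a) (D i s))
   \<and> (\<forall>i s. 1 \<le> i \<and> i \<le> n \<and> - d i \<le> s \<longrightarrow> over (Agens n a) (Dt i s))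
   \<and> Yrels n d E F D Dt \<subseteq> AIdeal n a"

definition same_hom :: "nat \<Rightarrow> (nat \<Rightarrow> nat) \<Rightarrow> (nat \<Rightarrow> int)
    \<Rightarrow> (nat \<Rightarrow> nat \<Rightarrow> agen freealg) \<Rightarrow> (nat \<Rightarrow> nat \<Rightarrow> agen freealg)
    \<Rightarrow> (nat \<Rightarrow> int \<Rightarrow> agen freealg) \<Rightarrow> (nat \<Rightarrow> int \<Rightarrow> agen freealg)
    \<Rightarrow> (nat \<Rightarrow> nat \<Rightarrow> agen freealg) \<Rightarrow> (nat \<Rightarrow> nat \<Rightarrow> agen freealg)
    \<Rightarrow> (nat \<Rightarrow> int \<Rightarrow> agen freealg) \<Rightarrow> (nat \<Rightarrow> int \<Rightarrow> agen freealg) \<Rightarrow> bool" where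
  "same_hom n a d E F D Dt E' F' D' Dt' \<longleftrightarrow>
     (\<forall>i r. 1 \<le> i \<and> i < n \<and> 1 \<le> r \<longrightarrow> E i r - E' i r \<in> AIdeal n a \<and> F i r - F' i r \<in> AIdeal n a)
   \<and> (\<forall>i s. 1 \<le> i \<and> i \<le> n \<and> d i \<le> s \<longrightarrow> D i s - D' i s \<in> AIdeal n a)
   \<and> (\<forall>i s. 1 \<le> i \<and> i \<le> n \<and> - d i \<le> s \<longrightarrow> Dt i s - Dt' i s \<in> AIdeal n a)"

text \<open>Coordinates of \<Lambda> = Z^n: \<epsilon>_j^\<or>(\<varpi>_i) and \<epsilon>_j^\<or>(\<alpha>_i).\<close>
definition varpi :: "nat \<Rightarrow> nat \<Rightarrow> int" where
  "varpi i j = (if i < j then -1 else 0)"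
definition alpha :: "nat \<Rightarrow> nat \<Rightarrow> int" where
  "alpha i j = (if j = i then 1 else if j = i + 1 then -1 else 0)"

definition ac :: "nat \<Rightarrow> (nat \<Rightarrow> nat) \<Rightarrow> nat \<Rightarrow> nat" where
  "ac n a j = (if 1 \<le> j \<and> j < n then a j else 0)"

definition Pev :: "nat \<Rightarrow> (nat \<Rightarrow> nat) \<Rightarrow> nat \<Rightarrow> agen freealg \<Rightarrow> agen freealg" where
  "Pev n a j c = prod_list (map (\<lambda>t. c - pp j t) [1..<ac n a j + 1])"

definition invPir :: "(nat \<Rightarrow> nat) \<Rightarrow> nat \<Rightarrow> nat \<Rightarrow> agen freealg" where
  "invPir a i r = prod_list (map (\<lambda>s. ainv i r s 0) (filter (\<lambda>s. s \<noteq> r) [1..<a i + 1]))"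

text \<open>Z_i(c) for i \<ge> 1 (all exponents \<gamma>_s equal 1 there).\<close>
definition Zev :: "nat \<Rightarrow> (nat \<Rightarrow> nat) \<Rightarrow> (nat \<Rightarrow> complex) \<Rightarrow> nat \<Rightarrow> agen freealg \<Rightarrow> agen freealg" where
  "Zev N ii x i c = prod_list (map (\<lambda>s. c - cst (x s)) (filter (\<lambda>s. ii s = i) [1..<N + 1]))"

text \<open>Coefficient of z^{-k} (k \<ge> 1) in the expansion in z^{-1} of the image of E_i(z), F_i(z).\<close>
definition Eimg :: "nat \<Rightarrow> (nat \<Rightarrow> nat) \<Rightarrow> nat \<Rightarrow> (nat \<Rightarrow> nat) \<Rightarrow> (nat \<Rightarrow> complex)
    \<Rightarrow> nat \<Rightarrow> nat \<Rightarrow> agen freealg" where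
  "Eimg n a N ii x i k = - (\<Sum>r\<in>{1..a i}.
      Pev n a (i - 1) (pp i r - 1) * Zev N ii x i (pp i r) * invPir a i r * pp i r ^ (k - 1) * eq i r)"

definition Fimg :: "nat \<Rightarrow> (nat \<Rightarrow> nat) \<Rightarrow> nat \<Rightarrow> nat \<Rightarrow> agen freealg" where
  "Fimg n a i k = (\<Sum>r\<in>{1..a i}.
      Pev n a (i + 1) (pp i r + 1) * invPir a i r * (pp i r + 1) ^ (k - 1) * eqi i r)"

text \<open>Expansion in w = z^{-1}: (z - c) = z (1 - c w), (z - c)^{-1} = z^{-1} sum_k c^k w^k.\<close>
definition geom :: "'r::ring_1 \<Rightarrow> 'r fps" where
  "geom c = Abs_fps (\<lambda>k. c ^ k)"

text \<open>P_i(z) / P_{i-1}(z-1) * prod_{k<i} Z_k(z) = z^{Ddeg i} * Dser i (z^{-1}).\<close>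
definition Ddeg :: "nat \<Rightarrow> (nat \<Rightarrow> nat) \<Rightarrow> nat \<Rightarrow> (nat \<Rightarrow> nat) \<Rightarrow> (nat \<Rightarrow> int) \<Rightarrow> nat \<Rightarrow> int" where
  "Ddeg n a N ii \<gamma> i = int (ac n a i) - int (ac n a (i - 1)) + (\<Sum>s\<in>{s\<in>{1..N}. ii s < i}. \<gamma> s)"

definition Dser :: "nat \<Rightarrow> (nat \<Rightarrow> nat) \<Rightarrow> nat \<Rightarrow> (nat \<Rightarrow> nat) \<Rightarrow> (nat \<Rightarrow> int) \<Rightarrow> (nat \<Rightarrow> complex)
    \<Rightarrow> nat \<Rightarrow> agen freealg fps" where
  "Dser n a N ii \<gamma> x i =
     prod_list (map (\<lambda>r. 1 - fps_const (pp i r) * fps_X) [1..<ac n a i + 1])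
   * prod_list (map (\<lambda>r. geom (1 + pp (i - 1) r)) [1..<ac n a (i - 1) + 1])
   * prod_list (map (\<lambda>s. if \<gamma> s = 1 then 1 - fps_const (cst (x s)) * fps_X else geom (cst (x s)))
                    (filter (\<lambda>s. ii s < i) [1..<N + 1]))"

text \<open>Coefficient of z^{-r} (r \<in> Z) of the expansion of the image of D_i(z).\<close>
definition Dimg :: "nat \<Rightarrow> (nat \<Rightarrow> nat) \<Rightarrow> nat \<Rightarrow> (nat \<Rightarrow> nat) \<Rightarrow> (nat \<Rightarrow> int) \<Rightarrow> (nat \<Rightarrow> complex)
    \<Rightarrow> nat \<Rightarrow> int \<Rightarrow> agen freealg" where
  "Dimg n a N ii \<gamma> x i r =
     (if 0 \<le> r + Ddeg n a N ii \<gamma> i then fps_nth (Dser n a N ii \<gamma> x i) (nat (r + Ddeg n a N ii \<gamma> i)) else 0)"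

definition Psi_formulas :: "nat \<Rightarrow> (nat \<Rightarrow> nat) \<Rightarrow> (nat \<Rightarrow> int) \<Rightarrow> nat \<Rightarrow> (nat \<Rightarrow> nat)
    \<Rightarrow> (nat \<Rightarrow> int) \<Rightarrow> (nat \<Rightarrow> complex)
    \<Rightarrow> (nat \<Rightarrow> nat \<Rightarrow> agen freealg) \<Rightarrow> (nat \<Rightarrow> nat \<Rightarrow> agen freealg)
    \<Rightarrow> (nat \<Rightarrow> int \<Rightarrow> agen freealg) \<Rightarrow> bool" where
  "Psi_formulas n a d N ii \<gamma> x E F D \<longleftrightarrow>
     (\<forall>i k. 1 \<le> i \<and> i < n \<and> 1 \<le> k \<longrightarrow>
        E i k - Eimg n a N ii x i k \<in> AIdeal n a \<and> F i k - Fimg n a i k \<in> AIdeal n a)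
   \<and> (\<forall>i r. 1 \<le> i \<and> i \<le> n \<longrightarrow>
        (if d i \<le> r then D i r else 0) - Dimg n a N ii \<gamma> x i r \<in> AIdeal n a)"

end

(* Put the currents E_i^(k) = - sum_r A_ir p_ir^(k-1) e^(q_ir) and F_i^(k) = sum_r B_ir (p_ir + 1)^(k-1) e^(-q_ir)
   into a normal form in which coefficients from a commutative ring stand to the left of the shift
   operators. Every relation then becomes an identity between coefficients: for two (or three) currents
   of the same kind the coefficient of a product of shifts e_r e_s turns out to be antisymmetric in r and s,
   and so cancels; a single computation covers E (shift by 1, neighbour i - 1) and F (shift by -1 in the
   variable p + 1, neighbour i + 1). The relation (Y1) with i = j is the partial fraction expansion of
   P_{i+1}(z) P_{i-1}(z-1) Z_i(z) / (P_i(z) P_i(z-1)), whose poles p_ir and p_ir + 1 have pairwise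
   invertible differences, so that no field is needed. Uniqueness: (Y0) determines the images of the
   series inverse to D_i(z). *)

theory Submission
  imports Defs
begin

text \<open>The obstacle is to say where the coefficients live. \<open>Arels\<close> does not state
  that the generators (p_ir - p_is + m)^(-1) commute with each other, with the p_jt or, up to a
  shift, with e^(q_jt), and no basis of the algebra is at hand. All this is deduced from the
  relations for p and e^q: the coefficient ring is the bicommutant of the p_ir and the constants,
  and the shift of an inverse follows from that of its denominator. In such a ring nothing may be
  cancelled merely for being nonzero, not even 2. So antisymmetric sums are made to vanish by
  pairing their terms, and every division is a multiplication by a given inverse. The antisymmetry
  has one source. Moving e_r past the coefficient of e_s turns 1/(y_s - y_r) into 1/(y_s - y_r + h),
  where h is the shift. The factor y_r - y_s - h, which (Y4), (Y5), (Y10) and (Y11) all produce,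
  cancels it up to sign, and what remains is odd because of the factor 1/(y_r - y_s) alone.\<close>

section \<open>Currents with commutative coefficients\<close>

text \<open>Swapping the two summations would only give S = -S, which does not force S = 0 in a
  general ring. The induction pairs the terms (r, s) and (s, r) one by one; the diagonal has to
  vanish by itself for the same reason.\<close>

lemma sum_sum_antisym:
  fixes w :: "'i \<Rightarrow> 'i \<Rightarrow> 'r::ab_group_add"
  assumes "finite R" "\<And>r. r \<in> R \<Longrightarrow> w r r = 0"
    "\<And>r s. r \<in> R \<Longrightarrow> s \<in> R \<Longrightarrow> r \<noteq> s \<Longrightarrow> w r s = - w s r"
  shows "(\<Sum>r\<in>R. \<Sum>s\<in>R. w r s) = 0"
  using assms
proof (induction R rule: finite_induct)
  case empty
  show ?case by simp
next
  case (insert x F)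
  have "(\<Sum>s\<in>F. w x s) = (\<Sum>s\<in>F. - w s x)"
    by (rule sum.cong[OF refl], rule insert.prems(2)) (use insert.hyps in auto)
  moreover have "(\<Sum>r\<in>F. \<Sum>s\<in>F. w r s) = 0"
    by (rule insert.IH) (rule insert.prems; simp)+
  ultimately show ?case
    using insert.hyps insert.prems(1)[of x] by (simp add: sum.distrib sum_negf)
qed

text \<open>This is (x^k y^l - x^l y^k) / (x - y) written as a polynomial. Its two sums have the
  index ranges of the right-hand sides of (Y4) and (Y5), with indices counted from 0.\<close>

definition hker :: "nat \<Rightarrow> nat \<Rightarrow> 's \<Rightarrow> 's \<Rightarrow> 's::comm_ring_1" where
  "hker k l x y = (\<Sum>t<k. x ^ t * y ^ (k + l - 1 - t)) - (\<Sum>t<l. x ^ t * y ^ (k + l - 1 - t))"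

lemma hker_mult: "(x - y) * hker k l x y = x ^ k * y ^ l - x ^ l * y ^ k"
proof -
  have *: "(x - y) * (\<Sum>t<k. x ^ t * y ^ (k + l - 1 - t)) = (x ^ k - y ^ k) * y ^ l" for k l :: nat
  proof -
    have "(\<Sum>t<k. x ^ t * y ^ (k + l - 1 - t)) = (\<Sum>t<k. y ^ (k - Suc t) * x ^ t) * y ^ l"
      unfolding sum_distrib_right
    proof (rule sum.cong)
      fix t assume "t \<in> {..<k}"
      then have "k + l - 1 - t = (k - Suc t) + l" by simp
      then show "x ^ t * y ^ (k + l - 1 - t) = y ^ (k - Suc t) * x ^ t * y ^ l"
        by (simp only: power_add ac_simps)
    qed simp
    then show ?thesis by (simp add: power_diff_sumr2 mult.assoc)
  qed
  have "(x - y) * (\<Sum>t<l. x ^ t * y ^ (k + l - 1 - t)) = (x ^ l - y ^ l) * y ^ k"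
    using *[of l k] by (simp only: add.commute[of l k])
  then have "(x - y) * hker k l x y = (x ^ k - y ^ k) * y ^ l - (x ^ l - y ^ l) * y ^ k"
    by (simp only: hker_def right_diff_distrib[of "x - y"] *[of k l])
  then show ?thesis by (simp add: algebra_simps)
qed

text \<open>Only the terms with index between \<open>k\<close> and \<open>l\<close> survive in the
  difference, and t -> k + l - 1 - t maps this interval to itself.\<close>

lemma sum_lessThan_diff_reflect:
  fixes g :: "nat \<Rightarrow> 'a::ab_group_add"
  shows "(\<Sum>t<k. g t) - (\<Sum>t<l. g t) = (\<Sum>t<k. g (k + l - 1 - t)) - (\<Sum>t<l. g (k + l - 1 - t))"
proof -
  have *: "(\<Sum>t<k. g t) - (\<Sum>t<l. g t) = (\<Sum>t<k. g (k + l - 1 - t)) - (\<Sum>t<l. g (k + l - 1 - t))"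
    if "l \<le> k" for k l
  proof -
    have "{..<k} = {..<l} \<union> {l..<k}" using that by auto
    then have "(\<Sum>t<k. g' t) - (\<Sum>t<l. g' t) = (\<Sum>t\<in>{l..<k}. g' t)" for g' :: "nat \<Rightarrow> 'a"
      by (metis (no_types, lifting) sum.union_disjoint finite_atLeastLessThan finite_lessThan
          ivl_disj_int_one(2) add_diff_cancel_left')
    moreover have "(\<Sum>t\<in>{l..<k}. g t) = (\<Sum>t\<in>{l..<k}. g (k + l - 1 - t))"
      by (rule sum.reindex_bij_witness[where i = "\<lambda>t. k + l - 1 - t" and j = "\<lambda>t. k + l - 1 - t"]) auto
    ultimately show ?thesis by simp
  qed
  show ?thesis
    using *[of l k] *[of k l] by (cases "l \<le> k") (simp_all add: add.commute[of k l], metis minus_diff_eq)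
qed

text \<open>The reflection exchanges the exponents of \<open>x\<close> and \<open>y\<close>. The
  symmetry cannot be read off \<open>hker_mult\<close>, since x - y may be a zero divisor.\<close>

lemma hker_sym: "hker k l x y = hker k l y x"
proof -
  have "k + l - 1 - (k + l - 1 - t) = t" if "t < k \<or> t < l" for t
    using that by auto
  then show ?thesis
    unfolding hker_def
      sum_lessThan_diff_reflect[of "\<lambda>t. x ^ t * y ^ (k + l - 1 - t)" k l]
    by (simp add: mult.commute)
qed

lemma comm_sum_right: "comm X (sum b C) = (\<Sum>c\<in>C. comm X (b c))"
  by (simp add: comm_def sum_distrib_left sum_distrib_right sum_subtractf)

section \<open>Ring homomorphisms and the shift relations of a commutative coefficient ring\<close>

locale unital_hom =
  fixes \<iota> :: "'s::ring_1 \<Rightarrow> 'r::ring_1"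
  assumes \<iota>_add: "\<iota> (x + y) = \<iota> x + \<iota> y"
    and \<iota>_mult: "\<iota> (x * y) = \<iota> x * \<iota> y"
    and \<iota>_one: "\<iota> 1 = 1"
begin

lemma \<iota>_zero: "\<iota> 0 = 0"
  using \<iota>_add[of 0 0] by simp

lemma \<iota>_minus: "\<iota> (- x) = - \<iota> x"
  using \<iota>_add[of x "- x"] by (simp add: \<iota>_zero eq_neg_iff_add_eq_0 add.commute)

lemma \<iota>_diff: "\<iota> (x - y) = \<iota> x - \<iota> y"
  using \<iota>_add[of x "- y"] by (simp add: \<iota>_minus)

lemma \<iota>_sum: "\<iota> (sum g A) = (\<Sum>a\<in>A. \<iota> (g a))"
  by (induction A rule: infinite_finite_induct) (auto simp: \<iota>_zero \<iota>_add)

lemma \<iota>_of_nat: "\<iota> (of_nat k) = of_nat k"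
  by (induction k) (auto simp: \<iota>_zero \<iota>_add \<iota>_one)

lemma \<iota>_of_int: "\<iota> (of_int k) = of_int k"
  by (cases k) (auto simp: \<iota>_of_nat \<iota>_minus \<iota>_diff \<iota>_one)

lemma \<iota>_bracket: "\<iota> (comm x y) = comm (\<iota> x) (\<iota> y)"
  by (simp add: comm_def \<iota>_diff \<iota>_mult)

lemma \<iota>_power: "\<iota> (x ^ k) = \<iota> x ^ k"
  by (induction k) (simp_all add: \<iota>_one \<iota>_mult)

end

locale comm_hom = unital_hom \<iota> for \<iota> :: "'s::comm_ring_1 \<Rightarrow> 'r::ring_1"
begin

lemma \<iota>_comm: "\<iota> x * \<iota> y = \<iota> y * \<iota> x"
  by (simp flip: \<iota>_mult add: mult.commute)

text \<open>A relation between elements instead of an automorphism: the effect of \<open>e\<close>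
  is only needed on the expressions that occur, so no automorphism of the coefficient ring has to be
  constructed.\<close>

definition shift :: "'r \<Rightarrow> 's \<Rightarrow> 's \<Rightarrow> bool" where
  "shift e s s' \<longleftrightarrow> e * \<iota> s = \<iota> s' * e"

lemma shift_add: "shift e s s' \<Longrightarrow> shift e t t' \<Longrightarrow> shift e (s + t) (s' + t')"
  by (simp add: shift_def \<iota>_add algebra_simps)

lemma shift_diff: "shift e s s' \<Longrightarrow> shift e t t' \<Longrightarrow> shift e (s - t) (s' - t')"
  by (simp add: shift_def \<iota>_diff algebra_simps)

lemma shift_of_int: "shift e (of_int k) (of_int k)"
  by (simp add: shift_def \<iota>_of_int mult_of_int_commute)

lemma shift_zero: "shift e 0 0"
  using shift_of_int[of e 0] by simp

lemma shift_one: "shift e 1 1"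
  using shift_of_int[of e 1] by simp

lemma shift_mult:
  assumes "shift e s s'" "shift e t t'"
  shows "shift e (s * t) (s' * t')"
proof -
  have "e * \<iota> (s * t) = (e * \<iota> s) * \<iota> t" by (simp add: \<iota>_mult mult.assoc)
  also have "\<dots> = \<iota> s' * (e * \<iota> t)" using assms by (simp add: shift_def mult.assoc)
  also have "\<dots> = \<iota> (s' * t') * e" using assms by (simp add: shift_def \<iota>_mult mult.assoc)
  finally show ?thesis by (simp add: shift_def)
qed

lemma shift_power: "shift e s s' \<Longrightarrow> shift e (s ^ k) (s' ^ k)"
  by (induction k) (auto intro: shift_one shift_mult)

lemma shift_sum: "(\<And>x. x \<in> X \<Longrightarrow> shift e (g x) (g' x)) \<Longrightarrow> shift e (sum g X) (sum g' X)"
  by (induction X rule: infinite_finite_induct) (auto intro: shift_zero shift_add)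

lemma shift_prod: "(\<And>x. x \<in> X \<Longrightarrow> shift e (g x) (g' x)) \<Longrightarrow> shift e (prod g X) (prod g' X)"
  by (induction X rule: infinite_finite_induct) (auto intro: shift_one shift_mult)

text \<open>Multiply e q = q' e by v' on the left and by v on the right. This is how the shift
  operators are moved past the inverses of p_ir - p_is + m, for which the algebra imposes no
  commutation relation.\<close>

lemma shift_inverse:
  assumes "shift e q q'" "v * q = 1" "v' * q' = 1"
  shows "shift e v v'"
proof -
  have "\<iota> v' * (e * \<iota> q) * \<iota> v = \<iota> (v' * q') * e * \<iota> v"
    using assms(1) by (simp add: shift_def \<iota>_mult mult.assoc)
  moreover have "\<iota> v' * (e * \<iota> q) * \<iota> v = \<iota> v' * e * \<iota> (v * q)"
    by (simp add: mult.commute[of v] \<iota>_mult mult.assoc)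
  ultimately show ?thesis using assms by (simp add: shift_def \<iota>_one)
qed

section \<open>Products of currents in normal form\<close>

lemma current_mult:
  assumes "\<And>r s. r \<in> R \<Longrightarrow> s \<in> R' \<Longrightarrow> shift (e r) (G s) (G' r s)"
  shows "(\<Sum>r\<in>R. \<iota> (F r) * e r) * (\<Sum>s\<in>R'. \<iota> (G s) * f s)
    = (\<Sum>r\<in>R. \<Sum>s\<in>R'. \<iota> (F r * G' r s) * (e r * f s))"
  unfolding sum_product
proof (intro sum.cong refl)
  fix r s assume "r \<in> R" "s \<in> R'"
  then have "e r * \<iota> (G s) = \<iota> (G' r s) * e r" using assms by (simp add: shift_def)
  then show "\<iota> (F r) * e r * (\<iota> (G s) * f s) = \<iota> (F r * G' r s) * (e r * f s)"
    by (simp add: \<iota>_mult mult.assoc) (metis mult.assoc)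
qed

lemma current_commute:
  assumes "\<And>r s. r \<in> R \<Longrightarrow> s \<in> R' \<Longrightarrow> shift (e r) (G s) (G' r s)"
    and "\<And>r s. r \<in> R \<Longrightarrow> s \<in> R' \<Longrightarrow> shift (f s) (F r) (F' r s)"
    and "\<And>r s. r \<in> R \<Longrightarrow> s \<in> R' \<Longrightarrow> F r * G' r s = G s * F' r s"
    and "\<And>r s. r \<in> R \<Longrightarrow> s \<in> R' \<Longrightarrow> e r * f s = f s * e r"
  shows "comm (\<Sum>r\<in>R. \<iota> (F r) * e r) (\<Sum>s\<in>R'. \<iota> (G s) * f s) = 0"
proof -
  have "(\<Sum>s\<in>R'. \<iota> (G s) * f s) * (\<Sum>r\<in>R. \<iota> (F r) * e r)
    = (\<Sum>s\<in>R'. \<Sum>r\<in>R. \<iota> (G s * F' r s) * (f s * e r))"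
    by (rule current_mult) (use assms in blast)
  also have "\<dots> = (\<Sum>r\<in>R. \<Sum>s\<in>R'. \<iota> (F r * G' r s) * (e r * f s))"
    by (subst sum.swap, intro sum.cong refl) (simp add: assms(3,4))
  also have "\<dots> = (\<Sum>r\<in>R. \<iota> (F r) * e r) * (\<Sum>s\<in>R'. \<iota> (G s) * f s)"
    by (rule current_mult[symmetric]) (use assms in blast)
  finally show ?thesis by (simp add: comm_def)
qed

lemma double_current_antisym:
  assumes "finite R" "\<And>r. r \<in> R \<Longrightarrow> w r r = 0"
    "\<And>r s. r \<in> R \<Longrightarrow> s \<in> R \<Longrightarrow> r \<noteq> s \<Longrightarrow> w r s = - w s r"
    "\<And>r s. r \<in> R \<Longrightarrow> s \<in> R \<Longrightarrow> e r * e s = e s * e r"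
  shows "(\<Sum>r\<in>R. \<Sum>s\<in>R. \<iota> (w r s) * (e r * e s)) = 0"
proof (rule sum_sum_antisym)
  fix r s assume "r \<in> R" "s \<in> R" "r \<noteq> s"
  then have "w r s = - w s r" "e r * e s = e s * e r" using assms by blast+
  then show "\<iota> (w r s) * (e r * e s) = - (\<iota> (w s r) * (e s * e r))"
    by (simp add: \<iota>_minus)
qed (use assms in \<open>auto simp: \<iota>_zero\<close>)

text \<open>Here \<open>b\<close> is one summand of the current of an adjacent node. The suffix
  \<open>t\<close> marks a coefficient after \<open>e'\<close> has passed it, \<open>1\<close> after
  one \<open>e r\<close>, \<open>2\<close> after two. In normal form X X b, X b X and b X X carry
  the three products in \<open>G\<close>; the middle one occurs twice in a double commutator
  symmetrised in \<open>k\<close> and \<open>l\<close>. The powers of \<open>y\<close> then enter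
  only through y_r^k y_s^l + y_r^l y_s^k, which is symmetric in r and s, so the antisymmetry of
  \<open>G\<close> suffices.\<close>

lemma serre_current:
  assumes fin: "finite R"
    and A: "\<And>r s. r \<in> R \<Longrightarrow> s \<in> R \<Longrightarrow> shift (e r) (A s) (A1 r s)"
    and y: "\<And>r s. r \<in> R \<Longrightarrow> s \<in> R \<Longrightarrow> shift (e r) (y s) (y1 r s)"
    and At: "\<And>s. s \<in> R \<Longrightarrow> shift e' (A s) (At s)"
    and yt: "\<And>s. s \<in> R \<Longrightarrow> shift e' (y s) (y s)"
    and At1: "\<And>r s. r \<in> R \<Longrightarrow> s \<in> R \<Longrightarrow> shift (e r) (At s) (At1 r s)"
    and B1: "\<And>r. r \<in> R \<Longrightarrow> shift (e r) B (B1 r)"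
    and B2: "\<And>r s. r \<in> R \<Longrightarrow> s \<in> R \<Longrightarrow> shift (e r) (B1 s) (B2 r s)"
    and ee: "\<And>r s. r \<in> R \<Longrightarrow> s \<in> R \<Longrightarrow> e r * e s = e s * e r"
    and ee': "\<And>r. r \<in> R \<Longrightarrow> e' * e r = e r * e'"
    and y1: "\<And>r s. r \<in> R \<Longrightarrow> s \<in> R \<Longrightarrow> r \<noteq> s \<Longrightarrow> y1 r s = y s"
    and G: "\<And>r s. G r s = A r * A1 r s * B2 r s - 2 * (A r * B1 r * At1 r s) + B * At r * At1 r s"
    and G0: "\<And>r. r \<in> R \<Longrightarrow> G r r = 0"
    and G1: "\<And>r s. r \<in> R \<Longrightarrow> s \<in> R \<Longrightarrow> r \<noteq> s \<Longrightarrow> G r s = - G s r"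
    and X: "\<And>k. X k = (\<Sum>r\<in>R. \<iota> (A r * y r ^ k) * e r)"
    and b: "b = \<iota> B * e'"
  shows "comm (X k) (comm (X l) b) + comm (X l) (comm (X k) b) = 0"
proof -
  define XB where "XB k = (\<Sum>r\<in>R. \<iota> (A r * y r ^ k * B1 r) * e r)" for k
  define Xt where "Xt k = (\<Sum>r\<in>R. \<iota> (At r * y r ^ k) * e r)" for k
  define BXt where "BXt k = (\<Sum>r\<in>R. \<iota> (B * (At r * y r ^ k)) * e r)" for k
  have Xb: "X k * b = XB k * e'" for k
  proof -
    have "\<iota> (A r * y r ^ k) * e r * b = \<iota> (A r * y r ^ k * B1 r) * e r * e'" if "r \<in> R" for r
      using B1[OF that] unfolding b shift_def \<iota>_mult by (simp add: mult.assoc) (metis mult.assoc)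
    then show ?thesis by (simp add: X XB_def sum_distrib_right)
  qed
  have eX: "e' * X k = Xt k * e'" for k
  proof -
    have "e' * (\<iota> (A r * y r ^ k) * e r) = \<iota> (At r * y r ^ k) * e r * e'" if "r \<in> R" for r
      using shift_mult[OF At[OF that] shift_power[OF yt[OF that], of k]] ee'[OF that]
      unfolding shift_def by (metis mult.assoc)
    then show ?thesis by (simp add: X Xt_def sum_distrib_right sum_distrib_left)
  qed
  have bX: "b * X k = BXt k * e'" for k
  proof -
    have "b * X k = \<iota> B * Xt k * e'" by (simp add: b eX mult.assoc)
    also have "\<iota> B * Xt k = BXt k" by (simp add: Xt_def BXt_def sum_distrib_left \<iota>_mult mult.assoc)
    finally show ?thesis .
  qed
  have e1: "X k * XB l = (\<Sum>r\<in>R. \<Sum>s\<in>R. \<iota> (A r * y r ^ k * (A1 r s * y1 r s ^ l * B2 r s)) * (e r * e s))" for k l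
    unfolding X XB_def by (rule current_mult) (intro shift_mult shift_power A y B2)
  have e2: "XB k * Xt l = (\<Sum>r\<in>R. \<Sum>s\<in>R. \<iota> (A r * y r ^ k * B1 r * (At1 r s * y1 r s ^ l)) * (e r * e s))" for k l
    unfolding Xt_def XB_def by (rule current_mult) (intro shift_mult shift_power At1 y)
  have e3: "BXt k * Xt l = (\<Sum>r\<in>R. \<Sum>s\<in>R. \<iota> (B * (At r * y r ^ k) * (At1 r s * y1 r s ^ l)) * (e r * e s))" for k l
    unfolding Xt_def BXt_def by (rule current_mult) (intro shift_mult shift_power At1 y)
  have "comm (X k) (comm (X l) b) = (X k * XB l - XB k * Xt l - XB l * Xt k + BXt l * Xt k) * e'" for k l
  proof -
    have "comm (X k) (comm (X l) b) = X k * (X l * b) - X k * b * X l - X l * b * X k + b * X l * X k"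
      by (simp add: comm_def algebra_simps)
    also have "\<dots> = X k * (XB l * e') - XB k * e' * X l - XB l * e' * X k + BXt l * e' * X k"
      by (simp only: Xb bX)
    also have "\<dots> = (X k * XB l - XB k * Xt l - XB l * Xt k + BXt l * Xt k) * e'"
      by (simp add: mult.assoc eX left_diff_distrib distrib_right)
    finally show ?thesis .
  qed
  then have "comm (X k) (comm (X l) b) + comm (X l) (comm (X k) b)
    = ((X k * XB l - XB k * Xt l - XB l * Xt k + BXt l * Xt k) + (X l * XB k - XB l * Xt k - XB k * Xt l + BXt k * Xt l)) * e'"
    by (simp add: distrib_right)
  also have "(X k * XB l - XB k * Xt l - XB l * Xt k + BXt l * Xt k) + (X l * XB k - XB l * Xt k - XB k * Xt l + BXt k * Xt l)
    = (\<Sum>r\<in>R. \<Sum>s\<in>R. \<iota> (G r s * (y r ^ k * y1 r s ^ l + y r ^ l * y1 r s ^ k)) * (e r * e s))"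
    unfolding e1 e2 e3
    unfolding sum_subtractf[symmetric] sum.distrib[symmetric] left_diff_distrib[symmetric] distrib_right[symmetric]
      \<iota>_add[symmetric] \<iota>_diff[symmetric]
    by (intro sum.cong refl arg_cong2[where f = times] arg_cong[where f = \<iota>]) (simp add: G algebra_simps)
  also have "\<dots> = 0"
  proof (rule double_current_antisym[OF fin])
    fix r s assume rs: "r \<in> R" "s \<in> R" "r \<noteq> s"
    show "G r s * (y r ^ k * y1 r s ^ l + y r ^ l * y1 r s ^ k) = - (G s r * (y s ^ k * y1 s r ^ l + y s ^ l * y1 s r ^ k))"
      using rs y1[of r s] y1[of s r] G1[OF rs] by (simp add: algebra_simps)
  qed (use ee G0 in auto)
  finally show ?thesis by simp
qed

end

section \<open>Currents of one kind\<close>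

text \<open>\<open>nb i\<close> is the node whose variables enter the coefficients of node i. The
  conditions on \<open>nb\<close> say that this dependence goes one way only. They are tied to
  nonempty index sets because for E the map is the truncated \<open>i - 1\<close>, which fixes 0,
  where the index set is empty.\<close>

locale gklo_half = comm_hom \<iota> for \<iota> :: "'s::comm_ring_1 \<Rightarrow> 'r::ring_1" +
  fixes R :: "nat \<Rightarrow> nat set" and nb :: "nat \<Rightarrow> nat" and h :: int
    and y :: "nat \<Rightarrow> nat \<Rightarrow> 's" and v :: "nat \<Rightarrow> nat \<Rightarrow> nat \<Rightarrow> int \<Rightarrow> 's"
    and Z Zs :: "nat \<Rightarrow> nat \<Rightarrow> 's" and e :: "nat \<Rightarrow> nat \<Rightarrow> 'r"
  assumes fin: "finite (R i)"
    and v_inv: "r \<in> R i \<Longrightarrow> s \<in> R i \<Longrightarrow> r \<noteq> s \<Longrightarrow> v i r s m * (y i r - y i s + of_int m) = 1"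
    and e_comm: "r \<in> R i \<Longrightarrow> s \<in> R j \<Longrightarrow> e i r * e j s = e j s * e i r"
    and shift_y: "r \<in> R i \<Longrightarrow> s \<in> R j \<Longrightarrow>
      shift (e i r) (y j s) (y j s - (if i = j \<and> r = s then of_int h else 0))"
    and shift_Z: "r \<in> R i \<Longrightarrow> s \<in> R j \<Longrightarrow>
      shift (e i r) (Z j s) (if i = j \<and> r = s then Zs i r else Z j s)"
    and nb_neq: "r \<in> R i \<Longrightarrow> nb i \<noteq> i"
    and nb_nb: "r \<in> R i \<Longrightarrow> s \<in> R j \<Longrightarrow> nb j = i \<Longrightarrow> nb i \<noteq> j"
begin

lemma \<iota>_scale: "\<iota> (g * (of_int c * q)) = of_int c * \<iota> (g * q)"
  by (simp only: mult.left_commute[of g] \<iota>_mult \<iota>_of_int)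

text \<open>With y = p and h = 1 the first product over \<open>R (nb i)\<close> is P_{i-1}(p_ir -
  1). With y = p + 1 and h = -1 it is the product of p_ir + 1 - p_{i+1,t}, that is P_{i+1}(p_ir +
  1). This coincidence lets one locale serve both kinds.\<close>

definition cf :: "nat set \<Rightarrow> nat \<Rightarrow> nat \<Rightarrow> 's" where
  "cf T i r = (\<Prod>t\<in>T. y i r - y (nb i) t - of_int h) * Z i r * (\<Prod>s\<in>R i - {r}. v i r s 0)"

text \<open>\<open>cf1 T i r s\<close> and \<open>y1 i r s\<close> are what \<open>cf T i s\<close> and \<open>y i s\<close> become when \<open>e i r\<close> is moved past them.
  Besides \<open>T = R (nb i)\<close> we need \<open>T\<close> with one or two elements removed, to isolate the factors that a
  current of the neighbouring node shifts.\<close>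

definition cf1 :: "nat set \<Rightarrow> nat \<Rightarrow> nat \<Rightarrow> nat \<Rightarrow> 's" where
  "cf1 T i r s = (if r = s
     then (\<Prod>t\<in>T. y i r - of_int h - y (nb i) t - of_int h) * Zs i r * (\<Prod>t\<in>R i - {r}. v i r t (- h))
     else (\<Prod>t\<in>T. y i s - y (nb i) t - of_int h) * Z i s * (v i s r h * (\<Prod>t\<in>R i - {r, s}. v i s t 0)))"

definition y1 :: "nat \<Rightarrow> nat \<Rightarrow> nat \<Rightarrow> 's" where
  "y1 i r s = y i s - (if r = s then of_int h else 0)"

text \<open>The upper index of the Yangian generator is k + 1, and the overall sign of E is left
  out.\<close>

definition J :: "nat \<Rightarrow> nat \<Rightarrow> 'r" where
  "J i k = (\<Sum>r\<in>R i. \<iota> (cf (R (nb i)) i r * y i r ^ k) * e i r)"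

lemma shift_y_same: "r \<in> R i \<Longrightarrow> s \<in> R i \<Longrightarrow> shift (e i r) (y i s) (y1 i r s)"
  using shift_y[of r i s i] by (simp add: y1_def)

lemma shift_y_other: "r \<in> R i \<Longrightarrow> s \<in> R j \<Longrightarrow> i \<noteq> j \<or> r \<noteq> s \<Longrightarrow> shift (e i r) (y j s) (y j s)"
  using shift_y[of r i s j] by auto

lemma shift_Z_other: "r \<in> R i \<Longrightarrow> s \<in> R j \<Longrightarrow> i \<noteq> j \<or> r \<noteq> s \<Longrightarrow> shift (e i r) (Z j s) (Z j s)"
  using shift_Z[of r i s j] by auto

lemma shift_v_other:
  assumes "r \<in> R i" "s \<in> R j" "t \<in> R j" "s \<noteq> t" "i \<noteq> j \<or> r \<noteq> s \<and> r \<noteq> t"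
  shows "shift (e i r) (v j s t m) (v j s t m)"
  by (rule shift_inverse[OF _ v_inv v_inv], rule shift_add[OF shift_diff shift_of_int])
    (use assms in \<open>auto intro: shift_y_other\<close>)

lemma shift_v_left:
  assumes "r \<in> R i" "t \<in> R i" "r \<noteq> t"
  shows "shift (e i r) (v i r t m) (v i r t (m - h))"
proof (rule shift_inverse[OF _ v_inv v_inv])
  have "shift (e i r) (y i r - y i t + of_int m) (y1 i r r - y i t + of_int m)"
    using assms by (intro shift_add shift_diff shift_of_int shift_y_same shift_y_other) auto
  then show "shift (e i r) (y i r - y i t + of_int m) (y i r - y i t + of_int (m - h))"
    by (simp add: y1_def algebra_simps)
qed (use assms in auto)

lemma shift_v_right:
  assumes "r \<in> R i" "t \<in> R i" "r \<noteq> t"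
  shows "shift (e i r) (v i t r m) (v i t r (m + h))"
proof (rule shift_inverse[OF _ v_inv v_inv])
  have "shift (e i r) (y i t - y i r + of_int m) (y i t - y1 i r r + of_int m)"
    using assms by (intro shift_add shift_diff shift_of_int shift_y_same shift_y_other) auto
  then show "shift (e i r) (y i t - y i r + of_int m) (y i t - y i r + of_int (m + h))"
    by (simp add: y1_def algebra_simps)
qed (use assms in auto)

lemma shift_cf_same:
  assumes "r \<in> R i" "s \<in> R i" "T \<subseteq> R (nb i)"
  shows "shift (e i r) (cf T i s) (cf1 T i r s)"
proof (cases "r = s")
  case True
  have "shift (e i r) (y i r - y (nb i) t - of_int h) (y i r - of_int h - y (nb i) t - of_int h)" if "t \<in> T" for t
    using assms that nb_neq[of r i] shift_y_same[of r i r]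
    by (intro shift_diff shift_of_int shift_y_other) (auto simp: y1_def)
  moreover have "shift (e i r) (v i r t 0) (v i r t (- h))" if "t \<in> R i - {r}" for t
    using shift_v_left[of r i t 0] assms that by auto
  moreover have "shift (e i r) (Z i r) (Zs i r)"
    using shift_Z[of r i r i] assms by simp
  ultimately show ?thesis
    unfolding cf_def cf1_def using True by (auto intro!: shift_mult shift_prod)
next
  case False
  have "shift (e i r) (y i s - y (nb i) t - of_int h) (y i s - y (nb i) t - of_int h)" if "t \<in> T" for t
    using assms that nb_neq[of r i] False by (intro shift_diff shift_of_int shift_y_other) auto
  moreover have "shift (e i r) (Z i s) (Z i s)"
    using assms False by (intro shift_Z_other) auto
  moreover have "shift (e i r) (\<Prod>t\<in>R i - {s}. v i s t 0) (v i s r h * (\<Prod>t\<in>R i - {r, s}. v i s t 0))"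
  proof -
    have "(\<Prod>t\<in>R i - {s}. v i s t 0) = v i s r 0 * (\<Prod>t\<in>R i - {r, s}. v i s t 0)"
      unfolding Diff_insert[of _ r "{s}"] by (rule prod.remove) (use assms False fin in auto)
    moreover have "shift (e i r) (v i s r 0) (v i s r h)"
      using shift_v_right[of r i s 0] assms False by simp
    moreover have "shift (e i r) (v i s t 0) (v i s t 0)" if "t \<in> R i - {r, s}" for t
      using assms that False by (intro shift_v_other) auto
    ultimately show ?thesis by (auto intro!: shift_mult shift_prod)
  qed
  ultimately show ?thesis
    unfolding cf_def cf1_def using False by (auto intro!: shift_mult shift_prod)
qed

lemma shift_cf_other:
  assumes "r \<in> R i" "s \<in> R j" "i \<noteq> j" "T \<subseteq> R (nb j)" "nb j = i \<Longrightarrow> r \<notin> T"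
  shows "shift (e i r) (cf T j s) (cf T j s)"
  unfolding cf_def using assms
  by (intro shift_mult shift_prod shift_diff shift_of_int shift_Z_other shift_y_other shift_v_other) auto

lemma cf_remove:
  assumes "t \<in> T" "finite T"
  shows "cf T i r = (y i r - y (nb i) t - of_int h) * cf (T - {t}) i r"
  unfolding cf_def prod.remove[OF assms(2,1)] by (simp add: mult.assoc)

lemma cf1_remove:
  assumes "t \<in> T" "finite T"
  shows "cf1 T i r s = (y1 i r s - y (nb i) t - of_int h) * cf1 (T - {t}) i r s"
  by (cases "r = s") (simp_all add: cf1_def y1_def prod.remove[OF assms(2,1)] mult.assoc)

text \<open>Both sides invert y_s - y_r + m, and inverses in a commutative ring are unique.\<close>

lemma v_swap:
  assumes "r \<in> R i" "s \<in> R i" "r \<noteq> s"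
  shows "v i s r m = - v i r s (- m)"
proof -
  have 1: "v i r s (- m) * (y i r - y i s + of_int (- m)) = 1" "v i s r m * (y i s - y i r + of_int m) = 1"
    using v_inv[of r i s "- m"] v_inv[of s i r m] assms by auto
  have "v i s r m = v i s r m * (v i r s (- m) * (y i r - y i s + of_int (- m)))" using 1 by simp
  also have "\<dots> = - v i r s (- m) * (v i s r m * (y i s - y i r + of_int m))" by (simp add: algebra_simps)
  finally show ?thesis using 1 by simp
qed

text \<open>Passing \<open>e i r\<close> turns the factor \<open>v i s r 0\<close> of
  \<open>cf T i s\<close> into \<open>v i s r h\<close>, and (y_r - y_s - h) times the latter is -1.
  What is left is symmetric in r and s except for \<open>v i r s 0\<close>, which is odd by
  \<open>v_swap\<close>.\<close>

lemma cf_antisym: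
  assumes "r \<in> R i" "s \<in> R i" "r \<noteq> s"
  shows "cf T i r * cf1 T i r s * (y i r - y i s - of_int h)
    = - (cf T i s * cf1 T i s r * (y i s - y i r - of_int h))"
proof -
  define N where "N r = (\<Prod>t\<in>T. y i r - y (nb i) t - of_int h) * Z i r" for r
  have *: "cf T i r * cf1 T i r s * (y i r - y i s - of_int h)
    = - (N r * N s * (\<Prod>t\<in>R i - {r, s}. v i r t 0) * (\<Prod>t\<in>R i - {r, s}. v i s t 0) * v i r s 0)"
    if "r \<in> R i" "s \<in> R i" "r \<noteq> s" for r s
  proof -
    have 1: "(\<Prod>t\<in>R i - {r}. v i r t 0) = v i r s 0 * (\<Prod>t\<in>R i - {r, s}. v i r t 0)"
      unfolding Diff_insert2[of _ r "{s}"] by (rule prod.remove) (use that fin in auto)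
    have "v i s r h * (y i r - y i s - of_int h) = - (v i s r h * (y i s - y i r + of_int h))"
      by (simp add: algebra_simps)
    also have "\<dots> = - 1" using v_inv[of s i r h] that by simp
    finally have 2: "v i s r h * (y i r - y i s - of_int h) = - 1" .
    have "cf T i r * cf1 T i r s * (y i r - y i s - of_int h)
      = N r * N s * (\<Prod>t\<in>R i - {r, s}. v i r t 0) * (\<Prod>t\<in>R i - {r, s}. v i s t 0) * v i r s 0
        * (v i s r h * (y i r - y i s - of_int h))"
      using that(3) by (simp only: cf_def cf1_def N_def 1 if_False ac_simps)
    then show ?thesis unfolding 2 by simp
  qed
  show ?thesis
    using *[OF assms] *[of s r] assms v_swap[OF assms, of 0] by (simp add: insert_commute ac_simps)
qed

section \<open>Quadratic and Serre relations within one kind\<close>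

lemma J_mult:
  "J i k * J i l = (\<Sum>r\<in>R i. \<Sum>s\<in>R i.
     \<iota> (cf (R (nb i)) i r * cf1 (R (nb i)) i r s * (y i r ^ k * y1 i r s ^ l)) * (e i r * e i s))"
proof -
  have "J i k * J i l = (\<Sum>r\<in>R i. \<Sum>s\<in>R i.
     \<iota> (cf (R (nb i)) i r * y i r ^ k * (cf1 (R (nb i)) i r s * y1 i r s ^ l)) * (e i r * e i s))"
    unfolding J_def by (rule current_mult) (intro shift_mult shift_power shift_cf_same shift_y_same subset_refl)
  then show ?thesis by (simp only: ac_simps)
qed

text \<open>The difference of the two sides has the coefficient (x - y - h) \<open>hker\<close>,
  where x = y_r and y is the shifted y_s. For r = s this is zero, since the shifted variable is y_r
  - h. For r \<noteq> s the linear factor is the one in \<open>cf_antisym\<close>, and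
  \<open>hker\<close> is symmetric.\<close>

lemma J_comm_same:
  "comm (J i k) (J i l)
     = of_int h * ((\<Sum>t<k. J i t * J i (k + l - 1 - t)) - (\<Sum>t<l. J i t * J i (k + l - 1 - t)))"
proof -
  define g where "g r s = cf (R (nb i)) i r * cf1 (R (nb i)) i r s" for r s
  \<comment> \<open>\<open>m q\<close> is the normally ordered double current with the polynomial q
    inserted. Each product in the claim has this form and \<open>m\<close> is additive, so the claim
    becomes one polynomial identity.\<close>
  define m where "m q = (\<Sum>r\<in>R i. \<Sum>s\<in>R i. \<iota> (g r s * q (y i r) (y1 i r s)) * (e i r * e i s))"
    for q :: "'s \<Rightarrow> 's \<Rightarrow> 's"
  have JJ: "J i k * J i l = m (\<lambda>x y. x ^ k * y ^ l)" for k l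
    unfolding J_mult m_def g_def ..
  have m_diff: "m q - m q' = m (\<lambda>x y. q x y - q' x y)" for q q'
    by (simp add: m_def \<iota>_diff right_diff_distrib left_diff_distrib sum_subtractf)
  have m_zero: "m (\<lambda>x y. 0) = 0" by (simp add: m_def \<iota>_zero)
  have m_add: "m q + m q' = m (\<lambda>x y. q x y + q' x y)" for q q'
    by (simp add: m_def \<iota>_add distrib_left distrib_right sum.distrib)
  have m_sum: "(\<Sum>t\<in>B. m (q t)) = m (\<lambda>x y. \<Sum>t\<in>B. q t x y)" for B :: "nat set" and q
    by (induction B rule: infinite_finite_induct) (auto simp: m_zero m_add)
  have m_scale: "of_int c * m q = m (\<lambda>x y. of_int c * q x y)" for c q
    unfolding m_def sum_distrib_left \<iota>_scale by (simp only: mult.assoc)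
  have "comm (J i k) (J i l) - of_int h * ((\<Sum>t<k. J i t * J i (k + l - 1 - t)) - (\<Sum>t<l. J i t * J i (k + l - 1 - t)))
    = m (\<lambda>x y. x ^ k * y ^ l - x ^ l * y ^ k - of_int h * hker k l x y)"
    unfolding comm_def JJ m_sum m_diff m_scale hker_def ..
  also have "\<dots> = m (\<lambda>x y. (x - y - of_int h) * hker k l x y)"
    unfolding hker_mult[symmetric] left_diff_distrib ..
  also have "\<dots> = 0"
    unfolding m_def
  proof (rule double_current_antisym[OF fin])
    fix r assume "r \<in> R i"
    then show "g r r * ((y i r - y1 i r r - of_int h) * hker k l (y i r) (y1 i r r)) = 0"
      by (simp add: y1_def)
  next
    fix r s assume rs: "r \<in> R i" "s \<in> R i" "r \<noteq> s"
    then show "g r s * ((y i r - y1 i r s - of_int h) * hker k l (y i r) (y1 i r s))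
      = - (g s r * ((y i s - y1 i s r - of_int h) * hker k l (y i s) (y1 i s r)))"
      using cf_antisym[OF rs, of "R (nb i)"] hker_sym[of k l "y i r" "y i s"]
      by (simp add: g_def y1_def mult.assoc[symmetric])
  qed (use e_comm in auto)
  finally show ?thesis by simp
qed

lemma J_comm_far:
  assumes "i \<noteq> j" "nb i \<noteq> j" "nb j \<noteq> i"
  shows "comm (J i k) (J j l) = 0"
  unfolding J_def
  by (rule current_commute[OF shift_mult[OF shift_cf_other shift_power[OF shift_y_other]]
        shift_mult[OF shift_cf_other shift_power[OF shift_y_other]]])
    (use assms e_comm in \<open>auto simp: ac_simps\<close>)

lemma shift_cf_nb:
  assumes "r \<in> R i" "s \<in> R j" "nb j = i"
  shows "shift (e i r) (cf (R i) j s) ((y j s - y i r) * cf (R i - {r}) j s)"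
proof -
  have ij: "i \<noteq> j" using assms nb_neq by blast
  have "shift (e i r) (y j s - y i r - of_int h) (y j s - y1 i r r - of_int h)"
    using assms ij by (intro shift_diff shift_of_int shift_y_same shift_y_other) auto
  moreover have "shift (e i r) (cf (R i - {r}) j s) (cf (R i - {r}) j s)"
    using assms ij by (intro shift_cf_other) auto
  ultimately show ?thesis
    using cf_remove[OF assms(1) fin, of j s] assms(3) shift_mult by (fastforce simp: y1_def)
qed

text \<open>Only \<open>e i r\<close> moves a coefficient of the other node: it turns the factor y_j
  - y_i - h into y_j - y_i. Hence the commutator of the two summands carries h x^k y^l, and the
  left-hand side carries h (x - y) x^k y^l, where y - x is the factor of the product
  \<open>J i k * J j l\<close>.\<close>

lemma J_comm_nb:
  assumes "nb j = i"
  shows "comm (J i (k + 1)) (J j l) - comm (J i k) (J j (l + 1)) = - of_int h * (J i k * J j l)"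
proof -
  let ?A = "cf (R (nb i)) i" and ?M = "\<lambda>r s. cf (R i - {r}) j s"
  have ij: "i \<noteq> j" and nbi: "nb i \<noteq> j" if "r \<in> R i" "s \<in> R j" for r s
    using that assms nb_neq nb_nb by blast+
  define m where "m q = (\<Sum>r\<in>R i. \<Sum>s\<in>R j. \<iota> (?A r * ?M r s * q (y i r) (y j s)) * (e i r * e j s))"
    for q :: "'s \<Rightarrow> 's \<Rightarrow> 's"
  have m_diff: "m q - m q' = m (\<lambda>x y. q x y - q' x y)" for q q'
    by (simp add: m_def \<iota>_diff right_diff_distrib left_diff_distrib sum_subtractf)
  have m_scale: "of_int c * m q = m (\<lambda>x y. of_int c * q x y)" for c q
    unfolding m_def sum_distrib_left \<iota>_scale by (simp only: mult.assoc)
  have ij_prod: "J i k * J j l = m (\<lambda>x y. (y - x) * x ^ k * y ^ l)" for k l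
  proof -
    have "J i k * J j l = (\<Sum>r\<in>R i. \<Sum>s\<in>R j.
        \<iota> (?A r * y i r ^ k * ((y j s - y i r) * ?M r s * y j s ^ l)) * (e i r * e j s))"
      unfolding J_def assms
    proof (rule current_mult)
      fix r s assume "r \<in> R i" "s \<in> R j"
      with ij[OF this] assms show "shift (e i r) (cf (R i) j s * y j s ^ l) ((y j s - y i r) * ?M r s * y j s ^ l)"
        by (intro shift_mult shift_power shift_cf_nb shift_y_other) auto
    qed
    then show ?thesis unfolding m_def by (simp only: ac_simps)
  qed
  have ji_prod: "J j l * J i k = m (\<lambda>x y. (y - x - of_int h) * x ^ k * y ^ l)" for k l
  proof -
    have "J j l * J i k = (\<Sum>s\<in>R j. \<Sum>r\<in>R i.
        \<iota> (cf (R i) j s * y j s ^ l * (?A r * y i r ^ k)) * (e j s * e i r))"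
      unfolding J_def assms
    proof (rule current_mult)
      fix s r assume "s \<in> R j" "r \<in> R i"
      with ij[of r s] nbi[of r s] show "shift (e j s) (?A r * y i r ^ k) (?A r * y i r ^ k)"
        by (intro shift_mult shift_power shift_cf_other shift_y_other) auto
    qed
    also have "\<dots> = (\<Sum>r\<in>R i. \<Sum>s\<in>R j.
        \<iota> (?A r * ?M r s * ((y j s - y i r - of_int h) * y i r ^ k * y j s ^ l)) * (e i r * e j s))"
    proof (subst sum.swap, intro sum.cong refl)
      fix r s assume "r \<in> R i" "s \<in> R j"
      then show "\<iota> (cf (R i) j s * y j s ^ l * (?A r * y i r ^ k)) * (e j s * e i r)
        = \<iota> (?A r * ?M r s * ((y j s - y i r - of_int h) * y i r ^ k * y j s ^ l)) * (e i r * e j s)"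
        using cf_remove[of r "R i" j s] fin assms e_comm[of r i s j] by (simp add: ac_simps)
    qed
    finally show ?thesis unfolding m_def .
  qed
  have "comm (J i (k + 1)) (J j l) - comm (J i k) (J j (l + 1)) = m (\<lambda>x y.
     (y - x) * x ^ (k + 1) * y ^ l - (y - x - of_int h) * x ^ (k + 1) * y ^ l
     - ((y - x) * x ^ k * y ^ (l + 1) - (y - x - of_int h) * x ^ k * y ^ (l + 1)))"
    unfolding comm_def ij_prod ji_prod m_diff ..
  also have "\<dots> = m (\<lambda>x y. of_int (- h) * ((y - x) * x ^ k * y ^ l))"
    by (rule arg_cong[where f = m]) (simp add: fun_eq_iff algebra_simps)
  also have "\<dots> = of_int (- h) * (J i k * J j l)"
    unfolding ij_prod m_scale ..
  finally show ?thesis by simp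
qed

text \<open>The case in which the \<open>e i r\<close> shift the coefficient of \<open>e j c\<close>
  and not conversely. Put a = u - y_r, b = u - y_s. Off the diagonal a b - 2 a (b - h) + (a - h)(b -
  h) = -h (y_r - y_s - h), so \<open>cf_antisym\<close> applies. On the diagonal (a + h) - 2 a + (a
  - h) = 0.\<close>

lemma J_serre_summand:
  assumes c: "c \<in> R j" and ij: "i \<noteq> j" and nb: "nb j = i" "nb i \<noteq> j"
  shows "comm (J i k) (comm (J i l) (\<iota> (cf (R (nb j)) j c * y j c ^ t) * e j c))
      + comm (J i l) (comm (J i k) (\<iota> (cf (R (nb j)) j c * y j c ^ t) * e j c)) = 0"
proof -
  let ?u = "y j c"
  let ?A = "cf (R (nb i)) i" and ?A1 = "cf1 (R (nb i)) i"
  define B1 where "B1 r = (?u - y i r) * cf (R i - {r}) j c" for r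
  define B2 where "B2 r s = (if r = s then (?u - y1 i r r) * cf (R i - {r}) j c
    else (?u - y i r) * (?u - y i s) * cf (R i - {r, s}) j c)" for r s
  have shB2: "shift (e i r) (B1 s) (B2 r s)" if "r \<in> R i" "s \<in> R i" for r s
  proof (cases "r = s")
    case True
    then show ?thesis
      unfolding B1_def B2_def using that c ij nb
      by (auto intro!: shift_mult shift_diff shift_y_same shift_y_other shift_cf_other)
  next
    case False
    have "cf (R i - {s}) j c = (?u - y i r - of_int h) * cf (R i - {r, s}) j c"
      unfolding Diff_insert[of _ r "{s}"] using cf_remove[of r "R i - {s}" j c] False that fin nb by auto
    moreover have "shift (e i r) (?u - y i r - of_int h) (?u - y1 i r r - of_int h)"
      using that c ij by (intro shift_diff shift_of_int shift_y_same shift_y_other) auto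
    moreover have "shift (e i r) (cf (R i - {r, s}) j c) (cf (R i - {r, s}) j c)"
      using that c ij nb by (intro shift_cf_other) auto
    moreover have "shift (e i r) (?u - y i s) (?u - y i s)"
      using that c ij False by (intro shift_diff shift_y_other) auto
    ultimately have "shift (e i r) (B1 s)
      ((?u - y i s) * ((?u - y1 i r r - of_int h) * cf (R i - {r, s}) j c))"
      unfolding B1_def by (auto intro!: shift_mult)
    then show ?thesis using False by (simp add: B2_def y1_def ac_simps)
  qed
  define G where "G r s = ?A r * ?A1 r s * (B2 r s * ?u ^ t) - 2 * (?A r * (B1 r * ?u ^ t) * ?A1 r s)
    + cf (R (nb j)) j c * ?u ^ t * ?A r * ?A1 r s" for r s
  show ?thesis
  proof (rule serre_current[where R = "R i" and e = "e i" and A = "?A" and ?A1.0 = "?A1" and y = "y i"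
        and ?y1.0 = "y1 i" and At = "?A" and ?At1.0 = "?A1" and ?B1.0 = "\<lambda>r. B1 r * ?u ^ t"
        and ?B2.0 = "\<lambda>r s. B2 r s * ?u ^ t" and e' = "e j c" and G = G
        and B = "cf (R (nb j)) j c * ?u ^ t", OF fin])
    fix r assume r: "r \<in> R i"
    show "shift (e i r) (cf (R (nb j)) j c * ?u ^ t) (B1 r * ?u ^ t)"
      using shift_cf_nb[OF r c nb(1)] shift_y_other[OF r c] ij nb
      by (auto intro!: shift_mult shift_power simp: B1_def)
    have "cf (R (nb j)) j c = (?u - y i r - of_int h) * cf (R i - {r}) j c"
      using cf_remove[OF r fin, of j c] nb by simp
    then show "G r r = 0"
      by (simp only: G_def B1_def B2_def y1_def if_True simp_thms) (simp add: algebra_simps)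
    show "e j c * e i r = e i r * e j c" using e_comm c r by blast
    show "shift (e j c) (?A r) (?A r)"
      using c r ij nb by (intro shift_cf_other) auto
    show "shift (e j c) (y i r) (y i r)"
      using c r ij by (intro shift_y_other) auto
  next
    fix r s assume rs: "r \<in> R i" "s \<in> R i"
    show "shift (e i r) (?A s) (?A1 r s)" "shift (e i r) (?A s) (?A1 r s)"
      "shift (e i r) (y i s) (y1 i r s)" "e i r * e i s = e i s * e i r"
      using shift_cf_same[OF rs subset_refl] shift_y_same[OF rs] e_comm[OF rs] by simp_all
    show "shift (e i r) (B1 s * ?u ^ t) (B2 r s * ?u ^ t)"
      using shB2[OF rs] shift_y_other[of r i c j] rs c ij by (auto intro!: shift_mult shift_power)
    assume neq: "r \<noteq> s"
    then show "y1 i r s = y i s" by (simp add: y1_def)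
    have *: "G r s = - of_int h * (?A r * ?A1 r s * (y i r - y i s - of_int h)) * (cf (R i - {r, s}) j c * ?u ^ t)"
      if "r \<in> R i" "s \<in> R i" "r \<noteq> s" for r s
    proof -
      have M: "cf (R i - {r}) j c = (?u - y i s - of_int h) * cf (R i - {r, s}) j c"
        unfolding Diff_insert2[of _ r "{s}"] using cf_remove[of s "R i - {r}" j c] that fin nb by auto
      then have B: "cf (R (nb j)) j c = (?u - y i r - of_int h) * ((?u - y i s - of_int h) * cf (R i - {r, s}) j c)"
        using cf_remove[of r "R i" j c] that fin nb by simp
      show ?thesis using that unfolding G_def B B1_def B2_def M by (simp add: algebra_simps)
    qed
    show "G r s = - G s r"
      unfolding *[OF rs neq] *[OF rs(2,1) neq[symmetric]] cf_antisym[OF rs neq] insert_commute[of s r]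
      by simp
  qed (simp_all add: G_def J_def)
qed

text \<open>The opposite case: \<open>e j c\<close> shifts the coefficients of node i. With a = y_r
  - u, b = y_s - u the off-diagonal factor is (a - h)(b - h) - 2 (a - h) b + a b = -h (y_r - y_s -
  h) again. On the diagonal b becomes a - h and the factor is 0.\<close>

lemma J_serre_summand':
  assumes c: "c \<in> R j" and ij: "i \<noteq> j" and nbi: "nb i = j" and False: "nb j \<noteq> i"
  shows "comm (J i k) (comm (J i l) (\<iota> (cf (R (nb j)) j c * y j c ^ t) * e j c))
      + comm (J i l) (comm (J i k) (\<iota> (cf (R (nb j)) j c * y j c ^ t) * e j c)) = 0"
proof -
  let ?u = "y j c"
  let ?A = "cf (R j) i" and ?A1 = "cf1 (R j) i"
  let ?M = "cf (R j - {c}) i" and ?M1 = "cf1 (R j - {c}) i"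
  let ?B = "cf (R (nb j)) j c * ?u ^ t"
  define At where "At s = (y i s - ?u) * ?M s" for s
  define At1 where "At1 r s = (y1 i r s - ?u) * ?M1 r s" for r s
  have A: "?A s = (y i s - ?u - of_int h) * ?M s" for s
    using cf_remove[OF c fin, of i s] nbi by simp
  have A1: "?A1 r s = (y1 i r s - ?u - of_int h) * ?M1 r s" for r s
    using cf1_remove[OF c fin, of i r s] nbi by simp
  define G where "G r s = ?A r * ?A1 r s * ?B - 2 * (?A r * ?B * At1 r s) + ?B * At r * At1 r s" for r s
  show ?thesis
  proof (rule serre_current[where R = "R i" and e = "e i" and A = "?A" and ?A1.0 = "?A1" and y = "y i"
        and ?y1.0 = "y1 i" and At = At and ?At1.0 = At1 and ?B1.0 = "\<lambda>r. ?B"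
        and ?B2.0 = "\<lambda>r s. ?B" and e' = "e j c" and G = G
        and B = "?B", OF fin])
    fix r assume r: "r \<in> R i"
    show *: "shift (e i r) ?B ?B"
      using False c r ij by (intro shift_mult shift_power shift_cf_other shift_y_other) auto
    show "shift (e i r) ?B ?B" by fact
    show "e j c * e i r = e i r * e j c" using e_comm c r by blast
    show "G r r = 0"
      unfolding G_def A A1 At_def At1_def by (simp add: y1_def algebra_simps)
    show "shift (e j c) (?A r) (At r)"
      unfolding At_def using shift_cf_nb[OF c r nbi] .
    show "shift (e j c) (y i r) (y i r)"
      using c r ij by (intro shift_y_other) auto
  next
    fix r s assume rs: "r \<in> R i" "s \<in> R i"
    show "shift (e i r) (?A s) (?A1 r s)"
      using shift_cf_same[OF rs, of "R j"] nbi by simp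
    show "shift (e i r) (y i s) (y1 i r s)" "e i r * e i s = e i s * e i r"
      using shift_y_same[OF rs] e_comm[OF rs] by simp_all
    show "shift (e i r) (At s) (At1 r s)"
      unfolding At_def At1_def using rs c ij nbi
      by (intro shift_mult shift_diff shift_y_same shift_y_other shift_cf_same) auto
    assume neq: "r \<noteq> s"
    then show "y1 i r s = y i s" by (simp add: y1_def)
    have *: "G r s = - of_int h * (?M r * ?M1 r s * (y i r - y i s - of_int h)) * ?B"
      if "r \<in> R i" "s \<in> R i" "r \<noteq> s" for r s
      using that unfolding G_def A A1 At_def At1_def by (simp add: y1_def algebra_simps)
    show "G r s = - G s r"
      unfolding *[OF rs neq] *[OF rs(2,1) neq[symmetric]] cf_antisym[OF rs neq] by simp
  qed (simp_all add: G_def J_def nbi)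
qed

text \<open>The relation is linear in the current of node j, so it can be checked summand by
  summand. The case of an empty \<open>R i\<close> is split off because the conditions on
  \<open>nb\<close> speak of nonempty index sets.\<close>

lemma J_serre:
  assumes "nb j = i \<or> nb i = j"
  shows "comm (J i k) (comm (J i l) (J j t)) + comm (J i l) (comm (J i k) (J j t)) = 0"
proof (cases "R i = {}")
  case True
  then show ?thesis by (simp add: J_def comm_def)
next
  case False
  have "comm (J i k) (comm (J i l) (\<iota> (cf (R (nb j)) j c * y j c ^ t) * e j c))
      + comm (J i l) (comm (J i k) (\<iota> (cf (R (nb j)) j c * y j c ^ t) * e j c)) = 0"
    if "c \<in> R j" for c
  proof -
    from False obtain r where r: "r \<in> R i" by blast
    have "i \<noteq> j" using assms nb_neq[OF r] nb_neq[OF that] by auto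
    moreover have "nb j = i \<Longrightarrow> nb i \<noteq> j" using nb_nb[OF r that] by blast
    ultimately show ?thesis
      using assms J_serre_summand[OF that, of i k l t] J_serre_summand'[OF that, of i k l t] by auto
  qed
  then have "(\<Sum>c\<in>R j. comm (J i k) (comm (J i l) (\<iota> (cf (R (nb j)) j c * y j c ^ t) * e j c))
      + comm (J i l) (comm (J i k) (\<iota> (cf (R (nb j)) j c * y j c ^ t) * e j c))) = 0"
    by (simp add: sum.neutral)
  then show ?thesis
    by (simp add: J_def[of j] comm_sum_right sum.distrib)
qed

end

section \<open>Partial fractions over commutative rings\<close>

unbundle fps_syntax

lemma mult_linear_expand:
  "F * (1 - fps_const c * fps_X) = F - fps_const c * (F * fps_X)" for F :: "'s::comm_ring_1 fps"
  by (simp add: algebra_simps)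

lemma geom_mult: "geom c * (1 - fps_const c * fps_X) = (1 :: 's::comm_ring_1 fps)"
proof (rule fps_ext)
  fix m show "(geom c * (1 - fps_const c * fps_X)) $ m = (1 :: 's fps) $ m"
    by (cases m) (simp_all add: geom_def mult_linear_expand)
qed

lemma geom_diff:
  "geom c - geom d = fps_X * fps_const (c - d) * (geom c * geom d :: 's::comm_ring_1 fps)"
proof -
  have "geom c - geom d = geom c * (geom d * (1 - fps_const d * fps_X))
      - geom d * (geom c * (1 - fps_const c * fps_X))"
    unfolding geom_mult by simp
  also have "\<dots> = fps_X * (fps_const c - fps_const d) * (geom c * geom d)"
    by (simp add: algebra_simps del: fps_const_sub)
  finally show ?thesis by simp
qed

text \<open>In z = 1/w this is the expansion of 1 / prod (z - c_i), multiplied by z. The induction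
  removes either of two poles \<alpha>, \<beta>: the difference of the two smaller identities is
  c_\<alpha> - c_\<beta> times the wanted one.\<close>

lemma fps_partial_fractions:
  fixes c :: "'i \<Rightarrow> 's::comm_ring_1"
  assumes "finite I" "I \<noteq> {}" "\<And>i j. i \<in> I \<Longrightarrow> j \<in> I \<Longrightarrow> i \<noteq> j \<Longrightarrow> u i j * (c i - c j) = 1"
  shows "(\<Sum>i\<in>I. fps_const (\<Prod>j\<in>I - {i}. u i j) * geom (c i)) = fps_X ^ (card I - 1) * (\<Prod>i\<in>I. geom (c i))"
  using assms
proof (induction "card I" arbitrary: I rule: less_induct)
  case less
  show ?case
  proof (cases "\<exists>i. I = {i}")
    case True
    then show ?thesis by auto
  next
    case False
    then obtain \<alpha> \<beta> where ab: "\<alpha> \<in> I" "\<beta> \<in> I" "\<alpha> \<noteq> \<beta>"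
      using less.prems(2) by blast
    define T where "T = I - {\<alpha>, \<beta>}"
    have T: "finite T" "\<alpha> \<notin> T" "\<beta> \<notin> T" and I: "I = insert \<alpha> (insert \<beta> T)"
      using ab less.prems(1) by (auto simp: T_def)
    define V where "V J i = (\<Prod>j\<in>J - {i}. u i j)" for J i
    let ?A = "insert \<alpha> T" and ?B = "insert \<beta> T"
    have card: "card I = Suc (Suc (card T))" "card ?A = Suc (card T)" "card ?B = Suc (card T)"
      using T ab by (auto simp: I)
    have IH: "(\<Sum>i\<in>?A. fps_const (V ?A i) * geom (c i)) = fps_X ^ card T * (\<Prod>i\<in>?A. geom (c i))"
      "(\<Sum>i\<in>?B. fps_const (V ?B i) * geom (c i)) = fps_X ^ card T * (\<Prod>i\<in>?B. geom (c i))"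
      using less.hyps[of ?A] less.hyps[of ?B] less.prems(3) T card unfolding V_def
      by (auto simp: I)
    \<comment> \<open>(a - b) / ((c - a)(c - b)) = 1/(c - a) - 1/(c - b), with \<open>u\<close> in
      place of the quotients.\<close>
    have VT: "V I i * (c \<alpha> - c \<beta>) = V ?A i - V ?B i" if "i \<in> T" for i
    proof -
      have "I - {i} = insert \<alpha> (insert \<beta> (T - {i}))" "?A - {i} = insert \<alpha> (T - {i})" "?B - {i} = insert \<beta> (T - {i})"
        using that T by (auto simp: I)
      then have W: "V I i = u i \<alpha> * (u i \<beta> * V T i)" "V ?A i = u i \<alpha> * V T i" "V ?B i = u i \<beta> * V T i"
        using T ab by (auto simp: V_def)
      have "V I i * (c \<alpha> - c \<beta>) = u i \<alpha> * V T i * (u i \<beta> * (c i - c \<beta>)) - u i \<beta> * V T i * (u i \<alpha> * (c i - c \<alpha>))"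
        unfolding W by (simp add: algebra_simps)
      moreover have "u i \<beta> * (c i - c \<beta>) = 1" "u i \<alpha> * (c i - c \<alpha>) = 1"
        using less.prems(3) that T by (auto simp: I)
      ultimately show ?thesis by (simp add: W)
    qed
    have uab: "u \<alpha> \<beta> * (c \<alpha> - c \<beta>) = 1" "u \<beta> \<alpha> * (c \<beta> - c \<alpha>) = 1"
      using less.prems(3) ab by auto
    have Va: "V I \<alpha> * (c \<alpha> - c \<beta>) = V ?A \<alpha>"
    proof -
      have "I - {\<alpha>} = insert \<beta> T" "?A - {\<alpha>} = T" using T ab by (auto simp: I)
      then have "V I \<alpha> * (c \<alpha> - c \<beta>) = V ?A \<alpha> * (u \<alpha> \<beta> * (c \<alpha> - c \<beta>))"
        using T by (simp add: V_def)
      then show ?thesis using uab by simp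
    qed
    have Vb: "V I \<beta> * (c \<alpha> - c \<beta>) = - V ?B \<beta>"
    proof -
      have "I - {\<beta>} = insert \<alpha> T" "?B - {\<beta>} = T" using T ab by (auto simp: I)
      then have "V I \<beta> * (c \<alpha> - c \<beta>) = - (V ?B \<beta> * (u \<beta> \<alpha> * (c \<beta> - c \<alpha>)))"
        using T by (simp add: V_def algebra_simps)
      then show ?thesis using uab by simp
    qed
    have "(\<Sum>i\<in>I. fps_const (V I i) * geom (c i)) * fps_const (c \<alpha> - c \<beta>)
      = (\<Sum>i\<in>I. fps_const (V I i * (c \<alpha> - c \<beta>)) * geom (c i))"
      unfolding sum_distrib_right fps_const_mult[symmetric] by (simp only: ac_simps)
    also have "\<dots> = (\<Sum>i\<in>?A. fps_const (V ?A i) * geom (c i)) - (\<Sum>i\<in>?B. fps_const (V ?B i) * geom (c i))"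
    proof -
      have "(\<Sum>i\<in>T. fps_const (V I i * (c \<alpha> - c \<beta>)) * geom (c i))
        = (\<Sum>i\<in>T. fps_const (V ?A i) * geom (c i)) - (\<Sum>i\<in>T. fps_const (V ?B i) * geom (c i))"
        unfolding sum_subtractf[symmetric]
        by (rule sum.cong[OF refl])
          (simp only: VT left_diff_distrib fps_const_sub[symmetric])
      moreover have "fps_const (V I \<beta> * (c \<alpha> - c \<beta>)) * geom (c \<beta>) = - (fps_const (V ?B \<beta>) * geom (c \<beta>))"
        unfolding Vb by (simp flip: fps_const_neg)
      moreover have "(\<Sum>i\<in>I. g i) = g \<alpha> + (g \<beta> + (\<Sum>i\<in>T. g i))" for g :: "'i \<Rightarrow> 's fps"
        using T ab by (simp add: I)
      ultimately show ?thesis using T Va by simp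
    qed
    also have "\<dots> = fps_X ^ card T * (\<Prod>i\<in>T. geom (c i)) * (geom (c \<alpha>) - geom (c \<beta>))"
      unfolding IH using T by (simp add: algebra_simps)
    also have "\<dots> = fps_X ^ (card I - 1) * (\<Prod>i\<in>I. geom (c i)) * fps_const (c \<alpha> - c \<beta>)"
    proof -
      have "(\<Prod>i\<in>I. geom (c i)) = geom (c \<alpha>) * (geom (c \<beta>) * (\<Prod>i\<in>T. geom (c i)))"
        using T ab by (simp add: I)
      then show ?thesis unfolding geom_diff card by (simp only: diff_Suc_1 power_Suc ac_simps)
    qed
    finally have eq: "(\<Sum>i\<in>I. fps_const (V I i) * geom (c i)) * fps_const (c \<alpha> - c \<beta>)
      = fps_X ^ (card I - 1) * (\<Prod>i\<in>I. geom (c i)) * fps_const (c \<alpha> - c \<beta>)" .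
    \<comment> \<open>The common factor is removed by its inverse \<open>u \<alpha> \<beta>\<close>;
      the ring may have zero divisors.\<close>
    have "fps_const (c \<alpha> - c \<beta>) * fps_const (u \<alpha> \<beta>) = 1"
      using uab by (simp add: mult.commute)
    with arg_cong[OF eq, of "\<lambda>x. x * fps_const (u \<alpha> \<beta>)"]
    show ?thesis by (simp only: mult.assoc V_def mult_1_right)
  qed
qed

text \<open>Extension by zero to negative indices: after a power of z is split off, the index of a
  coefficient can be negative, and those coefficients must be available as zeros.\<close>

definition coeff_int :: "'s::comm_ring_1 fps \<Rightarrow> int \<Rightarrow> 's" where
  "coeff_int F m = (if 0 \<le> m then fps_nth F (nat m) else 0)"

lemma coeff_int_mult_linear:
  "coeff_int (F * (1 - fps_const b * fps_X)) (m + 1) = coeff_int F (m + 1) - b * coeff_int F m"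
proof (cases "0 \<le> m")
  case True
  then have "nat (m + 1) = Suc (nat m)" by simp
  with True show ?thesis
    by (simp add: coeff_int_def mult_linear_expand)
next
  case False
  then have "m + 1 = 0 \<or> m + 1 < 0" by linarith
  with False show ?thesis
    by (auto simp: coeff_int_def mult_linear_expand)
qed

text \<open>The right-hand side is the sum of the residues of z^m / prod (z - c_i). For m <
  \<open>card I\<close> - 1 the index on the left is negative, and the lemma says that this sum is
  zero.\<close>

lemma coeff_int_geom_prod:
  fixes c :: "'i \<Rightarrow> 's::comm_ring_1"
  assumes "finite I" "\<And>i j. i \<in> I \<Longrightarrow> j \<in> I \<Longrightarrow> i \<noteq> j \<Longrightarrow> u i j * (c i - c j) = 1"
  shows "coeff_int (\<Prod>i\<in>I. geom (c i)) (int m + 1 - int (card I))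
    = (\<Sum>i\<in>I. (\<Prod>j\<in>I - {i}. u i j) * c i ^ m)"
proof (cases "I = {}")
  case True
  then show ?thesis by (simp add: coeff_int_def)
next
  case False
  then have card: "card I \<ge> 1" using assms(1) by (simp add: Suc_le_eq card_gt_0_iff)
  have "(\<Sum>i\<in>I. (\<Prod>j\<in>I - {i}. u i j) * c i ^ m)
      = (\<Sum>i\<in>I. fps_const (\<Prod>j\<in>I - {i}. u i j) * geom (c i)) $ m"
    by (simp add: fps_sum_nth geom_def)
  also have "\<dots> = (fps_X ^ (card I - 1) * (\<Prod>i\<in>I. geom (c i))) $ m"
    using fps_partial_fractions[OF assms(1) False assms(2)] by simp
  also have "\<dots> = coeff_int (\<Prod>i\<in>I. geom (c i)) (int m + 1 - int (card I))"
    using card by (auto simp: coeff_int_def fps_X_power_mult_nth nat_diff_distrib Suc_diff_le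
        intro!: arg_cong[where f = "fps_nth _"])
  finally show ?thesis by simp
qed

text \<open>A further factor z - b in the numerator multiplies the residue at c_i by c_i - b and
  raises the degree \<open>q\<close> by one. It combines the coefficients for m and m + 1, so
  \<open>m\<close> has to be arbitrary in the induction. A polynomial part of the quotient does not
  interfere, because only negative powers of z are read off.\<close>

lemma coeff_int_mult_linear_prod:
  assumes "finite K" "\<And>m. coeff_int F (int m + 1 + q) = (\<Sum>i\<in>I. U i * c i ^ m * g i)"
  shows "coeff_int (F * (\<Prod>k\<in>K. 1 - fps_const (b k) * fps_X)) (int m + 1 + (q + int (card K)))
    = (\<Sum>i\<in>I. U i * c i ^ m * (g i * (\<Prod>k\<in>K. c i - b k)))"
  using assms(1)
proof (induction K arbitrary: m rule: finite_induct)
  case empty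
  then show ?case using assms(2) by simp
next
  case (insert k K)
  let ?F = "F * (\<Prod>k\<in>K. 1 - fps_const (b k) * fps_X)"
  have "coeff_int (F * (\<Prod>k\<in>insert k K. 1 - fps_const (b k) * fps_X)) (int m + 1 + (q + int (card (insert k K))))
    = coeff_int (?F * (1 - fps_const (b k) * fps_X)) ((int m + 1 + (q + int (card K))) + 1)"
    using insert.hyps by (simp add: ac_simps)
  also have "\<dots> = coeff_int ?F (int (Suc m) + 1 + (q + int (card K))) - b k * coeff_int ?F (int m + 1 + (q + int (card K)))"
    unfolding coeff_int_mult_linear by (simp add: ac_simps)
  also have "\<dots> = (\<Sum>i\<in>I. U i * c i ^ m * (g i * (\<Prod>k\<in>insert k K. c i - b k)))"
    unfolding insert.IH sum_distrib_left sum_subtractf[symmetric]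
    using insert.hyps by (intro sum.cong) (simp_all add: algebra_simps)
  finally show ?case .
qed

text \<open>Division by 1 - y X is convolution with the powers of y. This produces the finite sums
  in (Y2) and (Y3).\<close>

lemma fps_nth_linear_quotient:
  fixes D G :: "'s::comm_ring_1 fps"
  assumes "G * (1 - fps_const y * fps_X) = fps_const \<kappa> * (fps_X * D)"
  shows "G $ m = \<kappa> * (\<Sum>t<m. D $ t * y ^ (m - 1 - t))"
proof (induction m)
  case 0
  have "(G * (1 - fps_const y * fps_X)) $ 0 = G $ 0" by simp
  then show ?case unfolding assms by simp
next
  case (Suc m)
  have "(G * (1 - fps_const y * fps_X)) $ Suc m = G $ Suc m - y * G $ m"
    by (simp add: mult_linear_expand)
  then have "G $ Suc m = \<kappa> * D $ m + y * G $ m" unfolding assms by simp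
  also have "y * G $ m = \<kappa> * (\<Sum>t<m. D $ t * y ^ (Suc m - 1 - t))"
    unfolding Suc sum_distrib_left
  proof (rule sum.cong[OF refl])
    fix t assume "t \<in> {..<m}"
    then have "Suc m - 1 - t = Suc (m - 1 - t)" by auto
    then show "y * (\<kappa> * (D $ t * y ^ (m - 1 - t))) = \<kappa> * (D $ t * y ^ (Suc m - 1 - t))" by simp
  qed
  finally show ?case by (simp add: algebra_simps)
qed

context comm_hom
begin

text \<open>The range of t is exactly where both indices are nonnegative. The sums in (Y0) and (Y1)
  both have this shape; for M < 0 the range is empty and the right-hand side is 0.\<close>

lemma sum_int_convolution:
  "(\<Sum>t\<in>{c..M + c}. \<iota> (coeff_int F (t - c)) * \<iota> (coeff_int G (M + c - t))) = \<iota> (coeff_int (F * G) M)"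
proof (cases "0 \<le> M")
  case True
  have "(\<Sum>t\<in>{c..M + c}. \<iota> (coeff_int F (t - c)) * \<iota> (coeff_int G (M + c - t)))
    = (\<Sum>k\<in>{0..nat M}. \<iota> (F $ k * G $ (nat M - k)))"
    by (rule sum.reindex_bij_witness[where i = "\<lambda>k. int k + c" and j = "\<lambda>t. nat (t - c)"])
      (use True in \<open>auto simp: coeff_int_def \<iota>_mult nat_diff_distrib
        intro!: arg_cong2[where f = times] arg_cong[where f = \<iota>] arg_cong[where f = "fps_nth _"]\<close>)
  then show ?thesis using True by (simp add: coeff_int_def fps_mult_nth \<iota>_sum)
next
  case False
  then show ?thesis by (simp add: coeff_int_def \<iota>_zero)
qed

definition fshift :: "'r \<Rightarrow> 's fps \<Rightarrow> 's fps \<Rightarrow> bool" where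
  "fshift e F G \<longleftrightarrow> (\<forall>m. shift e (F $ m) (G $ m))"

lemma fshift_mult: "fshift e F F' \<Longrightarrow> fshift e G G' \<Longrightarrow> fshift e (F * G) (F' * G')"
  by (auto simp: fshift_def fps_mult_nth intro!: shift_sum shift_mult)

lemma fshift_prod: "(\<And>x. x \<in> X \<Longrightarrow> fshift e (g x) (g' x)) \<Longrightarrow> fshift e (prod g X) (prod g' X)"
proof (induction X rule: infinite_finite_induct)
  case (insert x X)
  then show ?case by (auto intro: fshift_mult)
qed (auto simp: fshift_def shift_one shift_zero)

lemma fshift_linear: "shift e c c' \<Longrightarrow> fshift e (1 - fps_const c * fps_X) (1 - fps_const c' * fps_X)"
  using shift_diff[OF shift_zero, of e c c'] by (auto simp: fshift_def fps_X_def shift_one shift_zero)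

lemma fshift_geom: "shift e c c' \<Longrightarrow> fshift e (geom c) (geom c')"
  by (auto simp: fshift_def geom_def intro: shift_power)

end

section \<open>Currents of both kinds\<close>

text \<open>Commutation and shift rules are assumed for \<open>e\<close> only. Those for
  \<open>f\<close> are derived from e f = f e = 1; in particular the algebra has no relation for
  [e^(-q), e^(-q)].\<close>

locale gklo = comm_hom \<iota> for \<iota> :: "'s::comm_ring_1 \<Rightarrow> 'r::ring_1" +
  fixes n N :: nat and a ii :: "nat \<Rightarrow> nat" and \<gamma> :: "nat \<Rightarrow> int"
    and R :: "nat \<Rightarrow> nat set"
    and x :: "nat \<Rightarrow> 's" and p :: "nat \<Rightarrow> nat \<Rightarrow> 's"
    and v :: "nat \<Rightarrow> nat \<Rightarrow> nat \<Rightarrow> int \<Rightarrow> 's" and e f :: "nat \<Rightarrow> nat \<Rightarrow> 'r"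
  assumes R_def: "R i = {1..ac n a i}"
    and \<gamma>_pos: "s \<in> {1..N} \<Longrightarrow> ii s \<noteq> 0 \<Longrightarrow> \<gamma> s = 1"
    and v_inv: "r \<in> R i \<Longrightarrow> s \<in> R i \<Longrightarrow> r \<noteq> s \<Longrightarrow> v i r s m * (p i r - p i s + of_int m) = 1"
    and ef: "r \<in> R i \<Longrightarrow> e i r * f i r = 1"
    and fe: "r \<in> R i \<Longrightarrow> f i r * e i r = 1"
    and e_comm: "r \<in> R i \<Longrightarrow> s \<in> R j \<Longrightarrow> e i r * e j s = e j s * e i r"
    and shift_e_p: "r \<in> R i \<Longrightarrow> s \<in> R j \<Longrightarrow>
      shift (e i r) (p j s) (p j s - (if i = j \<and> r = s then 1 else 0))"
    and shift_e_x: "r \<in> R i \<Longrightarrow> shift (e i r) (x s) (x s)"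
begin

lemma fin: "finite (R i)" by (simp add: R_def)

lemma R_pos: "r \<in> R i \<Longrightarrow> 1 \<le> i \<and> i < n"
  by (cases "1 \<le> i \<and> i < n") (auto simp: R_def ac_def)

lemma card_R: "card (R i) = ac n a i" by (simp add: R_def)

lemma shift_f:
  assumes "r \<in> R i" "shift (e i r) s s'"
  shows "shift (f i r) s' s"
proof -
  have "f i r * \<iota> s' = f i r * (\<iota> s' * e i r) * f i r" using ef[OF assms(1)] by (simp add: mult.assoc)
  also have "\<dots> = (f i r * e i r) * \<iota> s * f i r" using assms(2) by (simp add: shift_def mult.assoc)
  finally show ?thesis using fe[OF assms(1)] by (simp add: shift_def)
qed

lemma shift_f_p:
  assumes "r \<in> R i" "s \<in> R j"
  shows "shift (f i r) (p j s) (p j s + (if i = j \<and> r = s then 1 else 0))"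
proof -
  let ?d = "if i = j \<and> r = s then 1 else 0 :: 's"
  have "shift (e i r) ?d ?d" by (simp add: shift_zero shift_one)
  with shift_e_p[OF assms] have "shift (e i r) (p j s + ?d) (p j s - ?d + ?d)" by (rule shift_add)
  then show ?thesis using shift_f[OF assms(1)] by simp
qed

lemma shift_f_x: "r \<in> R i \<Longrightarrow> shift (f i r) (x s) (x s)"
  by (rule shift_f[OF _ shift_e_x])

lemma f_e_comm:
  assumes "r \<in> R i" "s \<in> R j"
  shows "f i r * e j s = e j s * f i r"
proof -
  have "f i r * e j s = f i r * (e j s * e i r) * f i r" using ef[OF assms(1)] by (simp add: mult.assoc)
  also have "\<dots> = (f i r * e i r) * e j s * f i r" using e_comm[OF assms] by (simp add: mult.assoc)
  finally show ?thesis using fe[OF assms(1)] by simp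
qed

lemma f_comm:
  assumes "r \<in> R i" "s \<in> R j"
  shows "f i r * f j s = f j s * f i r"
proof -
  have "f i r * f j s = f j s * (e j s * f i r) * f j s" using fe[OF assms(2)] by (simp add: mult.assoc[symmetric])
  also have "\<dots> = f j s * f i r * (e j s * f j s)" by (simp only: f_e_comm[OF assms, symmetric] mult.assoc)
  finally show ?thesis using ef[OF assms(2)] by simp
qed

definition ZE :: "nat \<Rightarrow> nat \<Rightarrow> 's" where
  "ZE i r = (\<Prod>s\<in>{s\<in>{1..N}. ii s = i}. p i r - x s)"

sublocale E: gklo_half \<iota> R "\<lambda>i. i - 1" 1 p v ZE
  "\<lambda>i r. \<Prod>s\<in>{s\<in>{1..N}. ii s = i}. p i r - 1 - x s" e
proof
  fix i r j s assume rs: "r \<in> R i" "s \<in> R j"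
  show "shift (e i r) (p j s) (p j s - (if i = j \<and> r = s then of_int 1 else 0))"
    using shift_e_p[OF rs] by (simp only: of_int_1)
  have "shift (e i r) (p j s - x t) (p j s - (if i = j \<and> r = s then 1 else 0) - x t)" for t
    using shift_e_p[OF rs] shift_e_x[OF rs(1)] by (rule shift_diff)
  then have "shift (e i r) (ZE j s) (\<Prod>t\<in>{t\<in>{1..N}. ii t = j}. p j s - (if i = j \<and> r = s then 1 else 0) - x t)"
    unfolding ZE_def by (intro shift_prod)
  then show "shift (e i r) (ZE j s) (if i = j \<and> r = s
      then \<Prod>s\<in>{s\<in>{1..N}. ii s = i}. p i r - 1 - x s else ZE j s)"
    by (auto simp: ZE_def)
  show "e i r * e j s = e j s * e i r" by (rule e_comm[OF rs])
  show "i - 1 \<noteq> i" using R_pos[OF rs(1)] by auto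
  show "i - 1 \<noteq> j" if "j - 1 = i" using R_pos[OF rs(1)] R_pos[OF rs(2)] that by auto
qed (use fin v_inv R_pos in auto)

sublocale F: gklo_half \<iota> R Suc "- 1" "\<lambda>i r. p i r + 1" v "\<lambda>i r. 1" "\<lambda>i r. 1" f
proof
  fix i r j s assume rs: "r \<in> R i" "s \<in> R j"
  show "shift (f i r) (p j s + 1) (p j s + 1 - (if i = j \<and> r = s then of_int (- 1) else 0))"
    using shift_add[OF shift_f_p[OF rs] shift_one[of "f i r"]]
    by (cases "i = j \<and> r = s") (auto simp: add.commute add.left_commute)
  show "shift (f i r) 1 (if i = j \<and> r = s then 1 else 1)" by (simp add: shift_one)
  show "f i r * f j s = f j s * f i r" by (rule f_comm[OF rs])
qed (use fin v_inv in auto)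

section \<open>The commuting series and their relations with the currents\<close>

abbreviation ZK :: "nat \<Rightarrow> nat set" where "ZK i \<equiv> {s\<in>{1..N}. ii s < i}"

definition Dfps :: "nat \<Rightarrow> 's fps" where
  "Dfps i = (\<Prod>r\<in>R i. 1 - fps_const (p i r) * fps_X) * (\<Prod>r\<in>R (i - 1). geom (1 + p (i - 1) r))
     * (\<Prod>s\<in>ZK i. if \<gamma> s = 1 then 1 - fps_const (x s) * fps_X else geom (x s))"

text \<open>Minus the inverse of \<open>Dfps i\<close>, taken factor by factor; the sign is that of
  -\<delta>_{r,0} in (Y0).\<close>

definition Dtfps :: "nat \<Rightarrow> 's fps" where
  "Dtfps i = - ((\<Prod>r\<in>R i. geom (p i r)) * (\<Prod>r\<in>R (i - 1). 1 - fps_const (1 + p (i - 1) r) * fps_X)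
     * (\<Prod>s\<in>ZK i. if \<gamma> s = 1 then geom (x s) else 1 - fps_const (x s) * fps_X))"

lemma Dfps_0: "Dfps i $ 0 = 1"
proof -
  have "(prod g X :: 's fps) $ 0 = 1" if "\<And>x. x \<in> X \<Longrightarrow> g x $ 0 = 1" for g and X :: "nat set"
    using that by (induction X rule: infinite_finite_induct) auto
  note * = this
  show ?thesis unfolding Dfps_def by (simp add: * geom_def)
qed

lemma Dfps_Dtfps: "Dfps i * Dtfps i = - 1"
proof -
  have "(\<Prod>r\<in>R i. 1 - fps_const (p i r) * fps_X) * (\<Prod>r\<in>R i. geom (p i r)) = 1"
    "(\<Prod>r\<in>R (i - 1). geom (1 + p (i - 1) r)) * (\<Prod>r\<in>R (i - 1). 1 - fps_const (1 + p (i - 1) r) * fps_X) = 1"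
    "(\<Prod>s\<in>ZK i. if \<gamma> s = 1 then 1 - fps_const (x s) * fps_X else geom (x s))
      * (\<Prod>s\<in>ZK i. if \<gamma> s = 1 then geom (x s) else 1 - fps_const (x s) * fps_X) = 1"
    unfolding prod.distrib[symmetric]
    by (auto intro!: prod.neutral simp: geom_mult mult.commute[of _ "geom _"])
  note * = this
  have "Dfps i * Dtfps i = - (((\<Prod>r\<in>R i. 1 - fps_const (p i r) * fps_X) * (\<Prod>r\<in>R i. geom (p i r)))
     * ((\<Prod>r\<in>R (i - 1). geom (1 + p (i - 1) r)) * (\<Prod>r\<in>R (i - 1). 1 - fps_const (1 + p (i - 1) r) * fps_X))
     * ((\<Prod>s\<in>ZK i. if \<gamma> s = 1 then 1 - fps_const (x s) * fps_X else geom (x s))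
      * (\<Prod>s\<in>ZK i. if \<gamma> s = 1 then geom (x s) else 1 - fps_const (x s) * fps_X)))"
    unfolding Dfps_def Dtfps_def by (simp only: ac_simps mult_minus_left mult_minus_right)
  then show ?thesis unfolding * by simp
qed

text \<open>At most one factor contains p_jc: a factor of P_i(z) if i = j, a factor of 1/P_{i-1}(z -
  1) if i = j + 1. \<open>Q\<close> collects the unaffected rest. The parameter \<open>d\<close> is
  1 for \<open>e\<close> and -1 for \<open>f\<close>.\<close>

lemma fshift_Dfps:
  assumes c: "c \<in> R j" and gp: "\<And>i r. r \<in> R i \<Longrightarrow> shift g (p i r) (p i r - (if j = i \<and> c = r then d else 0))"
    and gx: "\<And>s. shift g (x s) (x s)"
  obtains D' Q where "fshift g (Dfps i) D'"
    and "i = j \<Longrightarrow> Dfps i = (1 - fps_const (p j c) * fps_X) * Q"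
    and "i = j \<Longrightarrow> D' = (1 - fps_const (p j c - d) * fps_X) * Q"
    and "i = j + 1 \<Longrightarrow> Dfps i = geom (1 + p j c) * Q"
    and "i = j + 1 \<Longrightarrow> D' = geom (1 + p j c - d) * Q"
    and "i \<noteq> j \<Longrightarrow> i \<noteq> j + 1 \<Longrightarrow> D' = Dfps i"
proof -
  define P3 where "P3 = (\<Prod>s\<in>ZK i. if \<gamma> s = 1 then 1 - fps_const (x s) * fps_X else geom (x s))"
  have 3: "fshift g P3 P3"
    unfolding P3_def by (auto intro!: fshift_prod fshift_linear fshift_geom gx)
  have gp': "shift g (p i r) (p i r)" if "r \<in> R i" "j \<noteq> i \<or> c \<noteq> r" for i r
    using gp[OF that(1)] that(2) by auto
  have gpc: "shift g (p j c) (p j c - d)" using gp[OF c] by simp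
  have 1: "fshift g (\<Prod>r\<in>X. 1 - fps_const (p k r) * fps_X) (\<Prod>r\<in>X. 1 - fps_const (p k r) * fps_X)"
    "fshift g (\<Prod>r\<in>X. geom (1 + p k r)) (\<Prod>r\<in>X. geom (1 + p k r))"
    if "X \<subseteq> R k" "j = k \<Longrightarrow> c \<notin> X" for X k
    using that by (auto intro!: fshift_prod fshift_linear fshift_geom gp' shift_add shift_one)
  consider "i = j" | "i = j + 1" | "i \<noteq> j" "i \<noteq> j + 1" by blast
  then show thesis
  proof cases
    assume ij: "i = j"
    \<comment> \<open>Subtraction is truncated; j \<ge> 1 holds because \<open>R j\<close> contains
      \<open>c\<close>.\<close>
    then have ne: "j \<noteq> i - 1" using R_pos[OF c] by auto
    define Q where "Q = (\<Prod>r\<in>R j - {c}. 1 - fps_const (p j r) * fps_X) * (\<Prod>r\<in>R (i - 1). geom (1 + p (i - 1) r)) * P3"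
    have D: "Dfps i = (1 - fps_const (p j c) * fps_X) * Q"
      unfolding Dfps_def Q_def P3_def ij prod.remove[OF fin c] by (simp only: mult.assoc)
    moreover have "fshift g Q Q"
      unfolding Q_def by (intro fshift_mult 1 3) (use ne in auto)
    then have "fshift g (Dfps i) ((1 - fps_const (p j c - d) * fps_X) * Q)"
      unfolding D by (intro fshift_mult fshift_linear gpc)
    ultimately show thesis using ij by (intro that) auto
  next
    assume ij: "i = j + 1"
    define Q where "Q = (\<Prod>r\<in>R i. 1 - fps_const (p i r) * fps_X) * (\<Prod>r\<in>R j - {c}. geom (1 + p j r)) * P3"
    have i1: "i - 1 = j" using ij by simp
    have D: "Dfps i = geom (1 + p j c) * Q"
      unfolding Dfps_def Q_def P3_def i1 prod.remove[OF fin c] by (simp only: ac_simps)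
    moreover have "fshift g Q Q"
      unfolding Q_def by (intro fshift_mult 1 3) (use ij in auto)
    moreover have "shift g (1 + p j c) (1 + (p j c - d))" by (intro shift_add shift_one gpc)
    ultimately have "fshift g (Dfps i) (geom (1 + p j c - d) * Q)"
      unfolding D by (intro fshift_mult fshift_geom) (simp_all add: add_diff_eq)
    with D ij show thesis by (intro that) auto
  next
    assume ij: "i \<noteq> j" "i \<noteq> j + 1"
    then have ne: "j \<noteq> i - 1" using R_pos[OF c] by auto
    have "fshift g (Dfps i) (Dfps i)"
      unfolding Dfps_def P3_def[symmetric] by (intro fshift_mult 1 3) (use ij ne in auto)
    with ij show thesis by (intro that) auto
  qed
qed

text \<open>If e D = D' e, the commutator with a summand of E has the coefficient D - D'. Changing p
  to p - 1 in the single affected factor gives D - D' = \<kappa> D / (z - p), and expanding 1/(z -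
  p) in powers of p raises the index of the current.\<close>

lemma comm_D_E:
  "comm (\<iota> (Dfps i $ m)) (E.J j k)
     = of_int ((if i = j + 1 then 1 else 0) - (if i = j then 1 else 0))
       * (\<Sum>t<m. \<iota> (Dfps i $ t) * E.J j (k + (m - 1 - t)))"
proof -
  define \<kappa> :: int where "\<kappa> = (if i = j + 1 then 1 else 0) - (if i = j then 1 else 0)"
  let ?A = "E.cf (R (j - 1)) j"
  have "comm (\<iota> (Dfps i $ m)) (\<iota> (?A c * p j c ^ k) * e j c)
    = of_int \<kappa> * (\<Sum>t<m. \<iota> (Dfps i $ t) * (\<iota> (?A c * p j c ^ (k + (m - 1 - t))) * e j c))"
    if c: "c \<in> R j" for c
  proof -
    obtain D' Q where D': "fshift (e j c) (Dfps i) D'"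
      "i = j \<Longrightarrow> Dfps i = (1 - fps_const (p j c) * fps_X) * Q"
      "i = j \<Longrightarrow> D' = (1 - fps_const (p j c - 1) * fps_X) * Q"
      "i = j + 1 \<Longrightarrow> Dfps i = geom (1 + p j c) * Q"
      "i = j + 1 \<Longrightarrow> D' = geom (1 + p j c - 1) * Q"
      "i \<noteq> j \<Longrightarrow> i \<noteq> j + 1 \<Longrightarrow> D' = Dfps i"
      by (rule fshift_Dfps[where g = "e j c" and d = 1 and i = i, OF c])
        (rule shift_e_p[OF c] shift_e_x[OF c] that; assumption)+
    have key: "(Dfps i - D') * (1 - fps_const (p j c) * fps_X) = fps_const (of_int \<kappa>) * (fps_X * Dfps i)"
    proof -
      consider "i = j" | "i = j + 1" | "i \<noteq> j" "i \<noteq> j + 1" by blast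
      then show ?thesis
      proof cases
        assume ij: "i = j"
        have 1: "fps_const (p j c - 1) = fps_const (p j c) - 1" by (simp flip: fps_const_sub)
        have "Dfps i - D' = - (fps_X * Q)"
          unfolding D'(2,3)[OF ij] 1 by (simp add: algebra_simps)
        then show ?thesis
          unfolding D'(2)[OF ij] using ij by (simp add: \<kappa>_def fps_const_neg[symmetric] del: fps_const_neg)
      next
        assume ij: "i = j + 1"
        have 1: "fps_const (1 + p j c) = 1 + fps_const (p j c)" by (simp flip: fps_const_add)
        have "(Dfps i - D') * (1 - fps_const (p j c) * fps_X)
          = geom (1 + p j c) * (1 - fps_const (p j c) * fps_X) * Q - geom (p j c) * (1 - fps_const (p j c) * fps_X) * Q"
          unfolding D'(4,5)[OF ij] by (simp add: algebra_simps)
        also have "geom (1 + p j c) * (1 - fps_const (p j c) * fps_X)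
          = geom (1 + p j c) * (1 - fps_const (1 + p j c) * fps_X) + geom (1 + p j c) * fps_X"
          unfolding 1 by (simp add: algebra_simps)
        finally show ?thesis
          unfolding geom_mult D'(4)[OF ij] using ij by (simp add: \<kappa>_def algebra_simps)
      qed (simp_all add: \<kappa>_def D'(6))
    qed
    have shD: "e j c * \<iota> (Dfps i $ m) = \<iota> (D' $ m) * e j c"
      using D'(1) by (simp add: fshift_def shift_def)
    have "comm (\<iota> (Dfps i $ m)) (\<iota> (?A c * p j c ^ k) * e j c) = \<iota> ((Dfps i - D') $ m * (?A c * p j c ^ k)) * e j c"
      unfolding comm_def mult.assoc shD
      by (simp add: \<iota>_mult \<iota>_diff mult.assoc[symmetric] left_diff_distrib \<iota>_comm[of _ "D' $ m"])
        (simp add: \<iota>_mult[symmetric] ac_simps)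
    also have "\<dots> = \<iota> (of_int \<kappa> * (\<Sum>t<m. Dfps i $ t * (?A c * p j c ^ (k + (m - 1 - t))))) * e j c"
      unfolding fps_nth_linear_quotient[OF key] by (simp only: sum_distrib_left sum_distrib_right power_add ac_simps)
    finally show ?thesis
      by (simp add: \<iota>_mult \<iota>_of_int \<iota>_sum sum_distrib_left sum_distrib_right mult.assoc)
  qed
  then have "comm (\<iota> (Dfps i $ m)) (E.J j k)
    = (\<Sum>c\<in>R j. of_int \<kappa> * (\<Sum>t<m. \<iota> (Dfps i $ t) * (\<iota> (?A c * p j c ^ (k + (m - 1 - t))) * e j c)))"
    unfolding E.J_def comm_sum_right by (intro sum.cong refl)
  also have "\<dots> = of_int \<kappa> * (\<Sum>t<m. \<iota> (Dfps i $ t) * E.J j (k + (m - 1 - t)))"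
    unfolding E.J_def sum_distrib_left by (rule sum.swap)
  finally show ?thesis unfolding \<kappa>_def .
qed

lemma comm_D_F:
  "comm (\<iota> (Dfps i $ m)) (F.J j k)
     = of_int ((if i = j then 1 else 0) - (if i = j + 1 then 1 else 0))
       * (\<Sum>t<m. F.J j (k + (m - 1 - t)) * \<iota> (Dfps i $ t))"
proof -
  define \<kappa> :: int where "\<kappa> = (if i = j then 1 else 0) - (if i = j + 1 then 1 else 0)"
  let ?B = "F.cf (R (Suc j)) j"
  have "comm (\<iota> (Dfps i $ m)) (\<iota> (?B c * (p j c + 1) ^ k) * f j c)
    = of_int \<kappa> * (\<Sum>t<m. (\<iota> (?B c * (p j c + 1) ^ (k + (m - 1 - t))) * f j c) * \<iota> (Dfps i $ t))"
    if c: "c \<in> R j" for c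
  proof -
    have shp: "shift (f j c) (p i r) (p i r - (if j = i \<and> c = r then - 1 else 0))" if "r \<in> R i" for i r
      using shift_f_p[OF c that] by (cases "j = i \<and> c = r") auto
    obtain D' Q where D': "fshift (f j c) (Dfps i) D'"
      "i = j \<Longrightarrow> Dfps i = (1 - fps_const (p j c) * fps_X) * Q"
      "i = j \<Longrightarrow> D' = (1 - fps_const (p j c - - 1) * fps_X) * Q"
      "i = j + 1 \<Longrightarrow> Dfps i = geom (1 + p j c) * Q"
      "i = j + 1 \<Longrightarrow> D' = geom (1 + p j c - - 1) * Q"
      "i \<noteq> j \<Longrightarrow> i \<noteq> j + 1 \<Longrightarrow> D' = Dfps i"
      by (rule fshift_Dfps[where g = "f j c" and d = "- 1" and i = i, OF c])
        (rule shp shift_f_x[OF c] that; assumption)+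
    let ?z = "p j c + 1"
    \<comment> \<open>Here the right-hand side contains D' and not D, because (Y3) puts D to the
      right of F and f D = D' f. The pole is p + 1, the variable of the F currents.\<close>
    have key: "(Dfps i - D') * (1 - fps_const ?z * fps_X) = fps_const (of_int \<kappa>) * (fps_X * D')"
    proof -
      consider "i = j" | "i = j + 1" | "i \<noteq> j" "i \<noteq> j + 1" by blast
      then show ?thesis
      proof cases
        assume ij: "i = j"
        have 1: "fps_const (p j c - - 1) = fps_const (p j c) + 1" by (simp flip: fps_const_add)
        have "Dfps i - D' = fps_X * Q"
          unfolding D'(2,3)[OF ij] 1 by (simp add: algebra_simps)
        then show ?thesis
          unfolding D'(3)[OF ij] using ij by (simp add: \<kappa>_def)
      next
        assume ij: "i = j + 1"
        have 1: "fps_const (?z + 1) = fps_const ?z + 1"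
          by (simp only: fps_const_add[symmetric] fps_const_1_eq_1)
        have "(Dfps i - D') * (1 - fps_const ?z * fps_X)
          = geom ?z * (1 - fps_const ?z * fps_X) * Q - geom (?z + 1) * (1 - fps_const ?z * fps_X) * Q"
          unfolding D'(4,5)[OF ij] by (simp add: algebra_simps)
        also have "geom (?z + 1) * (1 - fps_const ?z * fps_X)
          = geom (?z + 1) * (1 - fps_const (?z + 1) * fps_X) + geom (?z + 1) * fps_X"
          unfolding 1 by (simp add: algebra_simps)
        finally show ?thesis
          unfolding geom_mult D'(5)[OF ij] using ij
          by (simp add: \<kappa>_def algebra_simps fps_const_neg[symmetric] del: fps_const_neg)
      qed (simp_all add: \<kappa>_def D'(6))
    qed
    have shD: "f j c * \<iota> (Dfps i $ m) = \<iota> (D' $ m) * f j c" for m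
      using D'(1) by (simp add: fshift_def shift_def)
    have "comm (\<iota> (Dfps i $ m)) (\<iota> (?B c * ?z ^ k) * f j c) = \<iota> ((Dfps i - D') $ m * (?B c * ?z ^ k)) * f j c"
      unfolding comm_def mult.assoc shD
      by (simp add: \<iota>_mult \<iota>_diff mult.assoc[symmetric] left_diff_distrib \<iota>_comm[of _ "D' $ m"])
        (simp add: \<iota>_mult[symmetric] ac_simps)
    also have "\<dots> = \<iota> (of_int \<kappa> * (\<Sum>t<m. (?B c * ?z ^ (k + (m - 1 - t))) * D' $ t)) * f j c"
      unfolding fps_nth_linear_quotient[OF key] by (simp only: sum_distrib_left sum_distrib_right power_add ac_simps)
    finally show ?thesis
      by (simp add: \<iota>_mult \<iota>_of_int \<iota>_sum sum_distrib_left sum_distrib_right mult.assoc shD)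
  qed
  then have "comm (\<iota> (Dfps i $ m)) (F.J j k)
    = (\<Sum>c\<in>R j. of_int \<kappa> * (\<Sum>t<m. (\<iota> (?B c * (p j c + 1) ^ (k + (m - 1 - t))) * f j c) * \<iota> (Dfps i $ t)))"
    unfolding F.J_def comm_sum_right by (intro sum.cong refl)
  also have "\<dots> = of_int \<kappa> * (\<Sum>t<m. F.J j (k + (m - 1 - t)) * \<iota> (Dfps i $ t))"
    unfolding F.J_def sum_distrib_left sum_distrib_right by (rule sum.swap)
  finally show ?thesis unfolding \<kappa>_def .
qed

end

section \<open>Commutators of E with F\<close>

lemma comm_minus_left: "comm (- x) y = - comm x y"
  and comm_minus_right: "comm x (- y) = - comm x y"
  and comm_swap: "comm x y = - comm y x"
  by (simp_all add: comm_def)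

lemma comm_sum_left: "comm (sum b C) X = (\<Sum>c\<in>C. comm (b c) X)"
  by (simp add: comm_def sum_distrib_left sum_distrib_right sum_subtractf)

context comm_hom
begin

lemma summand_commute:
  assumes "shift e G G'" "shift f F F'" "F * G' = G * F'" "e * f = f * e"
  shows "comm (\<iota> F * e) (\<iota> G * f) = 0"
  using current_commute[of "{()}" "{()}" "\<lambda>_. e" "\<lambda>_. G" "\<lambda>_ _. G'" "\<lambda>_. f" "\<lambda>_. F" "\<lambda>_ _. F'"] assms
  by simp

lemma summand_comm_inverse:
  assumes "shift e G G'" "shift f F F'" "e * f = 1" "f * e = 1"
  shows "comm (\<iota> F * e) (\<iota> G * f) = \<iota> (F * G' - G * F')"
proof -
  have "\<iota> F * e * (\<iota> G * f) = \<iota> F * \<iota> G' * (e * f)"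
    using assms(1) unfolding shift_def by (metis mult.assoc)
  moreover have "\<iota> G * f * (\<iota> F * e) = \<iota> G * \<iota> F' * (f * e)"
    using assms(2) unfolding shift_def by (metis mult.assoc)
  ultimately show ?thesis by (simp add: comm_def assms \<iota>_diff \<iota>_mult)
qed

end

context gklo
begin

lemma shift_f_p_other: "r \<in> R i \<Longrightarrow> s \<in> R j \<Longrightarrow> i \<noteq> j \<or> r \<noteq> s \<Longrightarrow> shift (f i r) (p j s) (p j s)"
  using shift_f_p[of r i s j] by auto

lemma shift_e_Fcf:
  assumes "r \<in> R i" "s \<in> R j" "i \<noteq> j" "T \<subseteq> R (Suc j)" "Suc j = i \<Longrightarrow> r \<notin> T"
  shows "shift (e i r) (F.cf T j s) (F.cf T j s)"
  unfolding F.cf_def using assms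
  by (intro shift_mult shift_prod shift_diff shift_add shift_of_int shift_one E.shift_y_other E.shift_v_other) auto

lemma shift_f_Ecf:
  assumes "r \<in> R i" "s \<in> R j" "i \<noteq> j" "T \<subseteq> R (j - 1)" "j - 1 = i \<Longrightarrow> r \<notin> T"
  shows "shift (f i r) (E.cf T j s) (E.cf T j s)"
  unfolding E.cf_def ZE_def using assms
  by (intro shift_mult shift_prod shift_diff shift_of_int shift_f_x shift_f_p_other F.shift_v_other) auto

text \<open>If i = j, the shifts change one inverse in each coefficient, and \<open>v_swap\<close>
  equates v_rs(0) v_sr(1) with v_sr(0) v_rs(-1). If i = j + 1, each coefficient has one affected
  linear factor, and the two products agree after two sign changes. Otherwise nothing is shifted;
  this includes j = i + 1, since E_i involves the variables of node i - 1 and F_j those of node j +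
  1.\<close>

lemma comm_E_F_summand:
  assumes rs: "r \<in> R i" "s \<in> R j" and neq: "i \<noteq> j \<or> r \<noteq> s"
  shows "comm (\<iota> (E.cf (R (i - 1)) i r * p i r ^ k) * e i r)
    (\<iota> (F.cf (R (Suc j)) j s * (p j s + 1) ^ l) * f j s) = 0"
proof -
  let ?A = "E.cf (R (i - 1)) i r" and ?B = "F.cf (R (Suc j)) j s"
  have "\<exists>A' B'. shift (e i r) ?B B' \<and> shift (f j s) ?A A' \<and> ?A * B' = ?B * A'"
  proof -
    consider "i = j" | "i = Suc j" | "i \<noteq> j" "i \<noteq> Suc j" by blast
    then show ?thesis
    proof cases
      assume ij: "i = j"
      with neq have ne: "r \<noteq> s" by blast
      have sR: "s \<in> R i" using rs ij by simp
      define An where "An = (\<Prod>t\<in>R (i - 1). p i r - p (i - 1) t - of_int 1) * ZE i r"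
      define Bn where "Bn = (\<Prod>t\<in>R (Suc i). p i s + 1 - (p (Suc i) t + 1) - of_int (- 1))"
      define Vr where "Vr = (\<Prod>t\<in>R i - {r} - {s}. v i r t 0)"
      define Vs where "Vs = (\<Prod>t\<in>R i - {s} - {r}. v i s t 0)"
      have A: "?A = An * (v i r s 0 * Vr)"
        using prod.remove[of "R i - {r}" s "\<lambda>t. v i r t 0"] fin ne sR
        unfolding E.cf_def An_def Vr_def by simp
      have B: "?B = Bn * (v i s r 0 * Vs)"
        using prod.remove[of "R i - {s}" r "\<lambda>t. v i s t 0"] fin ne rs
        unfolding F.cf_def Bn_def Vs_def ij[symmetric] by simp
      have "shift (e i r) Bn Bn"
        unfolding Bn_def using rs sR ne
        by (intro shift_prod shift_diff shift_add shift_of_int shift_one E.shift_y_other) auto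
      moreover have "shift (e i r) Vs Vs"
        unfolding Vs_def using rs sR ne by (intro shift_prod E.shift_v_other) auto
      moreover have "shift (e i r) (v i s r 0) (v i s r 1)"
        using E.shift_v_right[OF rs(1) sR ne, of 0] by simp
      ultimately have sB: "shift (e i r) ?B (Bn * (v i s r 1 * Vs))"
        unfolding B by (intro shift_mult)
      have "shift (f i s) An An"
        unfolding An_def ZE_def using rs sR ne R_pos[OF rs(1)]
        by (intro shift_mult shift_prod shift_diff shift_of_int shift_f_x shift_f_p_other) auto
      moreover have "shift (f i s) Vr Vr"
        unfolding Vr_def using rs sR ne by (intro shift_prod F.shift_v_other) auto
      moreover have "shift (f i s) (v i r s 0) (v i r s (- 1))"
        using F.shift_v_right[OF sR rs(1) ne[symmetric], of 0] by simp
      ultimately have sA: "shift (f j s) ?A (An * (v i r s (- 1) * Vr))"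
        unfolding A ij[symmetric] by (intro shift_mult)
      have "v i s r 1 = - v i r s (- 1)" "v i s r 0 = - v i r s 0"
        using E.v_swap[OF rs(1) sR ne, of 1] E.v_swap[OF rs(1) sR ne, of 0] by simp_all
      then have "?A * (Bn * (v i s r 1 * Vs)) = ?B * (An * (v i r s (- 1) * Vr))"
        unfolding A B by (simp add: algebra_simps)
      with sA sB show ?thesis by blast
    next
      assume ij: "i = Suc j"
      then have i1: "i - 1 = j" by simp
      let ?Am = "E.cf (R j - {s}) i r" and ?Bm = "F.cf (R i - {r}) j s"
      have A: "?A = (p i r - p j s - 1) * ?Am"
        using E.cf_remove[OF rs(2) fin, of i r] i1 by simp
      have B: "?B = (p j s + 1 - p i r) * ?Bm"
        using F.cf_remove[OF rs(1) fin, of j s] ij by (simp add: diff_add_eq)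
      have "shift (e i r) ?Bm ?Bm"
        by (rule shift_e_Fcf[OF rs]) (simp_all add: ij Diff_subset)
      moreover have "shift (f j s) ?Am ?Am"
        by (rule shift_f_Ecf[OF rs(2,1)]) (simp_all add: ij Diff_subset)
      moreover have "shift (e i r) (p j s + 1 - p i r) (p j s + 1 - (p i r - 1))"
        using shift_e_p[OF rs(1,1)] shift_e_p[OF rs] ij
        by (intro shift_diff shift_add shift_one) auto
      moreover have "shift (f j s) (p i r - p j s - 1) (p i r - (p j s + 1) - 1)"
        using shift_f_p[OF rs(2,2)] shift_f_p[OF rs(2,1)] ij
        by (intro shift_diff shift_add shift_one) auto
      ultimately have "shift (e i r) ?B ((p j s + 1 - (p i r - 1)) * ?Bm)"
        "shift (f j s) ?A ((p i r - (p j s + 1) - 1) * ?Am)"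
        unfolding A B by (auto intro: shift_mult)
      moreover have "?A * ((p j s + 1 - (p i r - 1)) * ?Bm) = ?B * ((p i r - (p j s + 1) - 1) * ?Am)"
        unfolding A B by (simp add: algebra_simps)
      ultimately show ?thesis by blast
    next
      assume ij: "i \<noteq> j" "i \<noteq> Suc j"
      then have "i - 1 \<noteq> j" using R_pos[OF rs(1)] by auto
      then have "shift (f j s) ?A ?A"
        by (intro shift_f_Ecf[OF rs(2,1)]) (use ij in auto)
      moreover have "shift (e i r) ?B ?B"
        by (intro shift_e_Fcf[OF rs]) (use ij in auto)
      ultimately show ?thesis using mult.commute[of ?A ?B] by blast
    qed
  qed
  then obtain A' B' where AB: "shift (e i r) ?B B'" "shift (f j s) ?A A'" "?A * B' = ?B * A'"
    by blast
  show ?thesis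
  proof (rule summand_commute)
    show "shift (e i r) (?B * (p j s + 1) ^ l) (B' * (p j s + 1) ^ l)"
      using rs neq by (intro shift_mult shift_power AB shift_add shift_one E.shift_y_other) auto
    show "shift (f j s) (?A * p i r ^ k) (A' * p i r ^ k)"
      using rs neq by (intro shift_mult shift_power AB shift_f_p_other) auto
    have "?A * p i r ^ k * (B' * (p j s + 1) ^ l) = (?A * B') * (p i r ^ k * (p j s + 1) ^ l)"
      by (simp only: ac_simps)
    also have "\<dots> = ?B * (p j s + 1) ^ l * (A' * p i r ^ k)"
      unfolding AB by (simp only: ac_simps)
    finally show "?A * p i r ^ k * (B' * (p j s + 1) ^ l) = ?B * (p j s + 1) ^ l * (A' * p i r ^ k)" .
    show "e i r * f j s = f j s * e i r" using f_e_comm[OF rs(2,1)] by simp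
  qed
qed

lemma comm_E_F_distinct:
  assumes "i \<noteq> j"
  shows "comm (E.J i k) (F.J j l) = 0"
  unfolding E.J_def F.J_def comm_sum_left comm_sum_right
  by (intro sum.neutral ballI comm_E_F_summand) (use assms in auto)

text \<open>P_{i+1}(c) P_{i-1}(c - 1) Z_i(c), the numerator of the rational function behind
  (Y1).\<close>

definition Nev :: "nat \<Rightarrow> 's \<Rightarrow> 's" where
  "Nev i c = (\<Prod>t\<in>R (i + 1). c - p (i + 1) t) * (\<Prod>t\<in>R (i - 1). c - (1 + p (i - 1) t))
     * (\<Prod>s\<in>{s\<in>{1..N}. ii s = i}. c - x s)"

definition W :: "nat \<Rightarrow> nat \<Rightarrow> int \<Rightarrow> 's" where
  "W i r m = (\<Prod>t\<in>R i - {r}. v i r t 0 * v i r t m)"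

text \<open>The operators e and f cancel, so the commutator lies in the coefficient ring. In the
  order E F the operator e moves p + 1 back to p, in the order F E the operator f moves p to p + 1.
  Hence the two terms are taken at the two poles p and p + 1.\<close>

lemma comm_E_F_same_summand:
  assumes r: "r \<in> R i"
  shows "comm (\<iota> (E.cf (R (i - 1)) i r * p i r ^ k) * e i r)
    (\<iota> (F.cf (R (Suc i)) i r * (p i r + 1) ^ l) * f i r)
    = \<iota> (W i r (- 1) * p i r ^ (k + l) * Nev i (p i r) - W i r 1 * (p i r + 1) ^ (k + l) * Nev i (p i r + 1))"
proof -
  let ?A = "E.cf (R (i - 1)) i r" and ?B = "F.cf (R (Suc i)) i r"
  have i: "i - 1 \<noteq> i" using R_pos[OF r] by auto
  define V where "V m = (\<Prod>t\<in>R i - {r}. v i r t m)" for m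
  have W: "W i r m = V 0 * V m" for m by (simp add: W_def V_def prod.distrib)
  define A' where "A' = (\<Prod>t\<in>R (i - 1). p i r + 1 - p (i - 1) t - of_int 1)
    * (\<Prod>s\<in>{s\<in>{1..N}. ii s = i}. p i r + 1 - x s) * V 1"
  define B' where "B' = (\<Prod>t\<in>R (Suc i). p i r - 1 + 1 - (p (Suc i) t + 1) - of_int (- 1)) * 1 * V (- 1)"
  have ep: "shift (e i r) (p i r) (p i r - 1)" and fp: "shift (f i r) (p i r) (p i r + 1)"
    using shift_e_p[OF r r] shift_f_p[OF r r] by simp_all
  have B: "shift (e i r) ?B B'"
    unfolding F.cf_def B'_def V_def using r E.shift_v_left[of r i _ 0]
    by (intro shift_mult shift_prod shift_diff shift_add shift_one shift_of_int E.shift_y_other ep) auto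
  have A: "shift (f i r) ?A A'"
    unfolding E.cf_def ZE_def A'_def V_def using r i F.shift_v_left[of r i _ 0]
    by (intro shift_mult shift_prod shift_diff shift_of_int shift_f_p_other fp shift_f_x) auto
  have "comm (\<iota> (?A * p i r ^ k) * e i r) (\<iota> (?B * (p i r + 1) ^ l) * f i r)
    = \<iota> (?A * p i r ^ k * (B' * (p i r - 1 + 1) ^ l) - ?B * (p i r + 1) ^ l * (A' * (p i r + 1) ^ k))"
    by (intro summand_comm_inverse shift_mult shift_power shift_add shift_one A B ep fp ef[OF r] fe[OF r])
  also have "?A * p i r ^ k * (B' * (p i r - 1 + 1) ^ l) = W i r (- 1) * p i r ^ (k + l) * Nev i (p i r)"
  proof -
    have "?A = (\<Prod>t\<in>R (i - 1). p i r - (1 + p (i - 1) t)) * (\<Prod>s\<in>{s\<in>{1..N}. ii s = i}. p i r - x s) * V 0"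
      unfolding E.cf_def ZE_def V_def by (simp add: algebra_simps)
    moreover have "B' = (\<Prod>t\<in>R (i + 1). p i r - p (i + 1) t) * V (- 1)"
      by (simp add: B'_def algebra_simps)
    ultimately show ?thesis by (simp only: W Nev_def power_add diff_add_cancel mult.commute mult.left_commute mult.assoc)
  qed
  also have "?B * (p i r + 1) ^ l * (A' * (p i r + 1) ^ k) = W i r 1 * (p i r + 1) ^ (k + l) * Nev i (p i r + 1)"
  proof -
    have "A' = (\<Prod>t\<in>R (i - 1). p i r + 1 - (1 + p (i - 1) t)) * (\<Prod>s\<in>{s\<in>{1..N}. ii s = i}. p i r + 1 - x s) * V 1"
      by (simp add: A'_def algebra_simps)
    moreover have "?B = (\<Prod>t\<in>R (i + 1). p i r + 1 - p (i + 1) t) * V 0"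
      unfolding F.cf_def V_def by (simp add: algebra_simps)
    ultimately show ?thesis by (simp only: W Nev_def power_add mult.commute mult.left_commute mult.assoc)
  qed
  finally show ?thesis .
qed

text \<open>The sum of residues of z^m \<open>Nev i\<close> z / (P_i(z) P_i(z - 1)). The poles are
  indexed by pairs (r, b), the boolean b telling p_ir from p_ir + 1. Two poles with the same r
  differ by 1 or -1, which is its own inverse; all other differences are inverted by
  \<open>v\<close>.\<close>

lemma residue_sum:
  "(\<Sum>r\<in>R i. W i r (- 1) * p i r ^ m * Nev i (p i r) - W i r 1 * (p i r + 1) ^ m * Nev i (p i r + 1))
   = - coeff_int ((\<Prod>r\<in>R i. geom (p i r)) * (\<Prod>r\<in>R i. geom (1 + p i r))
       * (\<Prod>t\<in>R (i + 1). 1 - fps_const (p (i + 1) t) * fps_X)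
       * (\<Prod>t\<in>R (i - 1). 1 - fps_const (1 + p (i - 1) t) * fps_X)
       * (\<Prod>s\<in>{s\<in>{1..N}. ii s = i}. 1 - fps_const (x s) * fps_X))
     (int m + 1 + (- 2 * int (card (R i)) + int (card (R (i + 1))) + int (card (R (i - 1)))
       + int (card {s\<in>{1..N}. ii s = i})))"
proof -
  let ?I = "R i \<times> (UNIV :: bool set)"
  define c where "c = (\<lambda>(r, b). p i r + of_bool b)"
  define u :: "nat \<times> bool \<Rightarrow> nat \<times> bool \<Rightarrow> 's" where
    "u = (\<lambda>(r, b) (s, b'). if r = s then of_bool b - of_bool b' else v i r s (of_bool b - of_bool b'))"
  define U where "U P = (\<Prod>j\<in>?I - {P}. u P j)" for P
  have finI: "finite ?I" using fin by simp
  have inv: "u P P' * (c P - c P') = 1" if "P \<in> ?I" "P' \<in> ?I" "P \<noteq> P'" for P P'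
  proof -
    obtain r b s b' where P: "P = (r, b)" "P' = (s, b')" by fastforce
    show ?thesis
    proof (cases "r = s")
      case True
      with that P show ?thesis by (cases b; cases b') (auto simp: u_def c_def)
    next
      case False
      with that P have "v i r s (of_bool b - of_bool b') * (p i r - p i s + of_int (of_bool b - of_bool b')) = 1"
        by (intro v_inv) auto
      with False P show ?thesis by (simp add: u_def c_def algebra_simps)
    qed
  qed
  \<comment> \<open>The partner pole with the same r contributes -1 at p_ir and 1 at p_ir + 1, which
    is the origin of the opposite signs of the two terms.\<close>
  have U: "U (r, False) = - W i r (- 1)" "U (r, True) = W i r 1" if r: "r \<in> R i" for r
  proof -
    have *: "U (r, b) = u (r, b) (r, \<not> b) * (\<Prod>s\<in>R i - {r}. u (r, b) (s, True) * u (r, b) (s, False))" for b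
    proof -
      have "?I - {(r, b)} = insert (r, \<not> b) ((R i - {r}) \<times> UNIV)" using r by auto
      then have "U (r, b) = u (r, b) (r, \<not> b) * (\<Prod>j\<in>(R i - {r}) \<times> UNIV. u (r, b) j)"
        using finI fin by (simp add: U_def)
      also have "(\<Prod>j\<in>(R i - {r}) \<times> UNIV. u (r, b) j) = (\<Prod>s\<in>R i - {r}. \<Prod>b'\<in>UNIV. u (r, b) (s, b'))"
        by (simp add: prod.cartesian_product)
      finally show ?thesis by (simp add: UNIV_bool ac_simps)
    qed
    show "U (r, False) = - W i r (- 1)"
      unfolding * W_def by (auto simp: u_def mult.commute intro!: prod.cong)
    show "U (r, True) = W i r 1"
      unfolding * W_def by (auto simp: u_def mult.commute intro!: prod.cong)
  qed
  let ?G = "\<Prod>P\<in>?I. geom (c P)"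
  have 0: "coeff_int ?G (int m + 1 + (- int (card ?I))) = (\<Sum>P\<in>?I. U P * c P ^ m * 1)" for m
    using coeff_int_geom_prod[of ?I u c m] finI inv by (simp add: U_def)
  note 1 = coeff_int_mult_linear_prod[OF fin[of "i + 1"] 0, where b = "p (i + 1)"]
  note 2 = coeff_int_mult_linear_prod[OF fin[of "i - 1"] 1, where b = "\<lambda>t. 1 + p (i - 1) t"]
  have "finite {s\<in>{1..N}. ii s = i}" by simp
  note 3 = coeff_int_mult_linear_prod[OF this 2, where b = x]
  have G: "?G = (\<Prod>r\<in>R i. geom (p i r)) * (\<Prod>r\<in>R i. geom (1 + p i r))"
  proof -
    have "?G = (\<Prod>r\<in>R i. \<Prod>b\<in>UNIV. geom (c (r, b)))"
      by (simp add: prod.cartesian_product)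
    then show ?thesis by (simp add: UNIV_bool c_def prod.distrib ac_simps)
  qed
  have idx: "- int (card ?I) = - 2 * int (card (R i))" by (simp add: card_cartesian_product)
  have "(\<Sum>P\<in>?I. U P * c P ^ m * (1 * (\<Prod>k\<in>R (i + 1). c P - p (i + 1) k)
      * (\<Prod>k\<in>R (i - 1). c P - (1 + p (i - 1) k)) * (\<Prod>k\<in>{s\<in>{1..N}. ii s = i}. c P - x k)))
    = (\<Sum>P\<in>?I. U P * c P ^ m * Nev i (c P))"
    unfolding Nev_def by (simp only: mult_1_left)
  also have "\<dots> = (\<Sum>r\<in>R i. \<Sum>b\<in>UNIV. U (r, b) * c (r, b) ^ m * Nev i (c (r, b)))"
    by (simp add: sum.cartesian_product)
  also have "\<dots> = - (\<Sum>r\<in>R i. W i r (- 1) * p i r ^ m * Nev i (p i r) - W i r 1 * (p i r + 1) ^ m * Nev i (p i r + 1))"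
    unfolding sum_negf[symmetric] by (intro sum.cong refl) (simp add: UNIV_bool U c_def)
  finally have sum_U: "(\<Sum>P\<in>?I. U P * c P ^ m * (1 * (\<Prod>k\<in>R (i + 1). c P - p (i + 1) k)
      * (\<Prod>k\<in>R (i - 1). c P - (1 + p (i - 1) k)) * (\<Prod>k\<in>{s\<in>{1..N}. ii s = i}. c P - x k)))
    = - (\<Sum>r\<in>R i. W i r (- 1) * p i r ^ m * Nev i (p i r) - W i r 1 * (p i r + 1) ^ m * Nev i (p i r + 1))" .
  show ?thesis
    unfolding 3[of m, unfolded G idx sum_U] by (simp only: minus_minus)
qed

text \<open>In the product of the two series the factors Z_k with k < i cancel, leaving -P_{i+1}(z)
  P_{i-1}(z - 1) Z_i(z) / (P_i(z) P_i(z - 1)). Since i \<ge> 1, all exponents in Z_i are 1, so the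
  points x_s are not poles. The difference of the two \<open>Ddeg\<close> is the degree of this
  function.\<close>

lemma comm_E_F_same:
  assumes i: "1 \<le> i" "i < n"
  shows "comm (E.J i k) (F.J i l) = \<iota> (coeff_int (Dtfps i * Dfps (i + 1))
    (int (k + l) + 1 + Ddeg n a N ii \<gamma> (i + 1) - Ddeg n a N ii \<gamma> i))"
proof -
  let ?Z = "{s\<in>{1..N}. ii s = i}"
  let ?q = "- 2 * int (card (R i)) + int (card (R (i + 1))) + int (card (R (i - 1))) + int (card ?Z)"
  let ?\<phi> = "\<lambda>s. if \<gamma> s = 1 then 1 - fps_const (x s) * fps_X else geom (x s)"
  let ?\<psi> = "\<lambda>s. if \<gamma> s = 1 then geom (x s) else 1 - fps_const (x s) * fps_X"
  have split: "ZK (i + 1) = ZK i \<union> ?Z" "ZK i \<inter> ?Z = {}" by auto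
  have \<gamma>1: "\<gamma> s = 1" if "s \<in> ?Z" for s using that \<gamma>_pos[of s] i by auto
  have Z: "(\<Prod>s\<in>ZK (i + 1). ?\<phi> s) = (\<Prod>s\<in>ZK i. ?\<phi> s) * (\<Prod>s\<in>?Z. 1 - fps_const (x s) * fps_X)"
  proof -
    have "(\<Prod>s\<in>ZK (i + 1). ?\<phi> s) = (\<Prod>s\<in>ZK i. ?\<phi> s) * (\<Prod>s\<in>?Z. ?\<phi> s)"
      unfolding split(1) by (rule prod.union_disjoint) (use split(2) in auto)
    also have "(\<Prod>s\<in>?Z. ?\<phi> s) = (\<Prod>s\<in>?Z. 1 - fps_const (x s) * fps_X)"
      by (rule prod.cong) (use \<gamma>1 in auto)
    finally show ?thesis .
  qed
  have deg: "Ddeg n a N ii \<gamma> (i + 1) - Ddeg n a N ii \<gamma> i = ?q"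
  proof -
    have "(\<Sum>s\<in>ZK (i + 1). \<gamma> s) = (\<Sum>s\<in>ZK i. \<gamma> s) + (\<Sum>s\<in>?Z. \<gamma> s)"
      unfolding split(1) by (rule sum.union_disjoint) (use split(2) in auto)
    also have "(\<Sum>s\<in>?Z. \<gamma> s) = int (card ?Z)" using \<gamma>1 by simp
    finally show ?thesis by (simp add: Ddeg_def card_R)
  qed
  have 1: "(\<Prod>s\<in>ZK i. ?\<phi> s) * (\<Prod>s\<in>ZK i. ?\<psi> s) = 1"
    unfolding prod.distrib[symmetric]
    by (auto intro!: prod.neutral simp: geom_mult mult.commute[of _ "geom _"])
  let ?F = "(\<Prod>r\<in>R i. geom (p i r)) * (\<Prod>r\<in>R i. geom (1 + p i r))
       * (\<Prod>t\<in>R (i + 1). 1 - fps_const (p (i + 1) t) * fps_X)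
       * (\<Prod>t\<in>R (i - 1). 1 - fps_const (1 + p (i - 1) t) * fps_X)
       * (\<Prod>s\<in>?Z. 1 - fps_const (x s) * fps_X)"
  have "Dtfps i * Dfps (i + 1) = - (?F * ((\<Prod>s\<in>ZK i. ?\<phi> s) * (\<Prod>s\<in>ZK i. ?\<psi> s)))"
    unfolding Dtfps_def Dfps_def Z add_diff_cancel_right'
    by (simp only: mult_minus_left mult_minus_right ac_simps)
  then have F: "Dtfps i * Dfps (i + 1) = - ?F" unfolding 1 by simp
  have "comm (E.J i k) (F.J i l)
    = (\<Sum>r\<in>R i. \<Sum>s\<in>R i. comm (\<iota> (E.cf (R (i - 1)) i r * p i r ^ k) * e i r)
        (\<iota> (F.cf (R (Suc i)) i s * (p i s + 1) ^ l) * f i s))"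
    unfolding E.J_def F.J_def comm_sum_left comm_sum_right by (rule sum.swap)
  also have "\<dots> = (\<Sum>r\<in>R i. comm (\<iota> (E.cf (R (i - 1)) i r * p i r ^ k) * e i r)
        (\<iota> (F.cf (R (Suc i)) i r * (p i r + 1) ^ l) * f i r))"
  proof (rule sum.cong[OF refl])
    fix r assume r: "r \<in> R i"
    show "(\<Sum>s\<in>R i. comm (\<iota> (E.cf (R (i - 1)) i r * p i r ^ k) * e i r)
        (\<iota> (F.cf (R (Suc i)) i s * (p i s + 1) ^ l) * f i s))
      = comm (\<iota> (E.cf (R (i - 1)) i r * p i r ^ k) * e i r)
        (\<iota> (F.cf (R (Suc i)) i r * (p i r + 1) ^ l) * f i r)"
      (is "(\<Sum>s\<in>R i. ?c s) = _")
    proof -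
      have "(\<Sum>s\<in>R i - {r}. ?c s) = 0"
        by (intro sum.neutral ballI comm_E_F_summand) (use r in auto)
      then show ?thesis unfolding sum.remove[OF fin r] by (simp only: add_0_right)
    qed
  qed
  also have "\<dots> = \<iota> (- coeff_int ?F (int (k + l) + 1 + ?q))"
    unfolding residue_sum[symmetric] \<iota>_sum
    by (rule sum.cong[OF refl]) (rule comm_E_F_same_summand)
  also have "- coeff_int ?F (int (k + l) + 1 + ?q) = coeff_int (- ?F) (int (k + l) + 1 + ?q)"
    by (simp add: coeff_int_def)
  finally show ?thesis unfolding F deg[symmetric] by (simp only: add_diff_eq)
qed

end

section \<open>All defining relations\<close>

lemma sum_from_one:
  "1 \<le> r \<Longrightarrow> (\<Sum>t\<in>{1..<r}. g t) = (\<Sum>t<r - 1. g (Suc t))" for g :: "nat \<Rightarrow> 'a::comm_monoid_add"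
  by (rule sum.reindex_bij_witness[where i = Suc and j = "\<lambda>t. t - 1"]) auto

lemma sum_int_shift:
  "d \<le> r \<Longrightarrow> (\<Sum>t\<in>{d..r - 1}. g t) = (\<Sum>t<nat (r - d). g (int t + d))"
  for g :: "int \<Rightarrow> 'a::comm_monoid_add"
  by (rule sum.reindex_bij_witness[where i = "\<lambda>t. int t + d" and j = "\<lambda>t. nat (t - d)"]) auto

context gklo
begin

text \<open>The generators are given by representatives in another ring, of which only the images
  under \<open>h\<close> are known; \<open>h\<close> will be the projection from the free algebra to
  its quotient.\<close>

lemma Yrels_vanish:
  fixes d :: "nat \<Rightarrow> int" and h :: "'q::ring_1 \<Rightarrow> 'r"
  assumes h: "unital_hom h"
    and d: "\<And>i. 1 \<le> i \<Longrightarrow> i \<le> n \<Longrightarrow> d i = - Ddeg n a N ii \<gamma> i"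
    and hE: "\<And>i k. 1 \<le> i \<Longrightarrow> i < n \<Longrightarrow> 1 \<le> k \<Longrightarrow> h (E0 i k) = - E.J i (k - 1)"
    and hF: "\<And>i k. 1 \<le> i \<Longrightarrow> i < n \<Longrightarrow> 1 \<le> k \<Longrightarrow> h (F0 i k) = F.J i (k - 1)"
    and hD: "\<And>i t. 1 \<le> i \<Longrightarrow> i \<le> n \<Longrightarrow> h (D0 i t) = \<iota> (coeff_int (Dfps i) (t - d i))"
    and hDt: "\<And>i t. 1 \<le> i \<Longrightarrow> i \<le> n \<Longrightarrow> h (Dt0 i t) = \<iota> (coeff_int (Dtfps i) (t + d i))"
  shows "Yrels n d E0 F0 D0 Dt0 \<subseteq> {X. h X = 0}"
proof -
  interpret h: unital_hom h by (rule h)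
  define EE where "EE i k = h (E0 i k)" for i k
  define FF where "FF i k = h (F0 i k)" for i k
  define D where "D i t = h (D0 i t)" for i t
  define Dt where "Dt i t = h (Dt0 i t)" for i t
  note folds = EE_def[symmetric] FF_def[symmetric] D_def[symmetric] Dt_def[symmetric]
  note EE = hE[unfolded folds] and FF = hF[unfolded folds] and D = hD[unfolded folds] and Dt = hDt[unfolded folds]
  have Y0a: "D i (d i) - 1 = 0" if "1 \<le> i" "i \<le> n" for i
    using that by (simp add: D coeff_int_def Dfps_0 \<iota>_one)
  have Y0b: "(\<Sum>t\<in>{d i..int r + d i}. D i t * Dt i (int r - t)) + (if r = 0 then 1 else 0) = 0"
    if i: "1 \<le> i" "i \<le> n" for i r
  proof -
    have "(\<Sum>t\<in>{d i..int r + d i}. D i t * Dt i (int r - t))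
      = (\<Sum>t\<in>{d i..int r + d i}. \<iota> (coeff_int (Dfps i) (t - d i)) * \<iota> (coeff_int (Dtfps i) (int r + d i - t)))"
      unfolding D[OF i] Dt[OF i] by (simp add: diff_add_eq)
    then show ?thesis
      unfolding sum_int_convolution Dfps_Dtfps by (simp add: coeff_int_def \<iota>_minus \<iota>_one \<iota>_zero)
  qed
  have Y0c: "comm (D i r) (D j s) = 0" if "1 \<le> i" "i \<le> n" "1 \<le> j" "j \<le> n" for i j r s
    using that by (simp add: D comm_def \<iota>_comm)
  have Y1: "comm (EE i r) (FF j s) + (if i = j then
          (\<Sum>t\<in>{- d i..int r + int s - 1 - d (i+1)}. Dt i t * D (i+1) (int r + int s - t - 1)) else 0) = 0"
    if ij: "1 \<le> i" "i < n" "1 \<le> j" "j < n" "1 \<le> r" "1 \<le> s" for i j r s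
  proof (cases "i = j")
    case True
    define M where "M = int r + int s - 1 - d (i + 1) + d i"
    have i: "i \<le> n" "1 \<le> i + 1" "i + 1 \<le> n" using ij by auto
    have "(\<Sum>t\<in>{- d i..int r + int s - 1 - d (i+1)}. Dt i t * D (i+1) (int r + int s - t - 1))
      = (\<Sum>t\<in>{- d i..M + - d i}. \<iota> (coeff_int (Dtfps i) (t - - d i)) * \<iota> (coeff_int (Dfps (i + 1)) (M + - d i - t)))"
      unfolding Dt[OF ij(1) i(1)] D[OF i(2,3)] by (intro sum.cong) (simp_all add: M_def algebra_simps)
    also have "\<dots> = \<iota> (coeff_int (Dtfps i * Dfps (i + 1)) M)" by (rule sum_int_convolution)
    also have "M = int (r - 1 + (s - 1)) + 1 + Ddeg n a N ii \<gamma> (i + 1) - Ddeg n a N ii \<gamma> i"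
      unfolding M_def d[OF ij(1) i(1)] d[OF i(2,3)] using ij by (simp add: of_nat_diff)
    also have "\<iota> (coeff_int (Dtfps i * Dfps (i + 1)) \<dots>) = comm (E.J i (r - 1)) (F.J i (s - 1))"
      by (rule comm_E_F_same[OF ij(1,2), symmetric])
    finally have "(\<Sum>t\<in>{- d i..int r + int s - 1 - d (i+1)}. Dt i t * D (i+1) (int r + int s - t - 1))
      = comm (E.J i (r - 1)) (F.J i (s - 1))" .
    moreover have "comm (EE i r) (FF i s) = - comm (E.J i (r - 1)) (F.J i (s - 1))"
      unfolding EE[OF ij(1,2,5)] FF[OF ij(1,2,6)] comm_minus_left ..
    ultimately show ?thesis unfolding True[symmetric] by (simp only: if_True simp_thms left_minus)
  next
    case False
    have "comm (EE i r) (FF j s) = 0"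
      unfolding EE[OF ij(1,2,5)] FF[OF ij(3,4,6)] comm_minus_left comm_E_F_distinct[OF False] by simp
    with False show ?thesis by simp
  qed
  have Y2: "comm (D i r) (EE j s) - of_int ((if i = j + 1 then 1 else 0) - (if i = j then 1 else 0)) *
          (\<Sum>t\<in>{d i..r - 1}. D i t * EE j (nat (r + int s - t - 1))) = 0"
    if ij: "1 \<le> i" "i \<le> n" "1 \<le> j" "j < n" "d i \<le> r" "1 \<le> s" for i j r s
  proof -
    let ?m = "nat (r - d i)"
    have "(\<Sum>t\<in>{d i..r - 1}. D i t * EE j (nat (r + int s - t - 1)))
      = (\<Sum>t<?m. D i (int t + d i) * EE j (nat (r + int s - (int t + d i) - 1)))"
      by (rule sum_int_shift[OF ij(5)])
    also have "\<dots> = (\<Sum>t<?m. - (\<iota> (Dfps i $ t) * E.J j (s - 1 + (?m - 1 - t))))"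
    proof (rule sum.cong[OF refl])
      fix t assume "t \<in> {..<?m}"
      \<comment> \<open>t < ?m keeps the index of E at least \<open>s\<close>, so it is positive and
        truncation by \<open>nat\<close> loses nothing.\<close>
      then have "nat (r + int s - (int t + d i) - 1) = Suc (s - 1 + (?m - 1 - t))"
        using ij by auto
      then show "D i (int t + d i) * EE j (nat (r + int s - (int t + d i) - 1))
        = - (\<iota> (Dfps i $ t) * E.J j (s - 1 + (?m - 1 - t)))"
        using ij by (simp add: D EE coeff_int_def)
    qed
    finally have *: "(\<Sum>t\<in>{d i..r - 1}. D i t * EE j (nat (r + int s - t - 1)))
      = - (\<Sum>t<?m. \<iota> (Dfps i $ t) * E.J j (s - 1 + (?m - 1 - t)))" by (simp only: sum_negf)
    have Di: "D i r = \<iota> (Dfps i $ ?m)" using ij by (simp add: D coeff_int_def)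
    show ?thesis
      unfolding * Di EE[OF ij(3,4,6)] comm_minus_right comm_D_E by simp
  qed
  have Y3: "comm (D i r) (FF j s) - of_int ((if i = j then 1 else 0) - (if i = j + 1 then 1 else 0)) *
          (\<Sum>t\<in>{d i..r - 1}. FF j (nat (r + int s - t - 1)) * D i t) = 0"
    if ij: "1 \<le> i" "i \<le> n" "1 \<le> j" "j < n" "d i \<le> r" "1 \<le> s" for i j r s
  proof -
    let ?m = "nat (r - d i)"
    have "(\<Sum>t\<in>{d i..r - 1}. FF j (nat (r + int s - t - 1)) * D i t)
      = (\<Sum>t<?m. FF j (nat (r + int s - (int t + d i) - 1)) * D i (int t + d i))"
      by (rule sum_int_shift[OF ij(5)])
    also have "\<dots> = (\<Sum>t<?m. F.J j (s - 1 + (?m - 1 - t)) * \<iota> (Dfps i $ t))"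
    proof (rule sum.cong[OF refl])
      fix t assume "t \<in> {..<?m}"
      then have "nat (r + int s - (int t + d i) - 1) = Suc (s - 1 + (?m - 1 - t))"
        using ij by auto
      then show "FF j (nat (r + int s - (int t + d i) - 1)) * D i (int t + d i)
        = F.J j (s - 1 + (?m - 1 - t)) * \<iota> (Dfps i $ t)"
        using ij by (simp add: D FF coeff_int_def)
    qed
    finally have *: "(\<Sum>t\<in>{d i..r - 1}. FF j (nat (r + int s - t - 1)) * D i t)
      = (\<Sum>t<?m. F.J j (s - 1 + (?m - 1 - t)) * \<iota> (Dfps i $ t))" .
    have Di: "D i r = \<iota> (Dfps i $ ?m)" using ij by (simp add: D coeff_int_def)
    show ?thesis
      unfolding * Di FF[OF ij(3,4,6)] comm_D_F by simp
  qed
  have Y4: "comm (EE i r) (EE i s) - ((\<Sum>t\<in>{1..<r}. EE i t * EE i (r + s - t - 1))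
          - (\<Sum>t\<in>{1..<s}. EE i t * EE i (r + s - t - 1))) = 0"
    if ij: "1 \<le> i" "i < n" "1 \<le> r" "1 \<le> s" for i r s
  proof -
    have *: "(\<Sum>t\<in>{1..<q}. EE i t * EE i (r + s - t - 1))
      = (\<Sum>t<q - 1. E.J i t * E.J i (r - 1 + (s - 1) - 1 - t))" if q: "q = r \<or> q = s" for q
    proof -
      have "1 \<le> q" using q ij by auto
      then have "(\<Sum>t\<in>{1..<q}. EE i t * EE i (r + s - t - 1))
        = (\<Sum>t<q - 1. EE i (Suc t) * EE i (r + s - Suc t - 1))" by (rule sum_from_one)
      also have "\<dots> = (\<Sum>t<q - 1. E.J i t * E.J i (r - 1 + (s - 1) - 1 - t))"
      proof (rule sum.cong[OF refl])
        fix t assume "t \<in> {..<q - 1}"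
        then have n: "1 \<le> r + s - Suc t - 1" "1 \<le> Suc t" "Suc t - 1 = t" "r + s - Suc t - 1 - 1 = r - 1 + (s - 1) - 1 - t"
          using q ij by auto
        show "EE i (Suc t) * EE i (r + s - Suc t - 1) = E.J i t * E.J i (r - 1 + (s - 1) - 1 - t)"
          unfolding EE[OF ij(1,2) n(1)] EE[OF ij(1,2) n(2)] n(3-) by simp
      qed
      finally show ?thesis .
    qed
    show ?thesis
      unfolding *[OF disjI1[OF refl]] *[OF disjI2[OF refl]] EE[OF ij(1,2,3)] EE[OF ij(1,2,4)]
        comm_minus_left comm_minus_right E.J_comm_same
      by (simp only: of_int_1 mult_1_left minus_minus diff_self)
  qed
  have Y5: "comm (FF i r) (FF i s) - ((\<Sum>t\<in>{1..<s}. FF i (r + s - t - 1) * FF i t)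
          - (\<Sum>t\<in>{1..<r}. FF i (r + s - t - 1) * FF i t)) = 0"
    if ij: "1 \<le> i" "i < n" "1 \<le> r" "1 \<le> s" for i r s
  proof -
    let ?m = "r - 1 + (s - 1) - 1"
    have *: "(\<Sum>t\<in>{1..<q}. FF i (r + s - t - 1) * FF i t)
      = (\<Sum>t<q - 1. F.J i (?m - t) * F.J i (?m - (?m - t)))" if q: "q = r \<or> q = s" for q
    proof -
      have "1 \<le> q" using q ij by auto
      then have "(\<Sum>t\<in>{1..<q}. FF i (r + s - t - 1) * FF i t)
        = (\<Sum>t<q - 1. FF i (r + s - Suc t - 1) * FF i (Suc t))" by (rule sum_from_one)
      also have "\<dots> = (\<Sum>t<q - 1. F.J i (?m - t) * F.J i (?m - (?m - t)))"
      proof (rule sum.cong[OF refl])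
        fix t assume "t \<in> {..<q - 1}"
        then have n: "1 \<le> r + s - Suc t - 1" "1 \<le> Suc t" "Suc t - 1 = t" "r + s - Suc t - 1 - 1 = ?m - t" "?m - (?m - t) = t"
          using q ij by auto
        show "FF i (r + s - Suc t - 1) * FF i (Suc t) = F.J i (?m - t) * F.J i (?m - (?m - t))"
          unfolding FF[OF ij(1,2) n(1)] FF[OF ij(1,2) n(2)] n(3-) by simp
      qed
      finally show ?thesis .
    qed
    have "comm (FF i r) (FF i s) = of_int (- 1) * ((\<Sum>t<r - 1. F.J i t * F.J i (?m - t)) - (\<Sum>t<s - 1. F.J i t * F.J i (?m - t)))"
      unfolding FF[OF ij(1,2,3)] FF[OF ij(1,2,4)] by (rule F.J_comm_same)
    \<comment> \<open>(Y5) writes the products in the opposite order. The reflection t -> ?m - t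
      exchanges the two factors without changing the difference of the sums.\<close>
    also have "(\<Sum>t<r - 1. F.J i t * F.J i (?m - t)) - (\<Sum>t<s - 1. F.J i t * F.J i (?m - t))
      = (\<Sum>t<r - 1. F.J i (?m - t) * F.J i (?m - (?m - t))) - (\<Sum>t<s - 1. F.J i (?m - t) * F.J i (?m - (?m - t)))"
      by (rule sum_lessThan_diff_reflect)
    finally show ?thesis
      unfolding *[OF disjI1[OF refl]] *[OF disjI2[OF refl]] by simp
  qed
  have Y6: "comm (EE i (r+1)) (EE (i+1) s) - comm (EE i r) (EE (i+1) (s+1)) + EE i r * EE (i+1) s = 0"
    if ij: "1 \<le> i" "i + 1 < n" "1 \<le> r" "1 \<le> s" for i r s
  proof -
    have "i < n" "1 \<le> i + 1" "1 \<le> r + 1" "1 \<le> s + 1" using ij by auto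
    note rw = EE[OF ij(1) this(1) ij(3)] EE[OF ij(1) this(1,3)] EE[OF this(2) ij(2,4)] EE[OF this(2) ij(2) this(4)]
    have "comm (E.J i (r - 1 + 1)) (E.J (i + 1) (s - 1)) - comm (E.J i (r - 1)) (E.J (i + 1) (s - 1 + 1))
      = - of_int 1 * (E.J i (r - 1) * E.J (i + 1) (s - 1))"
      by (rule E.J_comm_nb) simp
    then show ?thesis
      unfolding rw comm_minus_left comm_minus_right using ij by simp
  qed
  have Y7: "comm (FF i (r+1)) (FF (i+1) s) - comm (FF i r) (FF (i+1) (s+1)) - FF (i+1) s * FF i r = 0"
    if ij: "1 \<le> i" "i + 1 < n" "1 \<le> r" "1 \<le> s" for i r s
  proof -
    have "i < n" "1 \<le> i + 1" "1 \<le> r + 1" "1 \<le> s + 1" using ij by auto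
    note rw = FF[OF ij(1) this(1) ij(3)] FF[OF ij(1) this(1,3)] FF[OF this(2) ij(2,4)] FF[OF this(2) ij(2) this(4)]
    \<comment> \<open>For F the neighbour of i is i + 1, so the current that shifts the other one is
      that of node i + 1 and comes first.\<close>
    have "comm (F.J (i + 1) (s - 1 + 1)) (F.J i (r - 1)) - comm (F.J (i + 1) (s - 1)) (F.J i (r - 1 + 1))
      = - of_int (- 1) * (F.J (i + 1) (s - 1) * F.J i (r - 1))"
      by (rule F.J_comm_nb) simp
    then show ?thesis
      unfolding rw using ij by (simp add: comm_swap[of "F.J i _"])
  qed
  have Y8: "comm (EE i r) (EE j s) = 0" and Y9: "comm (FF i r) (FF j s) = 0"
    if ij: "1 \<le> i" "i < n" "1 \<le> j" "j < n" "i + 1 < j \<or> j + 1 < i" "1 \<le> r" "1 \<le> s" for i j r s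
  proof -
    show "comm (EE i r) (EE j s) = 0"
      unfolding EE[OF ij(1,2,6)] EE[OF ij(3,4,7)] comm_minus_left comm_minus_right
      by (subst E.J_comm_far) (use ij in auto)
    show "comm (FF i r) (FF j s) = 0"
      unfolding FF[OF ij(1,2,6)] FF[OF ij(3,4,7)]
      by (rule F.J_comm_far) (use ij in auto)
  qed
  have Y10: "comm (EE i r) (comm (EE i s) (EE j t)) + comm (EE i s) (comm (EE i r) (EE j t)) = 0"
    and Y11: "comm (FF i r) (comm (FF i s) (FF j t)) + comm (FF i s) (comm (FF i r) (FF j t)) = 0"
    if ij: "1 \<le> i" "i < n" "1 \<le> j" "j < n" "j = i + 1 \<or> i = j + 1" "1 \<le> r" "1 \<le> s" "1 \<le> t" for i j r s t
  proof -
    have "comm (E.J i (r - 1)) (comm (E.J i (s - 1)) (E.J j (t - 1)))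
      + comm (E.J i (s - 1)) (comm (E.J i (r - 1)) (E.J j (t - 1))) = 0"
      by (rule E.J_serre) (use ij in auto)
    then show "comm (EE i r) (comm (EE i s) (EE j t)) + comm (EE i s) (comm (EE i r) (EE j t)) = 0"
      unfolding EE[OF ij(1,2,6)] EE[OF ij(1,2,7)] EE[OF ij(3,4,8)] comm_minus_left comm_minus_right
      by (simp only: minus_minus minus_add_distrib[symmetric]) simp
    show "comm (FF i r) (comm (FF i s) (FF j t)) + comm (FF i s) (comm (FF i r) (FF j t)) = 0"
      unfolding FF[OF ij(1,2,6)] FF[OF ij(1,2,7)] FF[OF ij(3,4,8)]
      by (rule F.J_serre) (use ij in auto)
  qed
  have vanish: "{X. Q X} \<subseteq> {X. h X = 0}" if "\<And>X. Q X \<Longrightarrow> h X = 0" for Q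
    using that by auto
  show ?thesis
    \<comment> \<open>Once \<open>h\<close> has been pushed through a relation, the result is one of
      the facts above, with the side conditions of the set comprehension as its premises.\<close>
    unfolding Yrels_def
    by (intro Un_least; rule vanish; elim exE conjE; erule ssubst;
        simp (no_asm) only: h.\<iota>_add h.\<iota>_diff h.\<iota>_mult h.\<iota>_sum h.\<iota>_bracket h.\<iota>_of_int
          h.\<iota>_one h.\<iota>_zero if_distrib[of h] folds;
        rule Y0a Y0b Y0c Y1 Y2 Y3 Y4 Y5 Y6 Y7 Y8 Y9 Y10 Y11; assumption)
qed

end

section \<open>The difference operator algebra as a type\<close>

lemma ideal_gen_left: "x \<in> ideal_gen X \<Longrightarrow> u * x \<in> ideal_gen X"
  using ideal_gen.mult[of x X u 1] by simp

lemma ideal_gen_right: "x \<in> ideal_gen X \<Longrightarrow> x * u \<in> ideal_gen X"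
  using ideal_gen.mult[of x X 1 u] by simp

lemma ideal_gen_minus: "x \<in> ideal_gen X \<Longrightarrow> - x \<in> ideal_gen X"
  using ideal_gen_left[of x X "- 1"] by simp

lemma ideal_gen_diff: "x \<in> ideal_gen X \<Longrightarrow> y \<in> ideal_gen X \<Longrightarrow> x - y \<in> ideal_gen X"
  using ideal_gen.add[OF _ ideal_gen_minus, of x X y] by simp

lemma ideal_gen_diff_swap: "x - y \<in> ideal_gen X \<Longrightarrow> y - x \<in> ideal_gen X"
  using ideal_gen_minus[of "x - y" X] by simp

lemma ideal_gen_diff_trans: "x - y \<in> ideal_gen X \<Longrightarrow> y - z \<in> ideal_gen X \<Longrightarrow> x - z \<in> ideal_gen X"
  using ideal_gen.add[of "x - y" X "y - z"] by simp

lemma ideal_gen_diff_add: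
  "x - x' \<in> ideal_gen X \<Longrightarrow> y - y' \<in> ideal_gen X \<Longrightarrow> x + y - (x' + y') \<in> ideal_gen X"
  using ideal_gen.add[of "x - x'" X "y - y'"] by (simp add: algebra_simps)

lemma ideal_gen_diff_diff:
  "x - x' \<in> ideal_gen X \<Longrightarrow> y - y' \<in> ideal_gen X \<Longrightarrow> x - y - (x' - y') \<in> ideal_gen X"
  using ideal_gen_diff[of "x - x'" X "y - y'"] by (simp add: algebra_simps)

lemma ideal_gen_diff_mult:
  assumes "x - x' \<in> ideal_gen X" "y - y' \<in> ideal_gen X"
  shows "x * y - x' * y' \<in> ideal_gen X"
proof -
  have "(x - x') * y + x' * (y - y') \<in> ideal_gen X"
    using assms by (intro ideal_gen.add ideal_gen_left ideal_gen_right)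
  then show ?thesis by (simp add: algebra_simps)
qed

lemma ideal_gen_sum: "(\<And>x. x \<in> B \<Longrightarrow> g x \<in> ideal_gen X) \<Longrightarrow> sum g B \<in> ideal_gen X"
  by (induction B rule: infinite_finite_induct) (auto intro: ideal_gen.zero ideal_gen.add)

lemma cst_central: "cst c * u = u * cst c"
proof -
  have *: "cst c * Poly_Mapping.single k d = Poly_Mapping.single k d * cst c" for k :: "'a word" and d
    by (simp add: cst_def mult_single mult.commute flip: zero_word_def)
  show ?thesis
  proof (induction u rule: update_induct)
    case (update f k d)
    then have "Poly_Mapping.update k d f = f + Poly_Mapping.single k d"
      by (intro poly_mapping_eqI)
        (auto simp: lookup_add lookup_single lookup_update in_keys_iff when_def)
    with update show ?case by (simp add: * algebra_simps)
  qed simp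
qed

text \<open>The image of the generating series of the \<open_dummy>\<close>

definition Dtser :: "nat \<Rightarrow> (nat \<Rightarrow> nat) \<Rightarrow> nat \<Rightarrow> (nat \<Rightarrow> nat) \<Rightarrow> (nat \<Rightarrow> int) \<Rightarrow> (nat \<Rightarrow> complex)
    \<Rightarrow> nat \<Rightarrow> agen freealg fps" where
  "Dtser n a N ii \<gamma> x i = -
     (prod_list (map (\<lambda>r. geom (pp i r)) [1..<ac n a i + 1])
   * prod_list (map (\<lambda>r. 1 - fps_const (1 + pp (i - 1) r) * fps_X) [1..<ac n a (i - 1) + 1])
   * prod_list (map (\<lambda>s. if \<gamma> s = 1 then geom (cst (x s)) else 1 - fps_const (cst (x s)) * fps_X)
                    (filter (\<lambda>s. ii s < i) [1..<N + 1])))"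

definition Dtimg :: "nat \<Rightarrow> (nat \<Rightarrow> nat) \<Rightarrow> nat \<Rightarrow> (nat \<Rightarrow> nat) \<Rightarrow> (nat \<Rightarrow> int) \<Rightarrow> (nat \<Rightarrow> complex)
    \<Rightarrow> nat \<Rightarrow> int \<Rightarrow> agen freealg" where
  "Dtimg n a N ii \<gamma> x i r =
     (if 0 \<le> r - Ddeg n a N ii \<gamma> i then fps_nth (Dtser n a N ii \<gamma> x i) (nat (r - Ddeg n a N ii \<gamma> i)) else 0)"

definition relations_hold :: "nat \<Rightarrow> (nat \<Rightarrow> nat) \<Rightarrow> bool" where
  "relations_hold n a \<longleftrightarrow> (\<forall>N ii \<gamma> x d.
     (\<forall>s\<in>{1..N}. ii s \<noteq> 0 \<longrightarrow> \<gamma> s = 1) \<longrightarrow> (\<forall>i. 1 \<le> i \<and> i \<le> n \<longrightarrow> d i = - Ddeg n a N ii \<gamma> i) \<longrightarrow>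
     Yrels n d (Eimg n a N ii x) (Fimg n a) (Dimg n a N ii \<gamma> x) (Dtimg n a N ii \<gamma> x) \<subseteq> AIdeal n a)"

text \<open>The quotient of the free algebra by \<^term>\<open>AIdeal n a\<close> depends on \<^term>\<open>n\<close> and \<^term>\<open>a\<close>, so it is not a
  type. To work in a type nevertheless, we only form the quotient for one pair, chosen to be a
  counterexample to \<^const>\<open>relations_hold\<close> if there is one; the fallback value makes the quotient
  ring nontrivial in any case.\<close>

definition bad_index :: "nat \<times> (nat \<Rightarrow> nat) \<Rightarrow> bool" where
  "bad_index = (\<lambda>(n, a). 1 \<notin> AIdeal n a \<and> \<not> relations_hold n a)"

definition worst_index :: "nat \<times> (nat \<Rightarrow> nat)" where
  "worst_index = (if \<exists>k. bad_index k then SOME k. bad_index k else (0, \<lambda>_. 0))"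

definition n0 :: nat where "n0 = fst worst_index"
definition a0 :: "nat \<Rightarrow> nat" where "a0 = snd worst_index"

lemma one_notin_worst: "1 \<notin> AIdeal n0 a0"
proof (cases "\<exists>k. bad_index k")
  case True
  then have "bad_index worst_index" unfolding worst_index_def using someI_ex[OF True] by simp
  then show ?thesis by (simp add: bad_index_def n0_def a0_def case_prod_beta)
next
  case False
  have "x = 0" if "x \<in> ideal_gen {}" for x :: "agen freealg"
    using that by induction auto
  then have "1 \<notin> ideal_gen ({} :: agen freealg set)" using one_neq_zero by blast
  moreover have "Arels 0 (\<lambda>_. 0) = {}" by (auto simp: Arels_def Agens_def)
  ultimately show ?thesis using False by (auto simp: AIdeal_def n0_def a0_def worst_index_def)
qed

quotient_type qalg = "agen freealg" / "\<lambda>x y. x - y \<in> AIdeal n0 a0"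
proof (rule equivpI)
  show "reflp (\<lambda>x y. x - y \<in> AIdeal n0 a0)"
    by (rule reflpI) (simp add: AIdeal_def ideal_gen.zero)
  show "symp (\<lambda>x y. x - y \<in> AIdeal n0 a0)"
    by (rule sympI) (auto simp: AIdeal_def intro: ideal_gen_diff_swap)
  show "transp (\<lambda>x y. x - y \<in> AIdeal n0 a0)"
    by (rule transpI) (auto simp: AIdeal_def intro: ideal_gen_diff_trans)
qed

instantiation qalg :: ring_1
begin

lift_definition zero_qalg :: qalg is 0 .
lift_definition one_qalg :: qalg is 1 .
lift_definition plus_qalg :: "qalg \<Rightarrow> qalg \<Rightarrow> qalg" is "(+)"
  unfolding AIdeal_def by (rule ideal_gen_diff_add)
lift_definition minus_qalg :: "qalg \<Rightarrow> qalg \<Rightarrow> qalg" is "(-)"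
  unfolding AIdeal_def by (rule ideal_gen_diff_diff)
lift_definition uminus_qalg :: "qalg \<Rightarrow> qalg" is uminus
  unfolding AIdeal_def by (simp add: ideal_gen_diff_swap)
lift_definition times_qalg :: "qalg \<Rightarrow> qalg \<Rightarrow> qalg" is "(*)"
  unfolding AIdeal_def by (rule ideal_gen_diff_mult)

instance
proof
  show "(0 :: qalg) \<noteq> 1"
    by transfer (use one_notin_worst ideal_gen_minus[of "- 1"] in \<open>auto simp: AIdeal_def\<close>)
qed (transfer; simp add: AIdeal_def ideal_gen.zero algebra_simps)+

end

abbreviation qproj :: "agen freealg \<Rightarrow> qalg" where "qproj \<equiv> abs_qalg"

lemma qproj_zero_iff: "qproj x = 0 \<longleftrightarrow> x \<in> AIdeal n0 a0"
  by (simp add: zero_qalg_def qalg.abs_eq_iff)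

interpretation qproj: unital_hom qproj
  by standard (simp_all add: plus_qalg.abs_eq times_qalg.abs_eq one_qalg_def)

lemma qproj_relation: "x - y \<in> Arels n0 a0 \<Longrightarrow> qproj x = qproj y"
  using qproj_zero_iff[of "x - y"] by (simp add: AIdeal_def ideal_gen.base qproj.\<iota>_diff)

definition cgens :: "qalg set" where
  "cgens = {qproj (pp i r) | i r. AP i r \<in> Agens n0 a0} \<union> range (\<lambda>c. qproj (cst c))"

lemma cgens_commute: "x \<in> cgens \<Longrightarrow> y \<in> cgens \<Longrightarrow> x * y = y * x"
proof -
  have c: "qproj (cst c) * qproj u = qproj u * qproj (cst c)" for c u
    by (simp flip: qproj.\<iota>_mult add: cst_central)
  have "qproj (pp i r) * qproj (pp j s) = qproj (pp j s) * qproj (pp i r)"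
    if "AP i r \<in> Agens n0 a0" "AP j s \<in> Agens n0 a0" for i r j s
  proof -
    have "comm (pp i r) (pp j s) \<in> Arels n0 a0" using that unfolding Arels_def by blast
    then show ?thesis using qproj_relation unfolding comm_def qproj.\<iota>_mult[symmetric] by blast
  qed
  with c show "x \<in> cgens \<Longrightarrow> y \<in> cgens \<Longrightarrow> x * y = y * x" unfolding cgens_def by auto
qed

text \<open>The bicommutant of the commuting elements \<^const>\<open>cgens\<close> is a commutative ring, and it is closed
  under inverses.\<close>

typedef calg = "{y. \<forall>z. (\<forall>g\<in>cgens. z * g = g * z) \<longrightarrow> y * z = z * y}"
  by (rule exI[of _ 1]) simp

setup_lifting type_definition_calg

instantiation calg :: comm_ring_1
begin

lift_definition zero_calg :: calg is 0 by simp
lift_definition one_calg :: calg is 1 by simp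
lift_definition plus_calg :: "calg \<Rightarrow> calg \<Rightarrow> calg" is "(+)" by (simp add: algebra_simps)
lift_definition minus_calg :: "calg \<Rightarrow> calg \<Rightarrow> calg" is "(-)" by (simp add: algebra_simps)
lift_definition uminus_calg :: "calg \<Rightarrow> calg" is uminus by simp
lift_definition times_calg :: "calg \<Rightarrow> calg \<Rightarrow> calg" is "(*)" by (metis mult.assoc)

instance
proof
  fix x y :: calg
  show "x * y = y * x"
  proof transfer
    fix x y :: qalg
    assume x: "\<forall>z. (\<forall>g\<in>cgens. z * g = g * z) \<longrightarrow> x * z = z * x"
      and y: "\<forall>z. (\<forall>g\<in>cgens. z * g = g * z) \<longrightarrow> y * z = z * y"
    have "y * g = g * y" if "g \<in> cgens" for g
      using y cgens_commute[OF that] by auto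
    then show "x * y = y * x" using x by blast
  qed
qed (transfer; simp add: algebra_simps)+

end

interpretation Rep_calg: comm_hom Rep_calg
  by standard (transfer; simp)+

lemma cgens_in_calg: "x \<in> cgens \<Longrightarrow> Rep_calg (Abs_calg x) = x"
  by (rule Abs_calg_inverse) auto

lemma inverse_in_calg:
  assumes "v * Rep_calg q = 1" "Rep_calg q * v = 1"
  shows "Rep_calg (Abs_calg v) = v"
proof (rule Abs_calg_inverse, rule CollectI, intro allI impI)
  fix z assume "\<forall>g\<in>cgens. z * g = g * z"
  then have z: "Rep_calg q * z = z * Rep_calg q" using Rep_calg[of q] by auto
  have "v * z = v * (z * Rep_calg q) * v" using assms by (simp add: mult.assoc)
  also have "\<dots> = (v * Rep_calg q) * z * v" by (simp add: z[symmetric] mult.assoc)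
  finally show "v * z = z * v" using assms by simp
qed

lemma AP_in_Agens: "AP i r \<in> Agens n a \<longleftrightarrow> r \<in> {1..ac n a i}"
  by (auto simp: Agens_def ac_def)

lemma AInv_in_Agens: "AInv i r s m \<in> Agens n a \<longleftrightarrow> r \<in> {1..ac n a i} \<and> s \<in> {1..ac n a i} \<and> r \<noteq> s"
  by (auto simp: Agens_def ac_def)

definition pC :: "nat \<Rightarrow> nat \<Rightarrow> calg" where "pC i r = Abs_calg (qproj (pp i r))"
definition vC :: "nat \<Rightarrow> nat \<Rightarrow> nat \<Rightarrow> int \<Rightarrow> calg" where "vC i r s m = Abs_calg (qproj (ainv i r s m))"
definition xC :: "(nat \<Rightarrow> complex) \<Rightarrow> nat \<Rightarrow> calg" where "xC x s = Abs_calg (qproj (cst (x s)))"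
definition R0 :: "nat \<Rightarrow> nat set" where "R0 i = {1..ac n0 a0 i}"

lemma Rep_pC: "r \<in> R0 i \<Longrightarrow> Rep_calg (pC i r) = qproj (pp i r)"
  unfolding pC_def by (rule cgens_in_calg) (auto simp: cgens_def AP_in_Agens R0_def)

lemma Rep_xC: "Rep_calg (xC x s) = qproj (cst (x s))"
  unfolding xC_def by (rule cgens_in_calg) (auto simp: cgens_def)

lemma
  assumes "r \<in> R0 i" "s \<in> R0 i" "r \<noteq> s"
  shows Rep_vC: "Rep_calg (vC i r s m) = qproj (ainv i r s m)"
    and vC_inv: "vC i r s m * (pC i r - pC i s + of_int m) = 1"
proof -
  have "AInv i r s m \<in> Agens n0 a0" using assms by (simp add: AInv_in_Agens R0_def)
  then have "ainv i r s m * (pp i r - pp i s + of_int m) - 1 \<in> Arels n0 a0"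
    "(pp i r - pp i s + of_int m) * ainv i r s m - 1 \<in> Arels n0 a0"
    unfolding Arels_def by blast+
  moreover have "Rep_calg (pC i r - pC i s + of_int m) = qproj (pp i r - pp i s + of_int m)"
    using assms by (simp only: Rep_calg.\<iota>_add Rep_calg.\<iota>_diff Rep_calg.\<iota>_of_int Rep_pC
        qproj.\<iota>_add qproj.\<iota>_diff qproj.\<iota>_of_int)
  ultimately have *: "qproj (ainv i r s m) * Rep_calg (pC i r - pC i s + of_int m) = 1"
    "Rep_calg (pC i r - pC i s + of_int m) * qproj (ainv i r s m) = 1"
    using qproj_relation qproj.\<iota>_one by (simp_all only: qproj.\<iota>_mult[symmetric])
  show "Rep_calg (vC i r s m) = qproj (ainv i r s m)"
    unfolding vC_def by (rule inverse_in_calg[OF *])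
  then have "Rep_calg (vC i r s m * (pC i r - pC i s + of_int m)) = Rep_calg 1"
    using * by (simp only: Rep_calg.\<iota>_mult Rep_calg.\<iota>_one)
  then show "vC i r s m * (pC i r - pC i s + of_int m) = 1"
    by (simp only: Rep_calg_inject)
qed

lemma gklo_calg:
  assumes "\<forall>s\<in>{1..N}. ii s \<noteq> 0 \<longrightarrow> \<gamma> s = 1"
  shows "gklo Rep_calg n0 N a0 ii \<gamma> R0 (xC x) pC vC (\<lambda>i r. qproj (eq i r)) (\<lambda>i r. qproj (eqi i r))"
proof
  fix i r j s assume r: "r \<in> R0 i" and s: "s \<in> R0 j"
  have A: "AP i r \<in> Agens n0 a0" "AP j s \<in> Agens n0 a0" using r s by (simp_all add: AP_in_Agens R0_def)
  have "comm (eq i r) (eq j s) \<in> Arels n0 a0" unfolding Arels_def using A by blast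
  then show "qproj (eq i r) * qproj (eq j s) = qproj (eq j s) * qproj (eq i r)"
    unfolding comm_def qproj.\<iota>_mult[symmetric] by (rule qproj_relation)
  have "comm (eq i r) (pp j s) + (if i = j \<and> r = s then eq i r else 0) \<in> Arels n0 a0"
    unfolding Arels_def
    by (intro UnI1, rule CollectI, rule exI[of _ i], rule exI[of _ r], rule exI[of _ j], rule exI[of _ s])
      (simp add: A)
  then have "eq i r * pp j s - (pp j s * eq i r - (if i = j \<and> r = s then eq i r else 0)) \<in> Arels n0 a0"
    by (simp only: comm_def diff_diff_eq2 diff_add_eq)
  then have "qproj (eq i r) * qproj (pp j s) = qproj (pp j s) * qproj (eq i r)
      - (if i = j \<and> r = s then qproj (eq i r) else 0)"
    using qproj_relation by (simp add: qproj.\<iota>_mult qproj.\<iota>_diff split: if_splits) (metis qproj.\<iota>_mult qproj.\<iota>_diff)+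
  then show "Rep_calg.shift (qproj (eq i r)) (pC j s) (pC j s - (if i = j \<and> r = s then 1 else 0))"
    unfolding Rep_calg.shift_def using s
    by (auto simp: Rep_pC Rep_calg.\<iota>_diff Rep_calg.\<iota>_one Rep_calg.\<iota>_zero left_diff_distrib)
next
  fix i r assume r: "r \<in> R0 i"
  then have A: "AP i r \<in> Agens n0 a0" by (simp add: AP_in_Agens R0_def)
  have "eq i r * eqi i r - 1 \<in> Arels n0 a0" "eqi i r * eq i r - 1 \<in> Arels n0 a0"
    unfolding Arels_def using A by blast+
  then show "qproj (eq i r) * qproj (eqi i r) = 1" "qproj (eqi i r) * qproj (eq i r) = 1"
    using qproj_relation qproj.\<iota>_one qproj.\<iota>_mult by metis+
  show "Rep_calg.shift (qproj (eq i r)) (xC x s) (xC x s)" for s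
    unfolding Rep_calg.shift_def Rep_xC by (simp only: qproj.\<iota>_mult[symmetric] cst_central)
qed (use assms vC_inv in \<open>auto simp: R0_def\<close>)

lemma qproj_prod_list:
  assumes "distinct ks" "\<And>k. k \<in> set ks \<Longrightarrow> qproj (g k) = Rep_calg (h k)"
  shows "qproj (prod_list (map g ks)) = Rep_calg (prod h (set ks))"
  using assms by (induction ks) (simp_all add: qproj.\<iota>_one Rep_calg.\<iota>_one qproj.\<iota>_mult Rep_calg.\<iota>_mult)

definition frep :: "agen freealg fps \<Rightarrow> calg fps \<Rightarrow> bool" where
  "frep F G \<longleftrightarrow> (\<forall>m. qproj (fps_nth F m) = Rep_calg (fps_nth G m))"

lemma frep_mult: "frep F F' \<Longrightarrow> frep G G' \<Longrightarrow> frep (F * G) (F' * G')"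
  by (simp add: frep_def fps_mult_nth qproj.\<iota>_sum Rep_calg.\<iota>_sum qproj.\<iota>_mult Rep_calg.\<iota>_mult)

lemma frep_uminus: "frep F F' \<Longrightarrow> frep (- F) (- F')"
  by (simp add: frep_def qproj.\<iota>_minus Rep_calg.\<iota>_minus)

lemma frep_prod_list:
  assumes "distinct ks" "\<And>k. k \<in> set ks \<Longrightarrow> frep (g k) (h k)"
  shows "frep (prod_list (map g ks)) (prod h (set ks))"
  using assms
proof (induction ks)
  case Nil
  then show ?case
    by (simp add: frep_def qproj.\<iota>_one Rep_calg.\<iota>_one qproj.\<iota>_zero Rep_calg.\<iota>_zero)
next
  case (Cons k ks)
  then show ?case by (simp add: frep_mult)
qed

lemma frep_linear: "qproj c = Rep_calg c' \<Longrightarrow> frep (1 - fps_const c * fps_X) (1 - fps_const c' * fps_X)"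
  by (auto simp: frep_def fps_X_def qproj.\<iota>_one Rep_calg.\<iota>_one qproj.\<iota>_zero Rep_calg.\<iota>_zero
      qproj.\<iota>_minus Rep_calg.\<iota>_minus)

lemma frep_geom: "qproj c = Rep_calg c' \<Longrightarrow> frep (geom c) (geom c')"
  by (simp add: frep_def geom_def qproj.\<iota>_power Rep_calg.\<iota>_power)

lemma qproj_Pev:
  assumes "qproj c = Rep_calg c'"
  shows "qproj (Pev n0 a0 j c) = Rep_calg (\<Prod>t\<in>R0 j. c' - pC j t)"
proof -
  have "set [1..<ac n0 a0 j + 1] = R0 j" by (auto simp: R0_def)
  moreover have "qproj (prod_list (map (\<lambda>t. c - pp j t) [1..<ac n0 a0 j + 1]))
      = Rep_calg (\<Prod>t\<in>set [1..<ac n0 a0 j + 1]. c' - pC j t)"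
    by (rule qproj_prod_list)
      (auto simp: assms qproj.\<iota>_diff Rep_calg.\<iota>_diff Rep_pC R0_def)
  ultimately show ?thesis by (simp only: Pev_def)
qed

lemma qproj_Zev:
  assumes "qproj c = Rep_calg c'"
  shows "qproj (Zev N ii x i c) = Rep_calg (\<Prod>s\<in>{s\<in>{1..N}. ii s = i}. c' - xC x s)"
proof -
  let ?l = "filter (\<lambda>s. ii s = i) [1..<N + 1]"
  have "set ?l = {s\<in>{1..N}. ii s = i}" by auto
  moreover have "qproj (prod_list (map (\<lambda>s. c - cst (x s)) ?l)) = Rep_calg (\<Prod>s\<in>set ?l. c' - xC x s)"
    by (rule qproj_prod_list)
      (auto simp: assms qproj.\<iota>_diff Rep_calg.\<iota>_diff Rep_xC)
  ultimately show ?thesis by (simp only: Zev_def)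
qed

lemma qproj_invPir:
  assumes "r \<in> R0 i"
  shows "qproj (invPir a0 i r) = Rep_calg (\<Prod>s\<in>R0 i - {r}. vC i r s 0)"
proof -
  let ?l = "filter (\<lambda>s. s \<noteq> r) [1..<a0 i + 1]"
  have R: "R0 i = {1..a0 i}" using assms by (auto simp: R0_def ac_def split: if_splits)
  have set: "set ?l = R0 i - {r}" unfolding R by auto
  have "qproj (prod_list (map (\<lambda>s. ainv i r s 0) ?l)) = Rep_calg (\<Prod>s\<in>set ?l. vC i r s 0)"
  proof (rule qproj_prod_list)
    fix s assume "s \<in> set ?l"
    then have "s \<in> R0 i - {r}" by (simp only: set)
    then show "qproj (ainv i r s 0) = Rep_calg (vC i r s 0)" using assms by (simp add: Rep_vC)
  qed simp
  then show ?thesis by (simp only: invPir_def set)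
qed

lemma relations_hold_worst: "relations_hold n0 a0"
  unfolding relations_hold_def
proof (intro allI impI)
  fix N ii \<gamma> x d
  assume \<gamma>: "\<forall>s\<in>{1..N}. ii s \<noteq> 0 \<longrightarrow> \<gamma> s = 1"
    and d: "\<forall>i. 1 \<le> i \<and> i \<le> n0 \<longrightarrow> d i = - Ddeg n0 a0 N ii \<gamma> i"
  interpret G: gklo Rep_calg n0 N a0 ii \<gamma> R0 "xC x" pC vC "\<lambda>i r. qproj (eq i r)" "\<lambda>i r. qproj (eqi i r)"
    by (rule gklo_calg[OF \<gamma>])
  have R0: "{1..a0 i} = R0 i" if "1 \<le> i" "i < n0" for i
    using that by (simp add: R0_def ac_def)
  have E: "qproj (Eimg n0 a0 N ii x i k) = - G.E.J i (k - 1)" if i: "1 \<le> i" "i < n0" for i k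
  proof -
    have "qproj (Pev n0 a0 (i - 1) (pp i r - 1) * Zev N ii x i (pp i r) * invPir a0 i r * pp i r ^ (k - 1) * eq i r)
      = Rep_calg (G.E.cf (R0 (i - 1)) i r * pC i r ^ (k - 1)) * qproj (eq i r)" if r: "r \<in> R0 i" for r
    proof -
      have "qproj (pp i r - 1) = Rep_calg (pC i r - 1)"
        by (simp add: qproj.\<iota>_diff Rep_calg.\<iota>_diff qproj.\<iota>_one Rep_calg.\<iota>_one Rep_pC[OF r])
      note P = qproj_Pev[OF this] qproj_Zev[OF Rep_pC[OF r, symmetric]] qproj_invPir[OF r] Rep_pC[OF r, symmetric]
      have "(\<Prod>t\<in>R0 (i - 1). pC i r - 1 - pC (i - 1) t) = (\<Prod>t\<in>R0 (i - 1). pC i r - pC (i - 1) t - of_int 1)"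
        by (rule prod.cong) (simp_all add: algebra_simps)
      then show ?thesis
        unfolding qproj.\<iota>_mult qproj.\<iota>_power P G.E.cf_def G.ZE_def by (simp only: Rep_calg.\<iota>_mult Rep_calg.\<iota>_power)
    qed
    then show ?thesis
      unfolding Eimg_def G.E.J_def qproj.\<iota>_minus qproj.\<iota>_sum R0[OF i] by (simp only: cong: sum.cong)
  qed
  have F: "qproj (Fimg n0 a0 i k) = G.F.J i (k - 1)" if i: "1 \<le> i" "i < n0" for i k
  proof -
    have "qproj (Pev n0 a0 (i + 1) (pp i r + 1) * invPir a0 i r * (pp i r + 1) ^ (k - 1) * eqi i r)
      = Rep_calg (G.F.cf (R0 (Suc i)) i r * (pC i r + 1) ^ (k - 1)) * qproj (eqi i r)" if r: "r \<in> R0 i" for r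
    proof -
      have 1: "qproj (pp i r + 1) = Rep_calg (pC i r + 1)"
        by (simp add: qproj.\<iota>_add Rep_calg.\<iota>_add qproj.\<iota>_one Rep_calg.\<iota>_one Rep_pC[OF r])
      note P = qproj_Pev[OF 1] 1 qproj_invPir[OF r]
      have "(\<Prod>t\<in>R0 (i + 1). pC i r + 1 - pC (i + 1) t) = (\<Prod>t\<in>R0 (Suc i). pC i r + 1 - (pC (Suc i) t + 1) - of_int (- 1))"
        by (rule prod.cong) (simp_all add: algebra_simps)
      then show ?thesis
        unfolding qproj.\<iota>_mult qproj.\<iota>_power P G.F.cf_def by (simp only: Rep_calg.\<iota>_mult Rep_calg.\<iota>_power mult_1_right)
    qed
    then show ?thesis
      unfolding Fimg_def G.F.J_def qproj.\<iota>_sum R0[OF i] by (simp only: cong: sum.cong)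
  qed
  have sets: "set [1..<ac n0 a0 i + 1] = R0 i" "set (filter (\<lambda>s. ii s < i) [1..<N + 1]) = {s\<in>{1..N}. ii s < i}" for i
    by (auto simp: R0_def)
  have succ: "qproj (1 + pp i r) = Rep_calg (1 + pC i r)" if "r \<in> R0 i" for i r
    by (simp add: qproj.\<iota>_add Rep_calg.\<iota>_add qproj.\<iota>_one Rep_calg.\<iota>_one Rep_pC[OF that])
  have D: "frep (Dser n0 a0 N ii \<gamma> x i) (G.Dfps i)" for i
    unfolding Dser_def G.Dfps_def sets[symmetric]
    by (intro frep_mult frep_prod_list) (auto simp: R0_def Rep_pC Rep_xC succ intro!: frep_linear frep_geom)
  have Dt: "frep (Dtser n0 a0 N ii \<gamma> x i) (G.Dtfps i)" for i
    unfolding Dtser_def G.Dtfps_def sets[symmetric]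
    by (intro frep_uminus frep_mult frep_prod_list) (auto simp: R0_def Rep_pC Rep_xC succ intro!: frep_linear frep_geom)
  have "Yrels n0 d (Eimg n0 a0 N ii x) (Fimg n0 a0) (Dimg n0 a0 N ii \<gamma> x) (Dtimg n0 a0 N ii \<gamma> x) \<subseteq> {X. qproj X = 0}"
  proof (rule G.Yrels_vanish)
    fix i t assume i: "1 \<le> i" "i \<le> n0"
    then have di: "d i = - Ddeg n0 a0 N ii \<gamma> i" using d by blast
    show "d i = - Ddeg n0 a0 N ii \<gamma> i" by (rule di)
    show "qproj (Dimg n0 a0 N ii \<gamma> x i t) = Rep_calg (coeff_int (G.Dfps i) (t - d i))"
      using D[of i] by (simp add: Dimg_def coeff_int_def frep_def di qproj.\<iota>_zero Rep_calg.\<iota>_zero)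
    show "qproj (Dtimg n0 a0 N ii \<gamma> x i t) = Rep_calg (coeff_int (G.Dtfps i) (t + d i))"
      using Dt[of i] by (simp add: Dtimg_def coeff_int_def frep_def di qproj.\<iota>_zero Rep_calg.\<iota>_zero)
  qed (use E F qproj.unital_hom_axioms in auto)
  then show "Yrels n0 d (Eimg n0 a0 N ii x) (Fimg n0 a0) (Dimg n0 a0 N ii \<gamma> x) (Dtimg n0 a0 N ii \<gamma> x) \<subseteq> AIdeal n0 a0"
    by (simp add: qproj_zero_iff)
qed

lemma relations_hold: "relations_hold n a"
proof (cases "1 \<in> AIdeal n a")
  case True
  then have "x \<in> AIdeal n a" for x
    using ideal_gen_left[of 1 _ x] by (simp add: AIdeal_def)
  then show ?thesis by (auto simp: relations_hold_def)
next
  case False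
  show ?thesis
  proof (rule ccontr)
    assume "\<not> relations_hold n a"
    with False have "bad_index (n, a)" by (simp add: bad_index_def)
    then have ex: "\<exists>k. bad_index k" by blast
    then have "bad_index worst_index" unfolding worst_index_def using someI_ex[OF ex] by simp
    then show False
      using relations_hold_worst by (simp add: bad_index_def n0_def a0_def case_prod_beta)
  qed
qed

section \<open>Existence and uniqueness\<close>

lemma over_zero: "over G 0" and over_one: "over G 1" and over_gen: "g \<in> G \<Longrightarrow> over G (gen g)"
  and over_cst: "over G (cst c)"
  by (auto simp: over_def zero_word_def gen_def cst_def split: if_splits)

lemma over_add: "over G u \<Longrightarrow> over G w \<Longrightarrow> over G (u + w)"
  using keys_add[of u w] by (auto simp: over_def)

lemma over_uminus: "over G u \<Longrightarrow> over G (- u)"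
  by (auto simp: over_def in_keys_iff)

lemma over_diff: "over G u \<Longrightarrow> over G w \<Longrightarrow> over G (u - w)"
  using over_add[OF _ over_uminus, of G u w] by simp

lemma over_mult: "over G u \<Longrightarrow> over G w \<Longrightarrow> over G (u * w)"
  using keys_mult[of u w] by (fastforce simp: over_def plus_word_def)

lemma over_power: "over G u \<Longrightarrow> over G (u ^ k)"
  by (induction k) (auto intro: over_one over_mult)

lemma over_sum: "(\<And>k. k \<in> K \<Longrightarrow> over G (g k)) \<Longrightarrow> over G (sum g K)"
  by (induction K rule: infinite_finite_induct) (auto intro: over_zero over_add)

lemma over_prod_list: "(\<And>k. k \<in> set ks \<Longrightarrow> over G (g k)) \<Longrightarrow> over G (prod_list (map g ks))"
  by (induction ks) (auto intro: over_one over_mult)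

definition fps_over :: "'g set \<Rightarrow> 'g freealg fps \<Rightarrow> bool" where
  "fps_over G F \<longleftrightarrow> (\<forall>m. over G (fps_nth F m))"

lemma fps_over_mult: "fps_over G F \<Longrightarrow> fps_over G H \<Longrightarrow> fps_over G (F * H)"
  by (auto simp: fps_over_def fps_mult_nth intro: over_sum over_mult)

lemma fps_over_uminus: "fps_over G F \<Longrightarrow> fps_over G (- F)"
  by (auto simp: fps_over_def intro: over_uminus)

lemma fps_over_prod_list: "(\<And>k. k \<in> set ks \<Longrightarrow> fps_over G (g k)) \<Longrightarrow> fps_over G (prod_list (map g ks))"
proof (induction ks)
  case Nil
  then show ?case by (simp add: fps_over_def over_zero over_one)
qed (simp add: fps_over_mult)

lemma fps_over_linear: "over G c \<Longrightarrow> fps_over G (1 - fps_const c * fps_X)"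
  by (auto simp: fps_over_def fps_X_def over_zero over_one over_uminus)

lemma fps_over_geom: "over G c \<Longrightarrow> fps_over G (geom c)"
  by (simp add: fps_over_def geom_def over_power)

lemma over_pp: "r \<in> {1..ac n a i} \<Longrightarrow> over (Agens n a) (pp i r)"
  by (simp add: over_gen AP_in_Agens)

lemma over_Pev: "over (Agens n a) c \<Longrightarrow> over (Agens n a) (Pev n a j c)"
  unfolding Pev_def by (intro over_prod_list over_diff over_pp) auto

lemma over_Zev: "over (Agens n a) c \<Longrightarrow> over (Agens n a) (Zev N ii x i c)"
  unfolding Zev_def by (intro over_prod_list over_diff over_cst)

lemma over_images:
  assumes i: "1 \<le> i" "i < n"
  shows "over (Agens n a) (Eimg n a N ii x i k)" "over (Agens n a) (Fimg n a i k)"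
proof -
  have ac: "ac n a i = a i" using i by (simp add: ac_def)
  have gens: "over (Agens n a) (pp i r)" "over (Agens n a) (eq i r)" "over (Agens n a) (eqi i r)"
    if "r \<in> {1..a i}" for r
    using that i by (auto intro!: over_gen simp: Agens_def)
  have inv: "over (Agens n a) (invPir a i r)" if "r \<in> {1..a i}" for r
    unfolding invPir_def using that ac by (intro over_prod_list over_gen) (auto simp: AInv_in_Agens split: if_splits)
  show "over (Agens n a) (Eimg n a N ii x i k)"
    unfolding Eimg_def
    by (intro over_uminus over_sum over_mult over_power over_Pev over_Zev over_diff over_one gens inv)
  show "over (Agens n a) (Fimg n a i k)"
    unfolding Fimg_def
    by (intro over_sum over_mult over_power over_Pev over_add over_one gens inv)
qed

lemma over_D_images:
  "over (Agens n a) (Dimg n a N ii \<gamma> x i t)" "over (Agens n a) (Dtimg n a N ii \<gamma> x i t)"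
proof -
  have "fps_over (Agens n a) (Dser n a N ii \<gamma> x i)"
    unfolding Dser_def
    by (intro fps_over_mult fps_over_prod_list)
      (auto intro!: fps_over_linear fps_over_geom over_add over_one over_cst over_pp)
  moreover have "fps_over (Agens n a) (Dtser n a N ii \<gamma> x i)"
    unfolding Dtser_def
    by (intro fps_over_uminus fps_over_mult fps_over_prod_list)
      (auto intro!: fps_over_linear fps_over_geom over_add over_one over_cst over_pp)
  ultimately show "over (Agens n a) (Dimg n a N ii \<gamma> x i t)" "over (Agens n a) (Dtimg n a N ii \<gamma> x i t)"
    by (auto simp: Dimg_def Dtimg_def fps_over_def over_zero)
qed

lemma ideal_gen_inverse_series_unique:
  fixes d :: int
  assumes D: "\<And>t. d \<le> t \<Longrightarrow> D t - D' t \<in> ideal_gen X" and one: "D d - 1 \<in> ideal_gen X"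
    and S: "\<And>r. (\<Sum>t\<in>{d..int r + d}. D t * Dt (int r - t)) + c r \<in> ideal_gen X"
    and S': "\<And>r. (\<Sum>t\<in>{d..int r + d}. D' t * Dt' (int r - t)) + c r \<in> ideal_gen X"
  shows "Dt (int r - d) - Dt' (int r - d) \<in> ideal_gen X"
proof (induction r rule: less_induct)
  case (less r)
  have split: "(\<Sum>t\<in>{d..int r + d}. g t) = g d + (\<Sum>t\<in>{d<..int r + d}. g t)" for g :: "int \<Rightarrow> 'a"
  proof -
    have "{d..int r + d} = insert d {d<..int r + d}" by auto
    then show ?thesis by simp
  qed
  have tail: "(\<Sum>t\<in>{d<..int r + d}. D t * Dt (int r - t) - D' t * Dt' (int r - t)) \<in> ideal_gen X"
  proof (intro ideal_gen_sum ideal_gen_diff_mult)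
    fix t assume t: "t \<in> {d<..int r + d}"
    then show "D t - D' t \<in> ideal_gen X" using D by simp
    have "int r - t = int (nat (int r + d - t)) - d" "nat (int r + d - t) < r" using t by auto
    then show "Dt (int r - t) - Dt' (int r - t) \<in> ideal_gen X"
      using less by metis
  qed
  have head_eq: "D d * Dt (int r - d) - D' d * Dt' (int r - d)
    = (\<Sum>t\<in>{d..int r + d}. D t * Dt (int r - t)) + c r - ((\<Sum>t\<in>{d..int r + d}. D' t * Dt' (int r - t)) + c r)
      - (\<Sum>t\<in>{d<..int r + d}. D t * Dt (int r - t) - D' t * Dt' (int r - t))"
    unfolding split sum_subtractf by simp
  have head: "D d * Dt (int r - d) - D' d * Dt' (int r - d) \<in> ideal_gen X"
    unfolding head_eq by (rule ideal_gen_diff[OF ideal_gen_diff[OF S S'] tail])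
  have "Dt (int r - d) - Dt' (int r - d) = D d * Dt (int r - d) - D' d * Dt' (int r - d)
    - (D d - 1) * Dt (int r - d) + (D d - 1) * Dt' (int r - d) - (D d - D' d) * Dt' (int r - d)"
    by (simp add: algebra_simps)
  also have "\<dots> \<in> ideal_gen X"
    by (intro ideal_gen_diff ideal_gen.add ideal_gen_right head one D order_refl)
  finally show ?case .
qed

lemma Yrels_Y0:
  assumes "1 \<le> i" "i \<le> n"
  shows "D i (d i) - 1 \<in> Yrels n d E F D Dt"
    and "(\<Sum>t\<in>{d i..int r + d i}. D i t * Dt i (int r - t)) + (if r = 0 then 1 else 0) \<in> Yrels n d E F D Dt"
proof -
  show "D i (d i) - 1 \<in> Yrels n d E F D Dt"
    unfolding Yrels_def using assms by (intro UnI1) blast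
  show "(\<Sum>t\<in>{d i..int r + d i}. D i t * Dt i (int r - t)) + (if r = 0 then 1 else 0) \<in> Yrels n d E F D Dt"
    unfolding Yrels_def Un_assoc using assms
    by (intro UnI2[OF UnI1] CollectI exI[of _ i] exI[of _ r] conjI refl)
qed

lemma shift_eq_Ddeg:
  assumes "1 \<le> j" and eq: "(\<Sum>s\<in>{1..N}. \<gamma> s * varpi (ii s) j) + m = (\<Sum>i\<in>{1..<n}. int (a i) * alpha i j)"
  shows "m = Ddeg n a N ii \<gamma> j"
proof -
  have "(\<Sum>s\<in>{1..N}. \<gamma> s * varpi (ii s) j) = - (\<Sum>s\<in>{1..N}. if ii s < j then \<gamma> s else 0)"
    unfolding sum_negf[symmetric] by (rule sum.cong) (auto simp: varpi_def)
  also have "(\<Sum>s\<in>{1..N}. if ii s < j then \<gamma> s else 0) = (\<Sum>s\<in>{s\<in>{1..N}. ii s < j}. \<gamma> s)"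
    by (rule sum.inter_filter[symmetric]) simp
  finally have 1: "(\<Sum>s\<in>{1..N}. \<gamma> s * varpi (ii s) j) = - (\<Sum>s\<in>{s\<in>{1..N}. ii s < j}. \<gamma> s)" .
  have "(\<Sum>i\<in>{1..<n}. int (a i) * alpha i j)
    = (\<Sum>i\<in>{1..<n}. (if i = j then int (a i) else 0) - (if i = j - 1 then int (a i) else 0))"
    using assms(1) by (intro sum.cong) (auto simp: alpha_def)
  also have "\<dots> = int (ac n a j) - int (ac n a (j - 1))"
    unfolding sum_subtractf by (simp add: ac_def)
  finally show ?thesis using eq 1 by (simp add: Ddeg_def)
qed

theorem theorem2p10:
  fixes n N :: nat
    and ii :: "nat \<Rightarrow> nat" and \<gamma> :: "nat \<Rightarrow> int" and x :: "nat \<Rightarrow> complex"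
    and \<mu> :: "nat \<Rightarrow> int" and a :: "nat \<Rightarrow> nat"
  assumes "n \<ge> 2"
    and "\<forall>s\<in>{1..N}. ii s < n"
    and "\<forall>s\<in>{1..N}. (ii s \<noteq> 0 \<longrightarrow> \<gamma> s = 1) \<and> (ii s = 0 \<longrightarrow> \<gamma> s = 1 \<or> \<gamma> s = -1)"
    and "\<forall>j\<in>{1..n}. (\<Sum>s\<in>{1..N}. \<gamma> s * varpi (ii s) j) + \<mu> j
                     = (\<Sum>i\<in>{1..<n}. int (a i) * alpha i j)"
  shows "\<exists>E F D Dt. Yhom n a (\<lambda>i. - \<mu> i) E F D Dt
            \<and> Psi_formulas n a (\<lambda>i. - \<mu> i) N ii \<gamma> x E F D
            \<and> (\<forall>E' F' D' Dt'. Yhom n a (\<lambda>i. - \<mu> i) E' F' D' Dt'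
                 \<and> Psi_formulas n a (\<lambda>i. - \<mu> i) N ii \<gamma> x E' F' D'
                 \<longrightarrow> same_hom n a (\<lambda>i. - \<mu> i) E F D Dt E' F' D' Dt')"
proof -
  let ?d = "\<lambda>i. - \<mu> i"
  let ?E = "Eimg n a N ii x" and ?F = "Fimg n a"
    and ?D = "Dimg n a N ii \<gamma> x" and ?Dt = "Dtimg n a N ii \<gamma> x"
  have \<mu>: "\<mu> i = Ddeg n a N ii \<gamma> i" if "1 \<le> i" "i \<le> n" for i
    by (rule shift_eq_Ddeg) (use that assms(4) in auto)
  have rels: "Yrels n ?d ?E ?F ?D ?Dt \<subseteq> AIdeal n a"
    using relations_hold[of n a] assms(3) \<mu> unfolding relations_hold_def by auto
  have "Yhom n a ?d ?E ?F ?D ?Dt"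
    unfolding Yhom_def by (simp add: rels over_images over_D_images)
  moreover have "Psi_formulas n a ?d N ii \<gamma> x ?E ?F ?D"
    unfolding Psi_formulas_def by (auto simp: AIdeal_def ideal_gen.zero \<mu> Dimg_def)
  moreover have "same_hom n a ?d ?E ?F ?D ?Dt E' F' D' Dt'"
    if Y: "Yhom n a ?d E' F' D' Dt'" and Psi: "Psi_formulas n a ?d N ii \<gamma> x E' F' D'" for E' F' D' Dt'
  proof -
    have EF: "?E i k - E' i k \<in> AIdeal n a" "?F i k - F' i k \<in> AIdeal n a" if "1 \<le> i" "i < n" "1 \<le> k" for i k
      using Psi that unfolding Psi_formulas_def AIdeal_def by (blast intro: ideal_gen_diff_swap)+
    have D: "?D i t - D' i t \<in> AIdeal n a" if "1 \<le> i" "i \<le> n" "?d i \<le> t" for i t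
    proof -
      have "(if ?d i \<le> t then D' i t else 0) - ?D i t \<in> AIdeal n a"
        using Psi that(1,2) unfolding Psi_formulas_def by blast
      with that(3) show ?thesis unfolding AIdeal_def by (simp add: ideal_gen_diff_swap)
    qed
    have Dt: "?Dt i t - Dt' i t \<in> AIdeal n a" if i: "1 \<le> i" "i \<le> n" and t: "- ?d i \<le> t" for i t
    proof -
      have "?Dt i (int (nat (t + ?d i)) - ?d i) - Dt' i (int (nat (t + ?d i)) - ?d i) \<in> ideal_gen (Arels n a)"
      proof (rule ideal_gen_inverse_series_unique)
        show "?D i s - D' i s \<in> ideal_gen (Arels n a)" if "?d i \<le> s" for s
          using D[OF i that] by (simp add: AIdeal_def)
        show "?D i (?d i) - 1 \<in> ideal_gen (Arels n a)"
          using Yrels_Y0(1)[OF i, of ?D ?d ?E ?F ?Dt] rels unfolding AIdeal_def by blast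
        show "(\<Sum>t\<in>{?d i..int r + ?d i}. ?D i t * ?Dt i (int r - t)) + (if r = 0 then 1 else 0)
          \<in> ideal_gen (Arels n a)" for r
          using Yrels_Y0(2)[OF i, of ?D ?Dt r ?d ?E ?F] rels unfolding AIdeal_def by blast
        show "(\<Sum>t\<in>{?d i..int r + ?d i}. D' i t * Dt' i (int r - t)) + (if r = 0 then 1 else 0)
          \<in> ideal_gen (Arels n a)" for r
          using Yrels_Y0(2)[OF i, of D' Dt' r ?d E' F'] Y unfolding Yhom_def AIdeal_def by blast
      qed
      with t show ?thesis by (simp add: AIdeal_def)
    qed
    show ?thesis unfolding same_hom_def using EF D Dt by blast
  qed
  ultimately show ?thesis by blast
qed

end
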